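(* Let $G$ be a compact group and let $\mu=(\mu_k)_{k\in-\mathbf N}$ be a sequence of Borel probability measures on $G$. For any extremal point $\mathbf P^o\in\mathrm{ex}(\mathcal P_\mu)$, the inclusion $$H_\mu(\mathbf P^o)\subset H^s_\mu$$ holds. If $G$ is abelian, then the equality $H_\mu(\mathbf P^o)=H^s_\mu$ holds for any extremal point $\mathbf P^o$.
   Context: $-\mathbf N=\{0,-1,-2,\dots\}$. On $G^{-\mathbf N}$ let $\eta=(\eta_k)_{k\in-\mathbf N}$ be the coordinate process, and set $\xi_k=(\eta_{k-1})^{-1}\cdot\eta_k$ for $k\in-\mathbf N$. Let $\mathcal F^\eta_k=\sigma(\eta_k,\eta_{k-1},\dots)$ and $\mathcal F^\xi_k=\sigma(\xi_k,\xi_{k-1},\dots)$. A solution (of $\eta_k=\eta_{k-1}\cdot\xi_k$, $k\in-\mathbf N$, with noise law $\mu$) is a probability measure $\mathbf P$ on $G^{-\mathbf N}$ such that, for every $k\in-\mathbf N$, under $\mathbf P$: (i) $\xi_k$ is independent of $\mathcal F^\eta_{k-1}$; (ii) $\xi_k$ has law $\mu_k$. The set of all solutions is $\mathcal P_\mu$; it is convex and $\mathrm{ex}(\mathcal P_\mu)$ is its set of extremal points. For $g\in G$ and $\mathbf P\in\mathcal P_\mu$, $T_g(\mathbf P)(\cdot)=\mathbf P(g\cdot\eta\in\cdot)$, where $g\cdot\eta=(g\cdot\eta_k)_{k\in-\mathbf N}$. For $\mathbf P^o\in\mathrm{ex}(\mathcal P_\mu)$, $H_\mu(\mathbf P^o)=\{g\in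 G: T_g(\mathbf P^o)=\mathbf P^o\}$. Let $\mathcal G$ be the totality of irreducible unitary representations of $G$ on finite-dimensional spaces. For $\mathbf P^o\in\mathrm{ex}(\mathcal P_\mu)$ let $\mathcal H^s_\mu$ be the set of $\rho\in\mathcal G$ such that, for every $k\in-\mathbf N$, $\rho(\eta_k)$ is $\mathcal F^\xi_k$-measurable $\mathbf P^o$-a.s. (i.e. coincides $\mathbf P^o$-a.s. with an $\mathcal F^\xi_k$-measurable random element); this set does not depend on the choice of $\mathbf P^o\in\mathrm{ex}(\mathcal P_\mu)$. Set $H^s_\mu=\{g\in G:\rho(g)=\mathrm{id}\text{ for every }\rho\in\mathcal H^s_\mu\}$.
   Formalization: Compact groups are Hausdorff, G^{-N} carries its Borel σ-field, and solutions are required to be Radon (regular) probability measures; this is automatic if G has a countable base, and without it the equality for abelian G can fail on non-metrizable groups. *)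

theory Defs
  imports "HOL-Probability.Probability" "Jordan_Normal_Form.Schur_Decomposition"
begin

text \<open>
  Conventions. The compact group is a Hausdorff topological group of type \<open>'g\<close>; it is
  written additively because \<open>topological_group_add\<close> is the topological group class of the
  library. Addition is not assumed to be commutative. The time \<open>-k\<close> is encoded by the
  natural number \<open>k\<close>, so that \<open>Suc k\<close> stands for the time preceding that of \<open>k\<close>.
  Sample paths have type \<open>nat \<Rightarrow> 'g\<close> and carry the product topology.
\<close>

definition coord :: "nat \<Rightarrow> (nat \<Rightarrow> 'g) \<Rightarrow> 'g" where
  "coord k \<omega> = \<omega> k"

definition noise :: "nat \<Rightarrow> (nat \<Rightarrow> 'g::group_add) \<Rightarrow> 'g" where
  "noise k \<omega> = - coord (Suc k) \<omega> + coord k \<omega>"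

text \<open>The \<open>\<sigma>\<close>-field generated by \<open>X j\<close> for \<open>j \<ge> k\<close>, that is, by the times up to \<open>-k\<close>.\<close>

definition past :: "(nat \<Rightarrow> 'a \<Rightarrow> 'g::topological_space) \<Rightarrow> nat \<Rightarrow> 'a measure" where
  "past X k = sigma UNIV {X j -` B | j B. j \<ge> k \<and> B \<in> sets borel}"

text \<open>
  A probability measure on a compact Hausdorff space is, as usual, a regular (Radon) Borel
  probability measure. Lemma \<open>solutions_second_countable\<close> below shows that the condition is
  redundant for groups with a countable base, in which case the Borel \<open>\<sigma>\<close>-field of the path space
  is also the product \<open>\<sigma>\<close>-field (\<open>sets_PiM_equal_borel\<close>).
\<close>

definition radon_prob :: "'a::topological_space measure \<Rightarrow> bool" where
  "radon_prob P \<longleftrightarrow> prob_space P \<and> sets P = sets borel \<and>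
     (\<forall>B\<in>sets borel. emeasure P B = (SUP K\<in>{K. K \<subseteq> B \<and> compact K}. emeasure P K))"

lemma radon_prob_second_countable:
  fixes P :: "'a::second_countable_topology measure"
  assumes comp: "compact (UNIV :: 'a set)" and haus: "Hausdorff_space (euclidean :: 'a topology)"
    and "prob_space P" and sb: "sets P = sets borel"
  shows "radon_prob P"
proof -
  interpret prob_space P by fact
  define R where "R B \<longleftrightarrow> (\<forall>e>0. \<exists>K U. closed K \<and> open U \<and> K \<subseteq> B \<and> B \<subseteq> U \<and> measure P (U - K) < e)"
    for B
  have sp: "space P = UNIV" using sb by (metis sets_eq_imp_space_eq space_borel)
  have [simp]: "A \<in> sets P" if "open A" for A using that by (simp add: sb)
  have [simp]: "A \<in> sets P" if "closed A" for A using that by (simp add: sb)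
  have reg: "\<exists>W. open W \<and> x \<in> W \<and> closure W \<subseteq> V" if "open V" "x \<in> V" for x and V :: "'a set"
  proof -
    have "regular_space (euclidean :: 'a topology)"
      by (rule compact_Hausdorff_imp_regular_space)
        (use comp haus in \<open>simp_all add: compact_space_def\<close>)
    then have "\<exists>W. openin euclidean W \<and> x \<in> W \<and> disjnt (- V) (closure W)"
      using that unfolding regular_space by (auto dest!: spec[of _ "- V"])
    then show ?thesis by (auto simp: disjnt_def)
  qed
  have R_open: "R V" if V: "open V" for V
    unfolding R_def
  proof (intro allI impI)
    fix e :: real assume e: "e > 0"
    obtain \<B> :: "'a set set" where \<B>: "countable \<B>" "topological_basis \<B>"
      using ex_countable_basis by blast
    define C where "C = insert {} (closure ` {b \<in> \<B>. closure b \<subseteq> V})"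
    have C: "countable C" "C \<noteq> {}" using \<B> by (auto simp: C_def)
    have CV: "\<Union>C = V"
    proof
      show "V \<subseteq> \<Union>C"
      proof
        fix x assume "x \<in> V"
        then obtain W where W: "open W" "x \<in> W" "closure W \<subseteq> V" using reg V by blast
        then obtain b where b: "b \<in> \<B>" "x \<in> b" "b \<subseteq> W"
          using \<B>(2) topological_basisE by blast
        then have "closure b \<subseteq> V" using W closure_mono by blast
        then show "x \<in> \<Union>C" using b closure_subset[of b] by (auto simp: C_def)
      qed
    qed (auto simp: C_def)
    define F where "F n = (\<Union>i<n. from_nat_into C i)" for n
    have cl: "closed (from_nat_into C i)" for i
      using from_nat_into[OF C(2), of i] by (auto simp: C_def)
    have clF: "closed (F n)" for n by (auto simp: F_def intro: cl)
    have UF: "(\<Union>n. F n) = V"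
    proof -
      have "(\<Union>n. F n) = (\<Union>i. from_nat_into C i)" by (auto simp: F_def)
      also have "\<dots> = \<Union>C" using range_from_nat_into[OF C(2,1)] by simp
      finally show ?thesis using CV by simp
    qed
    have "(\<lambda>n. measure P (F n)) \<longlonglongrightarrow> measure P (\<Union>n. F n)"
    proof (rule finite_Lim_measure_incseq)
      show "range F \<subseteq> sets P" using clF by auto
      show "incseq F" unfolding incseq_def F_def by (intro allI impI UN_mono) auto
    qed
    then have "\<forall>\<^sub>F n in sequentially. measure P (F n) > measure P V - e"
      using e UF by (intro order_tendstoD) auto
    then obtain n where n: "measure P (F n) > measure P V - e"
      using eventually_happens trivial_limit_sequentially by blast
    have FV: "F n \<subseteq> V" using UF by blast
    have "measure P (V - F n) = measure P V - measure P (F n)"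
      using FV V clF by (intro finite_measure_Diff) auto
    then show "\<exists>K U. closed K \<and> open U \<and> K \<subseteq> V \<and> V \<subseteq> U \<and> measure P (U - K) < e"
      using n FV V clF by (intro exI[of _ "F n"] exI[of _ V]) auto
  qed
  have R: "R B" if "B \<in> sets borel" for B
  proof -
    have "B \<in> sigma_sets UNIV {S. open S}" using that by (simp add: borel_def)
    then show ?thesis
    proof induction
      case (Basic a) then show ?case using R_open by simp
    next
      case Empty show ?case using R_open by simp
    next
      case (Compl a)
      show ?case unfolding R_def
      proof (intro allI impI)
        fix e :: real assume e: "e > 0"
        obtain K U where KU: "closed K" "open U" "K \<subseteq> a" "a \<subseteq> U" "measure P (U - K) < e"
          using Compl(2)[unfolded R_def, rule_format, OF e] by blast
        have "- K - - U = U - K" by auto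
        then have "closed (- U) \<and> open (- K) \<and> - U \<subseteq> UNIV - a \<and> UNIV - a \<subseteq> - K \<and>
            measure P (- K - - U) < e"
          using KU(3-5) closed_Compl[OF KU(2)] open_Compl[OF KU(1)] by simp blast
        then show "\<exists>K U. closed K \<and> open U \<and> K \<subseteq> UNIV - a \<and> UNIV - a \<subseteq> U \<and> measure P (U - K) < e"
          by blast
      qed
    next
      case (Union a)
      show ?case unfolding R_def
      proof (intro allI impI)
        fix e :: real assume e: "e > 0"
        have "\<forall>i. \<exists>K U. closed K \<and> open U \<and> K \<subseteq> a i \<and> a i \<subseteq> U \<and>
            measure P (U - K) < e / 2 * (1/2) ^ Suc i"
        proof
          fix i
          have "0 < e / 2 * (1/2) ^ Suc i" using e by simp
          then show "\<exists>K U. closed K \<and> open U \<and> K \<subseteq> a i \<and> a i \<subseteq> U \<and>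
              measure P (U - K) < e / 2 * (1/2) ^ Suc i"
            by (rule Union(2)[unfolded R_def, rule_format])
        qed
        then obtain K U where KU: "\<And>i. closed (K i)" "\<And>i. open (U i)" "\<And>i. K i \<subseteq> a i"
          "\<And>i. a i \<subseteq> U i" "\<And>i. measure P (U i - K i) < e / 2 * (1/2) ^ Suc i"
          by metis
        define F where "F n = (\<Union>i<n. K i)" for n
        define V where "V = (\<Union>i. U i)"
        have clF: "closed (F n)" for n by (auto simp: F_def intro: KU)
        have oV: "open V" by (auto simp: V_def intro: KU)
        have mUK: "U i - K i \<in> sets P" for i using KU(1,2)[of i] by auto
        have ps: "(\<lambda>i. e / 2 * (1/2) ^ Suc i) sums (e / 2)"
          using sums_mult[OF power_half_series, of "e/2"] by simp
        have sm: "summable (\<lambda>i. measure P (U i - K i))"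
          by (rule summable_comparison_test'[OF sums_summable[OF ps]])
            (use KU(5) in \<open>simp add: less_imp_le\<close>)
        have "measure P (V - (\<Union>i. K i)) \<le> measure P (\<Union>i. U i - K i)"
          using mUK by (intro finite_measure_mono sets.countable_UN) (auto simp: V_def)
        also have "\<dots> \<le> (\<Sum>i. measure P (U i - K i))"
          using mUK by (intro finite_measure_subadditive_countably sm) auto
        also have "\<dots> \<le> (\<Sum>i. e / 2 * (1/2) ^ Suc i)"
          by (rule suminf_le[OF _ sm sums_summable[OF ps]]) (rule less_imp_le[OF KU(5)])
        also have "\<dots> = e / 2" using sums_unique[OF ps] by simp
        finally have le: "measure P (V - (\<Union>i. K i)) \<le> e / 2" .
        have "(\<lambda>n. measure P (V - F n)) \<longlonglongrightarrow> measure P (\<Inter>n. V - F n)"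
        proof (rule finite_Lim_measure_decseq)
          show "range (\<lambda>n. V - F n) \<subseteq> sets P" using clF oV by auto
          show "decseq (\<lambda>n. V - F n)"
            unfolding decseq_def F_def by (intro allI impI Diff_mono UN_mono) auto
        qed
        moreover have "(\<Inter>n. V - F n) = V - (\<Union>i. K i)" by (auto simp: F_def)
        ultimately have "(\<lambda>n. measure P (V - F n)) \<longlonglongrightarrow> measure P (V - (\<Union>i. K i))"
          by simp
        from order_tendstoD(2)[OF this, of e]
        have "\<forall>\<^sub>F n in sequentially. measure P (V - F n) < e"
          using le e by linarith
        then obtain n where n: "measure P (V - F n) < e"
          using eventually_happens trivial_limit_sequentially by blast
        have "F n \<subseteq> (\<Union>i. a i)" "(\<Union>i. a i) \<subseteq> V" using KU by (force simp: F_def V_def)+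
        then show "\<exists>K U. closed K \<and> open U \<and> K \<subseteq> (\<Union>i. a i) \<and> (\<Union>i. a i) \<subseteq> U \<and> measure P (U - K) < e"
          using n oV clF[of n] by (intro exI[of _ "F n"] exI[of _ V] conjI)
      qed
    qed
  qed
  have "emeasure P B = (SUP K\<in>{K. K \<subseteq> B \<and> compact K}. emeasure P K)" if B: "B \<in> sets borel" for B
  proof (rule ennreal_approx_SUP)
    show "emeasure P K \<le> emeasure P B" if "K \<in> {K. K \<subseteq> B \<and> compact K}" for K
      using that B by (intro emeasure_mono) (auto simp: sb)
    show "\<exists>K\<in>{K. K \<subseteq> B \<and> compact K}. emeasure P B \<le> emeasure P K + ennreal e" if e: "0 < e" for e
    proof -
      obtain K U where KU: "closed K" "open U" "K \<subseteq> B" "B \<subseteq> U" "measure P (U - K) < e"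
        using R[OF B, unfolded R_def, rule_format, OF e] by blast
      have "compact K" using compact_Int_closed[OF comp KU(1)] by simp
      have "measure P (B - K) \<le> measure P (U - K)"
        using KU by (intro finite_measure_mono) auto
      moreover have "measure P (B - K) = measure P B - measure P K"
        using KU B by (intro finite_measure_Diff) (auto simp: sb)
      ultimately have "measure P B \<le> measure P K + e" using KU(5) by linarith
      then have "emeasure P B \<le> emeasure P K + ennreal e"
        using e by (simp add: emeasure_eq_measure flip: ennreal_plus)
      with KU(3) \<open>compact K\<close> show ?thesis by (intro bexI[of _ K]) simp_all
    qed
  qed
  then show ?thesis using assms unfolding radon_prob_def by blast
qed

lemma compact_paths:
  assumes "compact (UNIV :: 'g::topological_space set)"
  shows "compact (UNIV :: (nat \<Rightarrow> 'g) set)"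
proof -
  have "compact_space (euclidean :: 'g topology)" using assms by (simp add: compact_space_def)
  then have "compact_space (product_topology (\<lambda>_::nat. euclidean :: 'g topology) UNIV)"
    unfolding compact_space_product_topology by simp
  then show ?thesis by (simp add: compact_space_def euclidean_product_topology)
qed

lemma Hausdorff_paths: "Hausdorff_space (euclidean :: (nat \<Rightarrow> 'g::t2_space) topology)"
proof -
  have "Hausdorff_space (product_topology (\<lambda>_::nat. euclidean :: 'g topology) UNIV)"
    unfolding Hausdorff_space_product_topology
    unfolding Hausdorff_space_def disjnt_def using hausdorff[where 'a = 'g]
    by (simp; metis)
  then show ?thesis by (simp add: euclidean_product_topology)
qed

definition solutions ::
    "(nat \<Rightarrow> 'g::{topological_group_add,t2_space} measure) \<Rightarrow> (nat \<Rightarrow> 'g) measure set" where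
  "solutions \<mu> = {P. radon_prob P \<and>
     (\<forall>k. prob_space.indep_set P (sets (vimage_algebra UNIV (noise k) borel))
                                 (sets (past coord (Suc k))) \<and>
          distr P borel (noise k) = \<mu> k)}"

lemma solutions_second_countable:
  fixes \<mu> :: "nat \<Rightarrow> 'g::{topological_group_add,t2_space,second_countable_topology} measure"
  assumes "compact (UNIV :: 'g set)"
  shows "solutions \<mu> = {P. prob_space P \<and> sets P = sets borel \<and>
     (\<forall>k. prob_space.indep_set P (sets (vimage_algebra UNIV (noise k) borel))
                                 (sets (past coord (Suc k))) \<and>
          distr P borel (noise k) = \<mu> k)}"
  using radon_prob_second_countable[OF compact_paths[OF assms] Hausdorff_paths]
  unfolding solutions_def by (auto simp: radon_prob_def)

text \<open>Extremal points are spelled out: measures do not form a vector space in the library, so \<open>extreme_point_of\<close> does not apply.\<close>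

definition extremal_solutions ::
    "(nat \<Rightarrow> 'g::{topological_group_add,t2_space} measure) \<Rightarrow> (nat \<Rightarrow> 'g) measure set" where
  "extremal_solutions \<mu> = {P \<in> solutions \<mu>.
     \<forall>Q\<in>solutions \<mu>. \<forall>R\<in>solutions \<mu>. \<forall>t::real. 0 < t \<and> t < 1 \<and>
       (\<forall>A\<in>sets borel. measure P A = t * measure Q A + (1 - t) * measure R A) \<longrightarrow> Q = R}"

definition translate :: "'g::{topological_group_add,t2_space} \<Rightarrow>
    (nat \<Rightarrow> 'g) measure \<Rightarrow> (nat \<Rightarrow> 'g) measure" where
  "translate g P = distr P borel (\<lambda>\<omega> k. g + \<omega> k)"

definition H_mu :: "(nat \<Rightarrow> 'g::{topological_group_add,t2_space}) measure \<Rightarrow> 'g set" where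
  "H_mu P = {g. translate g P = P}"

text \<open>
  Finite-dimensional unitary representations are taken in matrix form, that is, with respect to
  an orthonormal basis of the representation space; the second component is the dimension.
\<close>

definition unitary_rep ::
    "('g::topological_group_add \<Rightarrow> complex mat) \<Rightarrow> nat \<Rightarrow> bool" where
  "unitary_rep \<rho> n \<longleftrightarrow>
     (\<forall>g. \<rho> g \<in> carrier_mat n n \<and> mat_adjoint (\<rho> g) * \<rho> g = 1\<^sub>m n) \<and>
     (\<forall>g h. \<rho> (g + h) = \<rho> g * \<rho> h) \<and>
     (\<forall>i<n. \<forall>j<n. continuous_on UNIV (\<lambda>g. \<rho> g $$ (i, j)))"

definition invariant_subspace ::
    "('g \<Rightarrow> complex mat) \<Rightarrow> nat \<Rightarrow> complex Matrix.vec set \<Rightarrow> bool" where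
  "invariant_subspace \<rho> n W \<longleftrightarrow>
     W \<subseteq> carrier_vec n \<and> 0\<^sub>v n \<in> W \<and> (\<forall>v\<in>W. \<forall>w\<in>W. v + w \<in> W) \<and>
     (\<forall>c. \<forall>v\<in>W. c \<cdot>\<^sub>v v \<in> W) \<and> (\<forall>g. \<forall>v\<in>W. \<rho> g *\<^sub>v v \<in> W)"

definition irreducible_unitary_reps ::
    "(('g::topological_group_add \<Rightarrow> complex mat) \<times> nat) set" where
  "irreducible_unitary_reps = {(\<rho>, n). n > 0 \<and> unitary_rep \<rho> n \<and>
     (\<forall>W. invariant_subspace \<rho> n W \<longrightarrow> W = {0\<^sub>v n} \<or> W = carrier_vec n)}"

text \<open>
  \<open>past noise k\<close> is a strict sub-\<open>\<sigma>\<close>-field in general, so "a.s. measurable" is rendered by an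
  honestly measurable matrix-valued version \<open>Y\<close>. For extremal solutions the set is known not to
  depend on \<open>P\<close>; formally it is computed from the given \<open>P\<close>.
\<close>

definition strong_reps :: "(nat \<Rightarrow> 'g::{topological_group_add,t2_space}) measure \<Rightarrow>
    (('g \<Rightarrow> complex mat) \<times> nat) set" where
  "strong_reps P = {(\<rho>, n) \<in> irreducible_unitary_reps. \<forall>k. \<exists>Y.
     (\<forall>\<omega>. Y \<omega> \<in> carrier_mat n n) \<and>
     (\<forall>i<n. \<forall>j<n. (\<lambda>\<omega>. Y \<omega> $$ (i, j)) \<in> borel_measurable (past noise k)) \<and>
     (AE \<omega> in P. \<rho> (coord k \<omega>) = Y \<omega>)}"

definition Hs_mu :: "(nat \<Rightarrow> 'g::{topological_group_add,t2_space}) measure \<Rightarrow> 'g set" where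
  "Hs_mu P = {g. \<forall>(\<rho>, n)\<in>strong_reps P. \<rho> g = 1\<^sub>m n}"

end

theory Submission
  imports Defs
begin

text \<open>
  Write \<open>\<eta>\<close> for the coordinate process and \<open>\<xi>\<close> for the noise. A translation \<open>\<eta> \<mapsto> g + \<eta>\<close> does not change
  the noise, hence it fixes every function of the noise. If \<open>\<rho>(\<eta>)\<close> is a function of the noise and
  the law of \<open>\<eta>\<close> is invariant under \<open>g\<close>, then \<open>\<rho>(g + \<eta>) = \<rho>(\<eta>)\<close> almost surely, that is,
  \<open>\<rho>(g) = 1\<close>. This is the inclusion \<open>H_mu_subset_Hs_mu\<close>.

  For abelian \<open>G\<close> the converse rests on a dichotomy for characters \<open>\<phi>\<close> (\<open>character_dichotomy\<close>).
  Let \<open>m k\<close> be the conditional expectation of \<open>\<phi>(\<eta> k)\<close> given the noise up to time \<open>-k\<close>. Since the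
  noise at time \<open>-k\<close> is independent of everything earlier, \<open>m k = m (k+1) * \<phi>(\<xi> k)\<close>
  (\<open>cond_version_step\<close>), which is also the recursion that \<open>\<phi>(\<eta> k)\<close> satisfies. So the quotient
  \<open>m k / \<phi>(\<eta> k)\<close> does not depend on \<open>k\<close> and belongs to the remote past of \<open>\<eta>\<close>. The remote past is
  trivial, because conditioning on an event of the remote past yields again a solution, so that a
  nontrivial event would split an extremal solution (\<open>extremal_zero_one\<close>). Hence the quotient is a
  constant \<open>c\<close>. If \<open>c \<noteq> 0\<close>, then \<open>\<phi>(\<eta> k) = m k / c\<close> is a function of the noise; if \<open>c = 0\<close>, then
  \<open>\<phi>(\<eta> 0)\<close> is orthogonal to all bounded functions of the noise.

  A product of characters of finitely many coordinates is \<open>\<phi>(\<eta> 0)\<close> times a function of the noise,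
  where \<open>\<phi>\<close> is the product of the characters. Translation by \<open>g\<close> multiplies it by \<open>\<phi>(g)\<close>, and for
  \<open>g\<close> in \<open>Hs_mu P\<close> the dichotomy says that \<open>\<phi>(g) = 1\<close> or that the integral vanishes. So \<open>P\<close> and its
  translate integrate all these products in the same way (\<open>monomials_translate\<close>). By
  Stone-Weierstrass they integrate all continuous functions in the same way, and being Radon
  measures they are equal.

  Stone-Weierstrass applies because the characters of a compact abelian group separate points
  (\<open>characters_separate\<close>). To see this, an invariant mean on the continuous functions is
  obtained by averaging over finitely many translations. It turns the continuous
  functions into a convolution algebra, in which the even powers of a hermitian element, suitably
  normalised, converge to an idempotent (\<open>top_idempotent\<close>). Below every idempotent there is a
  minimal one, and a minimal idempotent is a multiple of a character.

  When \<open>G\<close> has no countable base, the noise need not be measurable with respect to the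
  \<open>\<sigma>\<close>-field generated by the coordinates, since a Borel set of \<open>G \<times> G\<close> need not belong to the product
  \<open>\<sigma>\<close>-field. Inner regularity of \<open>P\<close> makes it measurable up to null sets; this is why the past of
  the coordinates appears below in its almost sure version \<open>ae_past\<close>.
\<close>

section \<open>Compact Hausdorff spaces and function spaces\<close>

lemma continuous_slices:
  assumes "continuous_on UNIV (\<lambda>(x, y). F x y)"
  shows "continuous_on UNIV (F x)" "continuous_on UNIV (\<lambda>x. F x y)"
proof -
  have "continuous_on UNIV (\<lambda>y. (x, y))" "continuous_on UNIV (\<lambda>x. (x, y))"
    by (intro continuous_intros)+
  from this[THEN continuous_on_compose2[OF assms]]
  show "continuous_on UNIV (F x)" "continuous_on UNIV (\<lambda>x. F x y)" by auto
qed

lemma compact_t2_Urysohn: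
  fixes K L :: "'a::t2_space set"
  assumes "compact (UNIV :: 'a set)" "compact K" "compact L" "K \<inter> L = {}"
  obtains f :: "'a \<Rightarrow> real" where "continuous_on UNIV f" "\<And>x. 0 \<le> f x" "\<And>x. f x \<le> 1"
    "\<And>x. x \<in> K \<Longrightarrow> f x = 1" "\<And>x. x \<in> L \<Longrightarrow> f x = 0"
proof -
  have "Hausdorff_space (euclidean :: 'a topology)"
    unfolding Hausdorff_space_def disjnt_def using hausdorff[where 'a='a] by simp
  then have "normal_space (euclidean :: 'a topology)"
    using assms(1) by (intro compact_Hausdorff_or_regular_imp_normal_space) (auto simp: compact_space_def)
  moreover have "closedin euclidean K" "closedin euclidean L" "disjnt L K"
    using assms compact_imp_closed by (auto simp: disjnt_def)
  ultimately obtain f :: "'a \<Rightarrow> real" where f: "continuous_map euclidean (top_of_set {0..1}) f" "f ` L \<subseteq> {0}" "f ` K \<subseteq> {1}"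
    using Urysohn_lemma[of euclidean L K 0 1] by auto
  then have "continuous_on UNIV f" "\<And>x. f x \<in> {0..1}"
    by (auto simp: continuous_map_in_subtopology)
  then show thesis using f that[of f] by fastforce
qed

text \<open>
  The path space is Hausdorff, so compact sets of paths are Borel and the Stone-Weierstrass theorem
  applies to it. The weaker separation axioms come first, because type class arities have to respect
  the inclusions between the classes.
\<close>

instance "fun" :: (type, t0_space) t0_space
proof
  fix f g :: "'a \<Rightarrow> 'b" assume "f \<noteq> g"
  then obtain i where "f i \<noteq> g i" by auto
  from separation_t0[THEN iffD1, OF this] obtain U where "open U" "(f i \<in> U) \<noteq> (g i \<in> U)" by auto
  then show "\<exists>U. open U \<and> (f \<in> U) \<noteq> (g \<in> U)"
    by (intro exI[of _ "(\<lambda>h. h i) -` U"]) (auto intro!: open_vimage continuous_on_product_coordinates)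
qed

instance "fun" :: (type, t1_space) t1_space
proof
  fix f g :: "'a \<Rightarrow> 'b" assume "f \<noteq> g"
  then obtain i where "f i \<noteq> g i" by auto
  from separation_t1[THEN iffD1, OF this] obtain U where "open U" "f i \<in> U" "g i \<notin> U" by auto
  then show "\<exists>U. open U \<and> f \<in> U \<and> g \<notin> U"
    by (intro exI[of _ "(\<lambda>h. h i) -` U"]) (auto intro!: open_vimage continuous_on_product_coordinates)
qed

instance "fun" :: (type, t2_space) t2_space
proof
  fix f g :: "'a \<Rightarrow> 'b" assume "f \<noteq> g"
  then obtain i where "f i \<noteq> g i" by auto
  from separation_t2[THEN iffD1, OF this] obtain U V where UV: "open U" "open V" "f i \<in> U" "g i \<in> V" "U \<inter> V = {}"
    by auto
  have "open ((\<lambda>h::'a \<Rightarrow> 'b. h i) -` U)" "open ((\<lambda>h::'a \<Rightarrow> 'b. h i) -` V)"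
    using UV by (auto intro!: open_vimage continuous_on_product_coordinates)
  then show "\<exists>U V. open U \<and> open V \<and> f \<in> U \<and> g \<in> V \<and> U \<inter> V = {}"
    using UV by (intro exI[of _ "(\<lambda>h. h i) -` U"] exI[of _ "(\<lambda>h. h i) -` V"]) auto
qed

section \<open>The invariant mean on a compact abelian group\<close>

definition average :: "'g::plus set \<Rightarrow> ('g \<Rightarrow> real) \<Rightarrow> 'g \<Rightarrow> real" where
  "average C f x = (\<Sum>c\<in>C. f (c + x)) / card C"

text \<open>
  Compositions are included so that the means of several functions can be approximated by one
  operator. All these operators are positive, preserve constants and commute with one another.
\<close>

inductive_set averagings :: "(('g::plus \<Rightarrow> real) \<Rightarrow> 'g \<Rightarrow> real) set" where
  averagings_id: "(\<lambda>f. f) \<in> averagings"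
| averagings_step: "T \<in> averagings \<Longrightarrow> finite C \<Longrightarrow> C \<noteq> {} \<Longrightarrow> (\<lambda>f. average C (T f)) \<in> averagings"

text \<open>
  For continuous \<open>f\<close> on a compact abelian group this is the integral with respect to the normalised
  Haar measure.
\<close>

definition mean :: "('g::plus \<Rightarrow> real) \<Rightarrow> real" where
  "mean f = Inf {b. \<exists>T\<in>averagings. \<forall>x. T f x \<le> b}"

lemma average_mono: "(\<And>x. f x \<le> g x) \<Longrightarrow> average C f x \<le> average C g x"
  unfolding average_def by (intro divide_right_mono sum_mono) auto

lemma averaging_mono:
  "T \<in> averagings \<Longrightarrow> (\<And>x. f x \<le> g x) \<Longrightarrow> T f x \<le> T g x"
  by (induction arbitrary: x rule: averagings.induct) (auto intro: average_mono)

lemma averaging_const: "T \<in> averagings \<Longrightarrow> T (\<lambda>_. c) = (\<lambda>_. c)"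
  by (induction rule: averagings.induct) (auto simp: average_def card_eq_0_iff)

lemma averaging_add: "T \<in> averagings \<Longrightarrow> T (\<lambda>x. f x + g x) = (\<lambda>x. T f x + T g x)"
  by (induction rule: averagings.induct) (auto simp: average_def sum.distrib add_divide_distrib)

lemma averaging_scale: "T \<in> averagings \<Longrightarrow> T (\<lambda>x. c * f x) = (\<lambda>x. c * T f x)"
  by (induction rule: averagings.induct) (auto simp: average_def sum_distrib_left)

lemma averaging_diff: "T \<in> averagings \<Longrightarrow> T (\<lambda>x. f x - g x) = (\<lambda>x. T f x - T g x)"
  using averaging_add[of T f "\<lambda>x. (-1) * g x"] averaging_scale[of T "-1" g] by simp

lemma averaging_near_const:
  assumes "T \<in> averagings" "\<And>x. \<bar>f x - c\<bar> \<le> e"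
  shows "\<bar>T f x - c\<bar> \<le> e"
  using averaging_mono[OF assms(1), of f "\<lambda>_. c + e" x] averaging_mono[OF assms(1), of "\<lambda>_. c - e" f x]
    assms(2) averaging_const[OF assms(1)] by (force simp: abs_le_iff algebra_simps)

lemma averaging_compose: "S \<in> averagings \<Longrightarrow> T \<in> averagings \<Longrightarrow> (\<lambda>f. S (T f)) \<in> averagings"
  by (induction rule: averagings.induct) (auto intro: averagings.intros)

lemma averaging_continuous:
  fixes f :: "'g::topological_monoid_add \<Rightarrow> real"
  assumes "T \<in> averagings" "continuous_on UNIV f"
  shows "continuous_on UNIV (T f)"
  using assms
proof (induction rule: averagings.induct)
  case (averagings_step T C)
  then show ?case unfolding average_def
    by (intro continuous_intros continuous_on_compose2[where f="\<lambda>x. _ + x" and g="T f"]) auto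
qed auto

lemma averaging_reflect:
  fixes T :: "('g::group_add \<Rightarrow> real) \<Rightarrow> 'g \<Rightarrow> real"
  assumes "T \<in> averagings" and comm: "\<And>x y::'g. x + y = y + x"
  shows "\<exists>S\<in>averagings. \<forall>f x. T (\<lambda>x. f (- x)) x = S f (- x)"
  using assms(1)
proof (induction rule: averagings.induct)
  case averagings_id
  then show ?case by (intro bexI[OF _ averagings.averagings_id]) auto
next
  case (averagings_step T C)
  then obtain S where S: "S \<in> averagings" "\<And>f x. T (\<lambda>x. f (- x)) x = S f (- x)" by blast
  have "average C (\<lambda>x. S f (- x)) x = average (uminus ` C) (S f) (- x)" for f x
    unfolding average_def
    by (subst sum.reindex) (auto simp: inj_on_def card_image minus_add comm)
  moreover have "(\<lambda>f. average (uminus ` C) (S f)) \<in> averagings"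
    using S averagings_step by (intro averagings.averagings_step) auto
  moreover have "T (\<lambda>x. f (- x)) = (\<lambda>x. S f (- x))" for f using S(2) by auto
  ultimately show ?case by auto
qed

locale compact_abelian =
  fixes G :: "'g::{topological_group_add,t2_space} itself"
  assumes compact_G: "compact (UNIV :: 'g set)"
    and comm: "\<And>x y :: 'g. x + y = y + x"
begin

sublocale G: ab_group_add "(+)" "0 :: 'g" "(-)" uminus
  by unfold_locales (auto simp: comm)

lemma averaging_shift:
  assumes "T \<in> averagings"
  shows "T (\<lambda>x. f (a + x)) = (\<lambda>x. T f (a + x :: 'g))"
  using assms by (induction rule: averagings.induct) (auto simp: average_def G.add.left_commute)

lemma average_commute:
  assumes "T \<in> averagings" "finite C" "C \<noteq> {}"
  shows "T (average C f) = (average C (T f) :: 'g \<Rightarrow> real)"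
  using assms
proof (induction arbitrary: rule: averagings.induct)
  case (averagings_step T D)
  have "average D (average C h) = average C (average D h)" for h :: "'g \<Rightarrow> real"
    unfolding average_def sum_divide_distrib[symmetric]
    by (subst sum.swap) (simp add: G.add.left_commute field_simps)
  then show ?case using averagings_step by simp
qed auto

lemma averaging_commute:
  assumes "S \<in> averagings" "T \<in> averagings"
  shows "S (T f) = (T (S f) :: 'g \<Rightarrow> real)"
  using assms(1) by (induction rule: averagings.induct) (auto simp: average_commute assms(2))

text \<open>
  Averages of \<open>f\<close> are as equicontinuous as \<open>f\<close> itself; \<open>mean_approx\<close> needs this uniformity, because it
  chooses a neighbourhood before it chooses the average.
\<close>

lemma averaging_modulus:
  assumes "T \<in> averagings" "\<And>x. \<bar>f (u + x) - f x\<bar> \<le> e"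
  shows "\<bar>T f (u + x) - T f (x :: 'g)\<bar> \<le> e"
  using averaging_near_const[OF assms(1), of "\<lambda>x. f (u + x) - f x" 0 e x] assms
  by (simp add: averaging_diff[OF assms(1)] averaging_shift[OF assms(1)])

lemma finite_translates:
  assumes "open (V :: 'g set)" "V \<noteq> {}"
  obtains C where "finite C" "C \<noteq> {}" "\<And>z. \<exists>c\<in>C. c + z \<in> V"
proof -
  have "open ((\<lambda>z. c + z) -` V)" for c
    using assms(1) by (intro open_vimage continuous_intros) auto
  moreover have "UNIV \<subseteq> (\<Union>c\<in>UNIV. (\<lambda>z. c + z) -` V)"
  proof
    fix z obtain v where "v \<in> V" using assms(2) by auto
    then have "(v - z) + z \<in> V" by simp
    then show "z \<in> (\<Union>c\<in>UNIV. (\<lambda>z. c + z) -` V)" by blast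
  qed
  ultimately obtain C where C: "finite C" "UNIV \<subseteq> (\<Union>c\<in>C. (\<lambda>z. c + z) -` V)"
    using compactE_image[OF compact_G, of UNIV "\<lambda>c. (\<lambda>z. c + z) -` V"] by metis
  show thesis
  proof
    show ex: "\<exists>c\<in>C. c + z \<in> V" for z using C(2) by auto
    show "C \<noteq> {}" using ex by auto
  qed fact
qed

lemma continuous_bounds:
  assumes "continuous_on UNIV (f :: 'g \<Rightarrow> real)"
  obtains B where "\<And>x. \<bar>f x\<bar> \<le> B" "B \<ge> 0"
proof -
  have "bounded (f ` UNIV)" using compact_G assms compact_continuous_image compact_imp_bounded by blast
  then obtain B where "\<And>x. \<bar>f x\<bar> \<le> B" by (auto simp: bounded_iff)
  moreover from this have "0 \<le> B" using abs_ge_zero order_trans by blast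
  ultimately show thesis using that by blast
qed

text \<open>
  The tube lemma: compactness of the second factor gives uniformity in \<open>y\<close>.
\<close>

lemma close_slices:
  fixes F :: "'a::topological_space \<Rightarrow> 'g \<Rightarrow> 'b::metric_space"
  assumes F: "continuous_on UNIV (\<lambda>(x, y). F x y)" and "0 < e"
  shows "\<exists>U. open U \<and> x0 \<in> U \<and> (\<forall>x\<in>U. \<forall>y. dist (F x y) (F x0 y) < e)"
proof -
  have "\<exists>V W. open V \<and> open W \<and> x0 \<in> V \<and> y0 \<in> W \<and> (\<forall>x\<in>V. \<forall>y\<in>W. dist (F x y) (F x0 y0) < e / 2)" for y0
  proof -
    have "open ((\<lambda>(x, y). F x y) -` ball (F x0 y0) (e/2))"
      by (intro open_vimage F) auto
    from open_prod_elim[OF this, of "(x0, y0)"] \<open>0 < e\<close>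
    obtain V W where "open V" "open W" "(x0, y0) \<in> V \<times> W"
      "V \<times> W \<subseteq> (\<lambda>(x, y). F x y) -` ball (F x0 y0) (e/2)" by auto
    then show ?thesis by (intro exI[of _ V] exI[of _ W]) (fastforce simp: dist_commute)
  qed
  then obtain V W where VW: "\<And>y. open (V y)" "\<And>y. open (W y)" "\<And>y. x0 \<in> V y" "\<And>y. y \<in> W y"
    "\<And>y0 x y. x \<in> V y0 \<Longrightarrow> y \<in> W y0 \<Longrightarrow> dist (F x y) (F x0 y0) < e / 2" by metis
  obtain D where D: "finite D" "UNIV \<subseteq> (\<Union>y\<in>D. W y)"
    using compactE_image[OF compact_G, of UNIV W] VW by (metis UNIV_I UN_I subsetI)
  show ?thesis
  proof (intro exI[of _ "\<Inter>y\<in>D. V y"] conjI ballI allI)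
    show "open (\<Inter>y\<in>D. V y)" using D VW by auto
    fix x y assume x: "x \<in> (\<Inter>y\<in>D. V y)"
    obtain d where d: "d \<in> D" "y \<in> W d" using D by blast
    have "dist (F x y) (F x0 d) < e/2" "dist (F x0 y) (F x0 d) < e/2"
      using VW(5)[of x d y] VW(5)[of x0 d y] x d VW(3) by auto
    then show "dist (F x y) (F x0 y) < e" by (metis dist_triangle_half_r dist_commute)
  qed (use VW in auto)
qed

text \<open>
  Averages of a continuous function come uniformly close to a constant. Fix a neighbourhood of \<open>0\<close> on
  which \<open>f\<close> varies by at most \<open>e/2\<close> and let \<open>N\<close> translates of it cover \<open>G\<close>. If the supremum of \<open>T f\<close> is
  within \<open>e/(2N)\<close> of the infimum \<open>mean f\<close> of all such suprema, then a point where \<open>T f\<close> drops by more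
  than \<open>e\<close> below the supremum is impossible: averaging over the \<open>N\<close> translations would spread that
  drop over all of \<open>G\<close> and push the supremum below \<open>mean f\<close>.
\<close>

lemma mean_approx:
  assumes f: "continuous_on UNIV (f :: 'g \<Rightarrow> real)" and "0 < e"
  shows "\<exists>T\<in>averagings. \<forall>x. \<bar>T f x - mean f\<bar> \<le> e"
proof -
  obtain B where B: "\<And>x. \<bar>f x\<bar> \<le> B" using continuous_bounds[OF f] by metis
  let ?S = "{b. \<exists>T\<in>averagings. \<forall>x. T f x \<le> b}"
  have lb: "m \<le> b" if "T \<in> averagings" "\<forall>x. T f x \<le> b" "\<And>x. m \<le> f x" for b T m
    using averaging_mono[OF that(1), of "\<lambda>_. m" f 0] that averaging_const[OF that(1)]
    by (metis order_trans)
  have bdd: "bdd_below ?S" using lb[of _ _ "-B"] B by (auto simp: bdd_below_def abs_le_iff) (metis minus_le_iff)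
  have "B \<in> ?S" using B by (auto simp: abs_le_iff intro!: bexI[OF _ averagings_id])
  then have ne: "?S \<noteq> {}" by blast
  have "continuous_on UNIV (\<lambda>(u, x). f (u + x))"
    unfolding case_prod_beta by (intro continuous_on_compose2[OF f] continuous_intros) auto
  from close_slices[OF this, of "e/2" 0] \<open>0 < e\<close> obtain U where U: "open U" "0 \<in> U"
    "\<And>u x. u \<in> U \<Longrightarrow> \<bar>f (u + x) - f x\<bar> < e/2" by (auto simp: dist_real_def)
  obtain C where C: "finite C" "C \<noteq> {}" "\<And>z. \<exists>c\<in>C. c + z \<in> U"
    using finite_translates[OF U(1)] U(2) by blast
  define N where "N = real (card C)"
  have N: "N > 0" using C by (simp add: N_def card_gt_0_iff)
  have "mean f < mean f + e / (2 * N)" using N \<open>0 < e\<close> by simp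
  then obtain b where b: "b \<in> ?S" "b < mean f + e / (2 * N)"
    using cInf_lessD[OF ne] unfolding mean_def by blast
  then obtain T where T: "T \<in> averagings" "\<And>x. T f x \<le> b" by auto
  have mod: "T f (u + x) \<le> T f x + e/2" if "u \<in> U" for u x
    using averaging_modulus[where f=f and u=u and x=x, OF T(1) less_imp_le[OF U(3)[OF that]]] by linarith
  have low: "b - e \<le> T f x0" for x0
  proof -
    (* One of the N translates of x lies near x0, where T f is small; at the others T f is at most b. *)
    have le: "average C (T f) x \<le> b + (T f x0 + e/2 - b) / N" for x
    proof -
      obtain c where c: "c \<in> C" "c + (x - x0) \<in> U" using C(3) by blast
      have "T f (c + x) \<le> T f x0 + e/2"
        using mod[OF c(2), of x0] by (simp add: add.assoc)
      then have "(\<Sum>c\<in>C. T f (c + x)) \<le> (T f x0 + e/2) + (\<Sum>c\<in>C - {c}. b)"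
        using c C T(2) by (subst sum.remove[OF C(1) c(1)]) (intro add_mono sum_mono, auto)
      also have "\<dots> = (T f x0 + e/2) + (N - 1) * b"
        using c C N by (simp add: N_def of_nat_diff Suc_leI card_gt_0_iff)
      finally show ?thesis using N unfolding average_def N_def[symmetric]
        by (simp add: field_simps)
    qed
    have "(\<lambda>f. average C (T f)) \<in> averagings" using T C by (intro averagings_step)
    then have "b + (T f x0 + e/2 - b) / N \<in> ?S"
      using le by (intro CollectI bexI[of _ "\<lambda>f. average C (T f)"] allI)
    then have "mean f \<le> b + (T f x0 + e/2 - b) / N"
      unfolding mean_def by (rule cInf_lower[OF _ bdd])
    then have "(b - e/2 - T f x0) / N \<le> (e/2) / N" using b by (simp add: diff_divide_distrib add_divide_distrib)
    then have "b - e/2 - T f x0 \<le> e/2" using N by (simp only: divide_le_cancel)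
    then show ?thesis by simp
  qed
  have "mean f \<le> b" unfolding mean_def by (rule cInf_lower[OF b(1) bdd])
  moreover have "e / (2 * N) \<le> e"
  proof -
    have "N \<ge> 1" using C by (simp add: N_def Suc_leI card_gt_0_iff)
    then show ?thesis using \<open>0 < e\<close> by (simp add: field_simps) 
  qed
  ultimately have "\<bar>T f x - mean f\<bar> \<le> e" for x using T(2)[rule_format, of x] low[of x] b
    by (auto simp: abs_le_iff) 
  then show ?thesis by (intro bexI[OF _ T(1)] allI)
qed

text \<open>
  Two constants approximated by averages \<open>S f\<close> and \<open>T f\<close> are both approximated by \<open>S (T f) = T (S f)\<close>,
  so they agree. This uniqueness is what makes the mean linear and invariant.
\<close>

lemma mean_eqI:
  assumes f: "continuous_on UNIV (f :: 'g \<Rightarrow> real)"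
    and ex: "\<And>e. 0 < e \<Longrightarrow> \<exists>T\<in>averagings. \<forall>x. \<bar>T f x - c\<bar> \<le> e"
  shows "mean f = c"
proof (rule ccontr)
  define e where "e = \<bar>mean f - c\<bar> / 3"
  assume "mean f \<noteq> c"
  then have "e > 0" by (simp add: e_def)
  obtain S where S: "S \<in> averagings" "\<forall>x. \<bar>S f x - mean f\<bar> \<le> e" using mean_approx[OF f \<open>e > 0\<close>] ..
  obtain T where T: "T \<in> averagings" "\<forall>x. \<bar>T f x - c\<bar> \<le> e" using ex[OF \<open>e > 0\<close>] ..
  have "\<bar>S (T f) 0 - c\<bar> \<le> e" "\<bar>T (S f) 0 - mean f\<bar> \<le> e"
    by (rule averaging_near_const[OF S(1) T(2)[rule_format]] averaging_near_const[OF T(1) S(2)[rule_format]])+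
  then show False using averaging_commute[OF S(1) T(1), of f] \<open>e > 0\<close> unfolding e_def by (simp add: abs_if split: if_splits)
qed

lemma mean_approx_family:
  assumes "finite \<F>" "\<And>f. f \<in> \<F> \<Longrightarrow> continuous_on UNIV (f :: 'g \<Rightarrow> real)" "0 < e"
  shows "\<exists>T\<in>averagings. \<forall>f\<in>\<F>. \<forall>x. \<bar>T f x - mean f\<bar> \<le> e"
  using assms(1,2)
proof (induction rule: finite_induct)
  case empty
  then show ?case by (intro bexI[OF _ averagings_id]) simp
next
  case (insert f \<F>)
  have "\<exists>T\<in>averagings. \<forall>f\<in>\<F>. \<forall>x. \<bar>T f x - mean f\<bar> \<le> e"
    by (rule insert.IH) (simp add: insert.prems)
  then obtain S where S: "S \<in> averagings" "\<forall>f\<in>\<F>. \<forall>x. \<bar>S f x - mean f\<bar> \<le> e" ..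
  have "continuous_on UNIV f" by (simp add: insert.prems)
  from mean_approx[OF this assms(3)]
  obtain T where T: "T \<in> averagings" "\<forall>x. \<bar>T f x - mean f\<bar> \<le> e" ..
  show ?case
  proof (intro bexI[of _ "\<lambda>f. T (S f)"] ballI allI)
    fix h x assume "h \<in> insert f \<F>"
    then show "\<bar>T (S h) x - mean h\<bar> \<le> e"
    proof
      assume "h = f"
      then show ?thesis using averaging_near_const[OF S(1), of "T f" "mean f" e x] T
        averaging_commute[OF S(1) T(1), of f] by simp
    next
      assume "h \<in> \<F>"
      then show ?thesis using S by (intro averaging_near_const[OF T(1)]) auto
    qed
  qed (rule averaging_compose[OF T(1) S(1)])
qed

lemma mean_const [simp]: "mean (\<lambda>_ :: 'g. c) = c"
proof (rule mean_eqI)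
  show "\<exists>T\<in>averagings. \<forall>x::'g. \<bar>T (\<lambda>_. c) x - c\<bar> \<le> e" if "0 < e" for e
    using that by (intro bexI[OF _ averagings_id]) simp
qed simp

lemma mean_add:
  assumes "continuous_on UNIV f" "continuous_on UNIV (g :: 'g \<Rightarrow> real)"
  shows "mean (\<lambda>x. f x + g x) = mean f + mean g"
proof (rule mean_eqI)
  fix e :: real assume "0 < e"
  then have "\<exists>T\<in>averagings. \<forall>h\<in>{f,g}. \<forall>x. \<bar>T h x - mean h\<bar> \<le> e/2"
    using assms by (intro mean_approx_family) auto
  then obtain T where T: "T \<in> averagings" "\<forall>h\<in>{f,g}. \<forall>x. \<bar>T h x - mean h\<bar> \<le> e/2" ..
  have "\<bar>T (\<lambda>x. f x + g x) x - (mean f + mean g)\<bar> \<le> e" for x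
  proof -
    have "\<bar>T f x - mean f\<bar> \<le> e/2" "\<bar>T g x - mean g\<bar> \<le> e/2" using T(2) by auto
    then show ?thesis unfolding averaging_add[OF T(1)] by linarith
  qed
  then show "\<exists>T\<in>averagings. \<forall>x. \<bar>T (\<lambda>x. f x + g x) x - (mean f + mean g)\<bar> \<le> e" by (intro bexI[OF _ T(1)] allI)
qed (rule continuous_on_add[OF assms])

lemma mean_scale:
  assumes f: "continuous_on UNIV (f :: 'g \<Rightarrow> real)"
  shows "mean (\<lambda>x. c * f x) = c * mean f"
proof (cases "c = 0")
  case False
  show ?thesis
  proof (rule mean_eqI)
    fix e :: real assume "0 < e"
    then have "0 < e / \<bar>c\<bar>" using False by simp
    from mean_approx[OF f this] obtain T where T: "T \<in> averagings" "\<forall>x. \<bar>T f x - mean f\<bar> \<le> e / \<bar>c\<bar>"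
      ..
    have "\<bar>T (\<lambda>x. c * f x) x - c * mean f\<bar> \<le> e" for x
    proof -
      have "\<bar>T (\<lambda>x. c * f x) x - c * mean f\<bar> = \<bar>c\<bar> * \<bar>T f x - mean f\<bar>"
        unfolding averaging_scale[OF T(1)] right_diff_distrib[symmetric] abs_mult ..
      also have "\<dots> \<le> \<bar>c\<bar> * (e / \<bar>c\<bar>)" by (rule mult_left_mono[OF T(2)[rule_format]]) simp
      also have "\<dots> = e" using False by simp
      finally show ?thesis .
    qed
    then show "\<exists>T\<in>averagings. \<forall>x. \<bar>T (\<lambda>x. c * f x) x - c * mean f\<bar> \<le> e" by (intro bexI[OF _ T(1)] allI)
  qed (rule continuous_on_mult_left[OF f])
qed simp

lemma mean_nonneg:
  assumes f: "continuous_on UNIV (f :: 'g \<Rightarrow> real)" and "\<And>x. 0 \<le> f x"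
  shows "0 \<le> mean f"
proof (rule field_le_epsilon)
  fix e :: real assume "0 < e"
  from mean_approx[OF f this] obtain T where T: "T \<in> averagings" "\<forall>x. \<bar>T f x - mean f\<bar> \<le> e" ..
  have "0 \<le> T f 0" using averaging_mono[OF T(1), of "\<lambda>_. 0" f 0] assms(2) averaging_const[OF T(1)] by simp
  then show "0 \<le> mean f + e" using T(2)[rule_format, of 0] by linarith
qed

lemma mean_averaging:
  assumes f: "continuous_on UNIV (f :: 'g \<Rightarrow> real)" and T: "T \<in> averagings"
  shows "mean (T f) = mean f"
proof (rule mean_eqI)
  fix e :: real assume "0 < e"
  from mean_approx[OF f this] obtain S where S: "S \<in> averagings" "\<forall>x. \<bar>S f x - mean f\<bar> \<le> e" ..
  then have "\<bar>S (T f) x - mean f\<bar> \<le> e" for x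
    using averaging_near_const[OF T, of "S f"] averaging_commute[OF S(1) T, of f] by simp
  then show "\<exists>S\<in>averagings. \<forall>x. \<bar>S (T f) x - mean f\<bar> \<le> e" by (intro bexI[OF _ S(1)] allI)
qed (rule averaging_continuous[OF T f])

lemma mean_shift:
  assumes f: "continuous_on UNIV (f :: 'g \<Rightarrow> real)"
  shows "mean (\<lambda>x. f (a + x)) = mean f"
proof -
  have "(\<lambda>f. average {a} f) \<in> averagings"
    using averagings_step[OF averagings_id, of "{a}"] by simp
  from mean_averaging[OF f this] show ?thesis by (simp add: average_def[abs_def])
qed

lemma mean_reflect:
  assumes f: "continuous_on UNIV (f :: 'g \<Rightarrow> real)"
  shows "mean (\<lambda>x. f (- x)) = mean f"
proof -
  have f': "continuous_on UNIV (\<lambda>x. f (- x))"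
    by (intro continuous_on_compose2[OF f] continuous_intros) auto
  show ?thesis
  proof (rule mean_eqI[OF f'])
    fix e :: real assume "0 < e"
    from mean_approx[OF f this] obtain T where T: "T \<in> averagings" "\<forall>x. \<bar>T f x - mean f\<bar> \<le> e" ..
    obtain S where S: "S \<in> averagings" "\<forall>f x. T (\<lambda>x. f (- x)) x = S f (- x)"
      using averaging_reflect[OF T(1) comm] ..
    have "\<bar>S (\<lambda>x. f (- x)) x - mean f\<bar> \<le> e" for x
      using T(2)[rule_format, of "- x"] S(2)[rule_format, of "\<lambda>x. f (- x)" "- x"] by simp
    then show "\<exists>S\<in>averagings. \<forall>x. \<bar>S (\<lambda>x. f (- x)) x - mean f\<bar> \<le> e" by (intro bexI[OF _ S(1)] allI)
  qed
qed

text \<open>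
  Finitely many translates of the open set where \<open>f\<close> exceeds \<open>f x0 / 2\<close> cover \<open>G\<close>, so a suitable average of \<open>f\<close>
  is bounded away from \<open>0\<close>.
\<close>

lemma mean_pos:
  assumes f: "continuous_on UNIV (f :: 'g \<Rightarrow> real)" and "\<And>x. 0 \<le> f x" "0 < f x0"
  shows "0 < mean f"
proof -
  define V where "V = f -` {f x0 / 2<..}"
  have "open V" unfolding V_def by (intro open_vimage f) auto
  moreover have "x0 \<in> V" using assms(3) by (simp add: V_def)
  ultimately obtain C where C: "finite C" "C \<noteq> {}" "\<And>z. \<exists>c\<in>C. c + z \<in> V"
    using finite_translates[of V] by blast
  define N where "N = real (card C)"
  have N: "N > 0" using C by (simp add: N_def card_gt_0_iff)
  have low: "f x0 / 2 / N \<le> average C f x" for x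
  proof -
    obtain c where c: "c \<in> C" "f x0 / 2 < f (c + x)" using C(3)[of x] by (auto simp: V_def)
    have "f (c + x) \<le> (\<Sum>c\<in>C. f (c + x))" using C c assms(2) by (intro member_le_sum) auto
    then show ?thesis unfolding average_def N_def[symmetric] using c N by (intro divide_right_mono) auto
  qed
  have T: "average C \<in> averagings" using averagings_step[OF averagings_id C(1,2)] .
  have "continuous_on UNIV (average C f)" using averaging_continuous[OF T f] .
  then have "0 \<le> mean (\<lambda>x. average C f x + - (f x0 / 2 / N))"
    using low by (intro mean_nonneg continuous_intros) (auto simp: algebra_simps)
  also have "\<dots> = mean f - f x0 / 2 / N"
    using mean_averaging[OF f T] \<open>continuous_on UNIV (average C f)\<close> by (subst mean_add) auto
  finally have "f x0 / 2 / N \<le> mean f" by simp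
  moreover have "0 < f x0 / 2 / N" using assms(3) N by simp
  ultimately show ?thesis by linarith
qed

lemma mean_diff:
  assumes "continuous_on UNIV f" "continuous_on UNIV (g :: 'g \<Rightarrow> real)"
  shows "mean (\<lambda>x. f x - g x) = mean f - mean g"
  using mean_add[OF assms(1) continuous_on_mult_left[OF assms(2), of "-1"]] mean_scale[OF assms(2), of "-1"] by simp

lemma mean_mono:
  assumes "continuous_on UNIV f" "continuous_on UNIV (g :: 'g \<Rightarrow> real)" "\<And>x. f x \<le> g x"
  shows "mean f \<le> mean g"
  using mean_nonneg[OF continuous_on_diff[OF assms(2,1)]] mean_diff[OF assms(2,1)] assms(3) by simp

lemma mean_near_const:
  assumes "continuous_on UNIV (f :: 'g \<Rightarrow> real)" "\<And>x. \<bar>f x - c\<bar> \<le> e"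
  shows "\<bar>mean f - c\<bar> \<le> e"
proof -
  have "f x \<le> c + e" "c - e \<le> f x" for x using assms(2)[of x] by linarith+
  then have "mean f \<le> mean (\<lambda>_::'g. c + e)" "mean (\<lambda>_::'g. c - e) \<le> mean f"
    by (simp_all only: mean_mono[OF assms(1) continuous_on_const] mean_mono[OF continuous_on_const assms(1)])
  then show ?thesis unfolding mean_const by linarith
qed

lemma mean_continuous:
  fixes F :: "'a::topological_space \<Rightarrow> 'g \<Rightarrow> real"
  assumes F: "continuous_on UNIV (\<lambda>(x, y). F x y)"
  shows "continuous_on UNIV (\<lambda>x. mean (F x))"
  unfolding continuous_on_def tendsto_iff
proof (intro ballI allI impI)
  fix x0 and e :: real assume "0 < e"
  note Fx = continuous_slices(1)[OF F]
  have "0 < e / 2" using \<open>0 < e\<close> by simp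
  from close_slices[OF F this, of x0] obtain U
    where "open U \<and> x0 \<in> U \<and> (\<forall>x\<in>U. \<forall>y. dist (F x y) (F x0 y) < e/2)" ..
  then have U: "open U" "x0 \<in> U" "\<And>x y. x \<in> U \<Longrightarrow> dist (F x y) (F x0 y) < e/2" by simp_all
  have "dist (mean (F x)) (mean (F x0)) < e" if "x \<in> U" for x
  proof -
    have "\<bar>mean (\<lambda>y. F x y - F x0 y) - 0\<bar> \<le> e/2"
      using U(3)[OF that] by (intro mean_near_const[OF continuous_on_diff[OF Fx Fx]]) (simp add: dist_real_def less_imp_le)
    then show ?thesis using \<open>0 < e\<close> unfolding mean_diff[OF Fx Fx] dist_real_def by simp
  qed
  then show "\<forall>\<^sub>F x in at x0 within UNIV. dist (mean (F x)) (mean (F x0)) < e"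
    unfolding eventually_at_topological using U(1,2) by (intro exI[of _ U]) simp
qed

lemma averaging_mean:
  fixes F :: "'g \<Rightarrow> 'g \<Rightarrow> real"
  assumes T: "T \<in> averagings" and F: "continuous_on UNIV (\<lambda>(x, y). F x y)"
  shows "continuous_on UNIV (\<lambda>(z, y). T (\<lambda>x. F x y) z)"
    and "T (\<lambda>x. mean (F x)) z = mean (\<lambda>y. T (\<lambda>x. F x y) z)"
proof -
  have "continuous_on UNIV (\<lambda>(z, y). T (\<lambda>x. F x y) z) \<and>
     (\<forall>z. T (\<lambda>x. mean (F x)) z = mean (\<lambda>y. T (\<lambda>x. F x y) z))"
    using T
  proof (induction rule: averagings.induct)
    case averagings_id
    then show ?case using F by simp
  next
    case (averagings_step T C)
    note c = averagings_step.IH[THEN conjunct1]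
    note c1 = continuous_slices(1)[OF c]
    have "continuous_on UNIV (\<lambda>(z, y). average C (T (\<lambda>x. F x y)) z)"
      unfolding average_def case_prod_beta using averagings_step.hyps
      by (intro continuous_intros continuous_on_compose2[OF c, where f="\<lambda>p. (_ + fst p, snd p)", simplified case_prod_beta fst_conv snd_conv]) auto
    moreover have "mean (\<lambda>y. \<Sum>c\<in>C. T (\<lambda>x. F x y) (c + z)) = (\<Sum>c\<in>C. mean (\<lambda>y. T (\<lambda>x. F x y) (c + z)))" for z
      using averagings_step(2)
      by (induction rule: finite_induct) (auto simp: mean_add c1 continuous_on_sum)
    then have "average C (T (\<lambda>x. mean (F x))) z = mean (\<lambda>y. average C (T (\<lambda>x. F x y)) z)" for z
      using averagings_step.IH mean_scale[of "\<lambda>y. \<Sum>c\<in>C. T (\<lambda>x. F x y) (c + z)" "1 / card C"]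
      by (simp add: average_def c1 continuous_on_sum)
    ultimately show ?case by simp
  qed
  then show "continuous_on UNIV (\<lambda>(z, y). T (\<lambda>x. F x y) z)"
    "T (\<lambda>x. mean (F x)) z = mean (\<lambda>y. T (\<lambda>x. F x y) z)" by auto
qed

text \<open>
  By compactness in \<open>y\<close>, one averaging operator in \<open>x\<close> approximates the means of all slices \<open>F _ y\<close>
  simultaneously. Averaging operators are finite sums and therefore commute with the mean in \<open>y\<close>.
\<close>

lemma mean_swap:
  fixes F :: "'g \<Rightarrow> 'g \<Rightarrow> real"
  assumes F: "continuous_on UNIV (\<lambda>(x, y). F x y)"
  shows "mean (\<lambda>x. mean (\<lambda>y. F x y)) = mean (\<lambda>y. mean (\<lambda>x. F x y))"
proof (rule mean_eqI)
  show F1: "continuous_on UNIV (\<lambda>x. mean (\<lambda>y. F x y))" by (intro mean_continuous F)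
  have F': "continuous_on UNIV (\<lambda>(y, x). F x y)"
    using continuous_on_compose2[OF F continuous_on_swap] by (simp add: case_prod_beta)
  note Fy = continuous_slices(2)[OF F]
  fix e :: real assume e: "0 < e"
  have "\<forall>y0. \<exists>U. open U \<and> y0 \<in> U \<and> (\<forall>y\<in>U. \<forall>x. dist (F x y) (F x y0) < e/3)"
    using close_slices[OF F', of "e/3"] e by simp
  then obtain U where U: "\<And>y. open (U y)" "\<And>y. y \<in> U y"
    "\<And>y0 y x. y \<in> U y0 \<Longrightarrow> \<bar>F x y - F x y0\<bar> < e/3" unfolding dist_real_def by metis
  obtain D where D: "finite D" "UNIV \<subseteq> (\<Union>y\<in>D. U y)"
    using compactE_image[OF compact_G, of UNIV U] U by (metis UNIV_I UN_I subsetI)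
  have "\<exists>T\<in>averagings. \<forall>f\<in>(\<lambda>y x. F x y) ` D. \<forall>x. \<bar>T f x - mean f\<bar> \<le> e/3"
    using D(1) e Fy by (intro mean_approx_family) auto
  then obtain T where T: "T \<in> averagings" "\<forall>f\<in>(\<lambda>y x. F x y) ` D. \<forall>x. \<bar>T f x - mean f\<bar> \<le> e/3" ..
  have near: "\<bar>T (\<lambda>x. F x y) z - mean (\<lambda>x. F x y)\<bar> \<le> e" for y z
  proof -
    obtain d where d: "d \<in> D" "y \<in> U d" using D by blast
    have lt: "\<bar>(F x y - F x d) - 0\<bar> \<le> e/3" for x using U(3)[OF d(2), of x] by simp
    have "\<bar>T (\<lambda>x. F x y - F x d) z - 0\<bar> \<le> e/3" by (rule averaging_near_const[OF T(1) lt])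
    moreover have "\<bar>mean (\<lambda>x. F x y - F x d) - 0\<bar> \<le> e/3"
      by (rule mean_near_const[OF continuous_on_diff[OF Fy Fy] lt])
    ultimately show ?thesis using T(2)[rule_format, OF imageI[OF d(1)], of z]
      unfolding averaging_diff[OF T(1)] mean_diff[OF Fy Fy] by linarith
  qed
  show "\<exists>T\<in>averagings. \<forall>z. \<bar>T (\<lambda>x. mean (F x)) z - mean (\<lambda>y. mean (\<lambda>x. F x y))\<bar> \<le> e"
  proof (intro bexI[of _ T] allI)
    fix z
    note c = continuous_slices(1)[OF averaging_mean(1)[OF T(1) F]]
    have c': "continuous_on UNIV (\<lambda>y. mean (\<lambda>x. F x y))" by (intro mean_continuous F')
    have "\<bar>mean (\<lambda>y. T (\<lambda>x. F x y) z - mean (\<lambda>x. F x y)) - 0\<bar> \<le> e"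
      using near by (intro mean_near_const[OF continuous_on_diff[OF c c']]) simp
    then show "\<bar>T (\<lambda>x. mean (F x)) z - mean (\<lambda>y. mean (\<lambda>x. F x y))\<bar> \<le> e"
      unfolding averaging_mean(2)[OF T(1) F] mean_diff[OF c c'] by simp
  qed (rule T)
qed

end

section \<open>Convolution of continuous functions\<close>

context compact_abelian begin

definition cmean :: "('g \<Rightarrow> complex) \<Rightarrow> complex" where
  "cmean f = Complex (mean (\<lambda>x. Re (f x))) (mean (\<lambda>x. Im (f x)))"

lemma cmean_add:
  assumes "continuous_on UNIV f" "continuous_on UNIV g"
  shows "cmean (\<lambda>x. f x + g x) = cmean f + cmean g"
  unfolding cmean_def plus_complex.simps
  using assms by (simp add: mean_add complex_eq_iff continuous_on_Re continuous_on_Im)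

lemma cmean_mult:
  assumes "continuous_on UNIV f"
  shows "cmean (\<lambda>x. c * f x) = c * cmean f"
proof -
  note * = continuous_on_Re[OF assms] continuous_on_Im[OF assms]
  show ?thesis unfolding cmean_def
    by (simp add: complex_eq_iff mean_add mean_diff mean_scale * continuous_on_mult_left)
qed

lemma cmean_diff:
  assumes "continuous_on UNIV f" "continuous_on UNIV g"
  shows "cmean (\<lambda>x. f x - g x) = cmean f - cmean g"
  using cmean_add[OF assms(1) continuous_on_mult_left[OF assms(2), of "-1"]] cmean_mult[OF assms(2), of "-1"]
  by simp

lemma cmean_zero [simp]: "cmean (\<lambda>_. 0) = 0"
  by (simp add: cmean_def complex_eq_iff)

lemma cmean_cnj:
  assumes "continuous_on UNIV f"
  shows "cmean (\<lambda>x. cnj (f x)) = cnj (cmean f)"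
  using mean_scale[OF continuous_on_Im[OF assms], of "-1"]
  unfolding cmean_def by (simp add: complex_eq_iff)

lemma cmean_of_real: "cmean (\<lambda>x. of_real (f x)) = of_real (mean f)"
  by (simp add: cmean_def complex_eq_iff)

lemma cmean_shift:
  assumes "continuous_on UNIV f"
  shows "cmean (\<lambda>x. f (a + x)) = cmean f"
  using mean_shift[OF continuous_on_Re[OF assms], of a] mean_shift[OF continuous_on_Im[OF assms], of a]
  unfolding cmean_def by simp

lemma cmean_reflect:
  assumes "continuous_on UNIV f"
  shows "cmean (\<lambda>x. f (a - x)) = cmean f"
proof -
  have f: "continuous_on UNIV (\<lambda>x. f (a + x))"
    by (rule continuous_on_compose2[OF assms]) (intro continuous_intros, simp)
  show ?thesis
  using mean_reflect[OF continuous_on_Re[OF f]] mean_reflect[OF continuous_on_Im[OF f]]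
    cmean_shift[OF assms, of a]
  unfolding cmean_def by simp
qed

lemma cmean_continuous:
  fixes F :: "'a::topological_space \<Rightarrow> 'g \<Rightarrow> complex"
  assumes F: "continuous_on UNIV (\<lambda>(x, y). F x y)"
  shows "continuous_on UNIV (\<lambda>x. cmean (F x))"
proof -
  have "continuous_on UNIV (\<lambda>(x, y). Re (F x y))" "continuous_on UNIV (\<lambda>(x, y). Im (F x y))"
    using continuous_on_Re[OF F] continuous_on_Im[OF F] by (simp_all add: case_prod_beta)
  from this[THEN mean_continuous] show ?thesis
    unfolding cmean_def by (simp add: continuous_on_Complex)
qed

lemma cmean_swap:
  fixes F :: "'g \<Rightarrow> 'g \<Rightarrow> complex"
  assumes F: "continuous_on UNIV (\<lambda>(x, y). F x y)"
  shows "cmean (\<lambda>x. cmean (\<lambda>y. F x y)) = cmean (\<lambda>y. cmean (\<lambda>x. F x y))"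
proof -
  have "continuous_on UNIV (\<lambda>(x, y). Re (F x y))" "continuous_on UNIV (\<lambda>(x, y). Im (F x y))"
    using continuous_on_Re[OF F] continuous_on_Im[OF F] by (simp_all add: case_prod_beta)
  from this[THEN mean_swap] show ?thesis unfolding cmean_def by simp
qed

text \<open>
  After rotating \<open>f\<close> by a number of modulus one, its mean is real and equal to the mean of a real part.
\<close>

lemma norm_cmean_le:
  assumes f: "continuous_on UNIV f"
  shows "norm (cmean f) \<le> mean (\<lambda>x. norm (f x))"
proof -
  define c where "c = cnj (sgn (cmean f))"
  have c: "norm c \<le> 1" by (simp add: c_def norm_sgn)
  have "c * cmean f = of_real (norm (cmean f))"
    unfolding c_def sgn_eq by (simp add: complex_norm_square[symmetric] power2_eq_square mult.commute divide_simps)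
  then have "norm (cmean f) = Re (cmean (\<lambda>x. c * f x))" by (simp add: cmean_mult[OF f])
  also have "\<dots> = mean (\<lambda>x. Re (c * f x))" by (simp add: cmean_def)
  also have "\<dots> \<le> mean (\<lambda>x. norm (f x))"
  proof (rule mean_mono)
    fix x
    have "Re (c * f x) \<le> norm c * norm (f x)" using complex_Re_le_cmod[of "c * f x"] by (simp add: norm_mult)
    also have "\<dots> \<le> norm (f x)" using mult_right_mono[OF c, of "norm (f x)"] by simp
    finally show "Re (c * f x) \<le> norm (f x)" .
  qed (intro continuous_on_Re continuous_on_mult_left continuous_on_norm f)+
  finally show ?thesis .
qed

lemma norm_cmean_bound:
  assumes f: "continuous_on UNIV f" and "\<And>x. norm (f x) \<le> B"
  shows "norm (cmean f) \<le> B"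
proof -
  have "mean (\<lambda>x. norm (f x)) \<le> mean (\<lambda>_::'g. B)"
    by (rule mean_mono[OF continuous_on_norm[OF f] continuous_on_const assms(2)])
  with norm_cmean_le[OF f] show ?thesis by simp
qed

text \<open>
  The square of the norm of \<open>f\<close> in the Hilbert space of square integrable functions.
\<close>

definition norm2 :: "('g \<Rightarrow> complex) \<Rightarrow> real" where
  "norm2 f = mean (\<lambda>x. (norm (f x))\<^sup>2)"

lemma norm2_nonneg: "continuous_on UNIV f \<Longrightarrow> 0 \<le> norm2 f"
  unfolding norm2_def by (intro mean_nonneg continuous_intros) auto

lemma norm2_pos: "continuous_on UNIV f \<Longrightarrow> f x \<noteq> 0 \<Longrightarrow> 0 < norm2 f"
  unfolding norm2_def by (intro mean_pos[of _ x] continuous_intros) auto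

lemma cmean_Cauchy_Schwarz:
  assumes f: "continuous_on UNIV f" and g: "continuous_on UNIV g"
  shows "(norm (cmean (\<lambda>x. f x * g x)))\<^sup>2 \<le> norm2 f * norm2 g"
proof (cases "norm2 f = 0")
  case True
  then have "f x = 0" for x using norm2_pos[OF f, of x] by force
  then show ?thesis using norm2_nonneg[OF f] norm2_nonneg[OF g] by simp
next
  case False
  define a b m where "a = norm2 f" "b = norm2 g" "m = mean (\<lambda>x. norm (f x) * norm (g x))"
  have "a > 0" using False norm2_nonneg[OF f] by (simp add: a_b_m_def)
  note nf = continuous_on_norm[OF f] and ng = continuous_on_norm[OF g]
  have c: "continuous_on UNIV (\<lambda>x. (norm (f x))\<^sup>2)" "continuous_on UNIV (\<lambda>x. (norm (g x))\<^sup>2)"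
    "continuous_on UNIV (\<lambda>x. norm (f x) * norm (g x))"
    by (intro continuous_on_power continuous_on_mult nf ng)+
  (* The quadratic t |-> mean ((t |f| - |g|)^2) at its minimum t = m / a. *)
  have "0 \<le> mean (\<lambda>x. (m / a * norm (f x) - norm (g x))\<^sup>2)"
    by (intro mean_nonneg continuous_on_power continuous_on_diff continuous_on_mult_left nf ng) simp
  also have "(\<lambda>x. (m / a * norm (f x) - norm (g x))\<^sup>2)
      = (\<lambda>x. (m / a)\<^sup>2 * (norm (f x))\<^sup>2 + (norm (g x))\<^sup>2 - 2 * (m / a) * (norm (f x) * norm (g x)))"
    by (rule ext) (simp add: power2_eq_square algebra_simps)
  also have "mean \<dots> = (m / a)\<^sup>2 * a + b - 2 * (m / a) * m"
    unfolding a_b_m_def norm2_def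
      mean_diff[OF continuous_on_add[OF continuous_on_mult_left[OF c(1)] c(2)] continuous_on_mult_left[OF c(3)]]
      mean_add[OF continuous_on_mult_left[OF c(1)] c(2)] mean_scale[OF c(1)] mean_scale[OF c(3)] ..
  also have "\<dots> = b - m\<^sup>2 / a" using \<open>a > 0\<close> by (simp add: power2_eq_square field_simps)
  finally have "m\<^sup>2 \<le> a * b" using \<open>a > 0\<close> by (simp add: field_simps)
  moreover have "norm (cmean (\<lambda>x. f x * g x)) \<le> m"
    using norm_cmean_le[OF continuous_on_mult[OF f g]] by (simp add: a_b_m_def norm_mult)
  then have "(norm (cmean (\<lambda>x. f x * g x)))\<^sup>2 \<le> m\<^sup>2" by (intro power_mono) auto
  ultimately show ?thesis by (simp add: a_b_m_def)
qed

definition conv :: "('g \<Rightarrow> complex) \<Rightarrow> ('g \<Rightarrow> complex) \<Rightarrow> 'g \<Rightarrow> complex" where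
  "conv f g x = cmean (\<lambda>y. f y * g (x - y))"

lemma conv_integrand_continuous:
  fixes f g :: "'g \<Rightarrow> complex"
  assumes f: "continuous_on UNIV f" and g: "continuous_on UNIV g"
  shows "continuous_on UNIV (\<lambda>(x, y). f y * g (x - y))"
  unfolding case_prod_beta
  by (rule continuous_on_mult continuous_on_compose2[OF f] continuous_on_compose2[OF g]
      continuous_on_diff continuous_on_fst continuous_on_snd continuous_on_id subset_UNIV)+

lemmas conv_integrand = continuous_slices(1)[OF conv_integrand_continuous]

lemma conv_continuous:
  "continuous_on UNIV f \<Longrightarrow> continuous_on UNIV g \<Longrightarrow> continuous_on UNIV (conv f g)"
  unfolding conv_def[abs_def] by (intro cmean_continuous conv_integrand_continuous)

lemma conv_commute:
  assumes "continuous_on UNIV f" "continuous_on UNIV g"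
  shows "conv f g = conv g f"
proof
  fix x
  have "conv f g x = cmean (\<lambda>y. f (x - y) * g (x - (x - y)))"
    unfolding conv_def by (rule cmean_reflect[OF conv_integrand[OF assms], symmetric])
  then show "conv f g x = conv g f x"
    by (simp add: conv_def mult.commute G.diff_diff_eq2 G.add_diff_cancel_left')
qed

lemma conv_assoc:
  assumes f: "continuous_on UNIV f" and g: "continuous_on UNIV g" and h: "continuous_on UNIV h"
  shows "conv (conv f g) h = conv f (conv g h)"
proof
  fix x
  have c: "continuous_on UNIV (\<lambda>(y, z). h (x - y) * (f z * g (y - z)))"
    unfolding case_prod_beta
    by (rule continuous_on_mult continuous_on_compose2[OF f] continuous_on_compose2[OF g] continuous_on_compose2[OF h]
      continuous_on_fst continuous_on_snd continuous_on_diff continuous_on_id continuous_on_const subset_UNIV)+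
  have c': "continuous_on UNIV (\<lambda>y. g (y - z) * h (x - y))" for z
    by (rule continuous_on_mult continuous_on_compose2[OF g] continuous_on_compose2[OF h]
      continuous_on_diff continuous_on_id continuous_on_const subset_UNIV)+
  have "conv (conv f g) h x = cmean (\<lambda>y. cmean (\<lambda>z. h (x - y) * (f z * g (y - z))))"
    unfolding conv_def cmean_mult[OF conv_integrand[OF f g]] by (simp add: mult.commute)
  also have "\<dots> = cmean (\<lambda>z. cmean (\<lambda>y. h (x - y) * (f z * g (y - z))))"
    by (rule cmean_swap[OF c])
  also have "\<dots> = cmean (\<lambda>z. f z * cmean (\<lambda>y. g (y - z) * h (x - y)))"
    by (simp add: cmean_mult[OF c', symmetric] mult_ac)
  also have "\<dots> = cmean (\<lambda>z. f z * conv g h (x - z))"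
  proof -
    have "cmean (\<lambda>y. g (y - z) * h (x - y)) = conv g h (x - z)" for z
      using cmean_shift[OF c', of z z] unfolding conv_def by (simp add: G.diff_diff_add G.add_diff_cancel_left')
    then show ?thesis by simp
  qed
  finally show "conv (conv f g) h x = conv f (conv g h) x" by (simp add: conv_def)
qed

lemma conv_add_right:
  assumes "continuous_on UNIV f" "continuous_on UNIV g" "continuous_on UNIV h"
  shows "conv f (\<lambda>x. g x + h x) = (\<lambda>x. conv f g x + conv f h x)"
  unfolding conv_def using cmean_add[OF conv_integrand[OF assms(1,2)] conv_integrand[OF assms(1,3)]]
  by (simp add: distrib_left)

lemma conv_scale_right:
  assumes "continuous_on UNIV f" "continuous_on UNIV g"
  shows "conv f (\<lambda>x. c * g x) = (\<lambda>x. c * conv f g x)"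
  unfolding conv_def cmean_mult[OF conv_integrand[OF assms], symmetric] by (simp add: mult_ac)

lemma conv_scale_left:
  assumes "continuous_on UNIV f" "continuous_on UNIV g"
  shows "conv (\<lambda>x. c * f x) g = (\<lambda>x. c * conv f g x)"
  unfolding conv_commute[OF assms] conv_commute[OF continuous_on_mult_left[OF assms(1)] assms(2)]
  by (rule conv_scale_right[OF assms(2,1)])

lemma conv_diff_right:
  assumes "continuous_on UNIV f" "continuous_on UNIV g" "continuous_on UNIV h"
  shows "conv f (\<lambda>x. g x - h x) = (\<lambda>x. conv f g x - conv f h x)"
  unfolding conv_def using cmean_diff[OF conv_integrand[OF assms(1,2)] conv_integrand[OF assms(1,3)]]
  by (simp add: right_diff_distrib)

lemma conv_shift_right:
  assumes "continuous_on UNIV f" "continuous_on UNIV g"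
  shows "conv f (\<lambda>x. g (a + x)) = (\<lambda>x. conv f g (a + x))"
  unfolding conv_def by (simp add: add_diff_eq)

lemma norm_conv_le:
  assumes f: "continuous_on UNIV f" and g: "continuous_on UNIV g"
  shows "(norm (conv f g x))\<^sup>2 \<le> norm2 f * norm2 g"
proof -
  have c: "continuous_on UNIV (\<lambda>y. g (x - y))"
    by (rule continuous_on_compose2[OF g] continuous_on_diff continuous_on_id continuous_on_const subset_UNIV)+
  have "continuous_on UNIV (\<lambda>y. of_real ((norm (g y))\<^sup>2) :: complex)"
    by (intro continuous_on_of_real continuous_on_power continuous_on_norm g)
  from cmean_reflect[OF this, of x] have "norm2 (\<lambda>y. g (x - y)) = norm2 g"
    unfolding cmean_of_real norm2_def of_real_eq_iff .
  then show ?thesis using cmean_Cauchy_Schwarz[OF f c] by (simp add: conv_def)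
qed

text \<open>
  The self-adjoint elements of the convolution algebra, with involution \<open>f \<mapsto> (\<lambda>x. cnj (f (- x)))\<close>.
\<close>

definition hermitian :: "('g \<Rightarrow> complex) \<Rightarrow> bool" where
  "hermitian f \<longleftrightarrow> continuous_on UNIV f \<and> (\<forall>x. f (- x) = cnj (f x))"

lemma hermitian_continuous: "hermitian f \<Longrightarrow> continuous_on UNIV f"
  by (simp add: hermitian_def)

lemma conv_adjoint:
  assumes f: "continuous_on UNIV f" and g: "continuous_on UNIV g"
  shows "conv (\<lambda>x. cnj (f (- x))) (\<lambda>x. cnj (g (- x))) = (\<lambda>x. cnj (conv f g (- x)))"
proof
  fix x
  have "conv (\<lambda>x. cnj (f (- x))) (\<lambda>x. cnj (g (- x))) x = cmean (\<lambda>y. cnj (f (- y) * g (- x - (- y))))"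
    unfolding conv_def by (simp add: comm)
  also have "\<dots> = cmean (\<lambda>y. cnj (f y * g (- x - y)))"
    using cmean_reflect[OF continuous_on_cnj[OF conv_integrand[OF f g, of "-x"]], of 0] by simp
  also have "\<dots> = cnj (conv f g (- x))"
    unfolding conv_def by (rule cmean_cnj[OF conv_integrand[OF f g]])
  finally show "conv (\<lambda>x. cnj (f (- x))) (\<lambda>x. cnj (g (- x))) x = cnj (conv f g (- x))" .
qed

lemma hermitian_conv:
  assumes "hermitian f" "hermitian g"
  shows "hermitian (conv f g)"
proof -
  have "(\<lambda>x. cnj (f (- x))) = f" "(\<lambda>x. cnj (g (- x))) = g" using assms by (auto simp: hermitian_def)
  with conv_adjoint[of f g] assms have "conv f g x = cnj (conv f g (- x))" for x
    by (metis hermitian_continuous)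
  then have "cnj (conv f g x) = conv f g (- x)" for x by (metis complex_cnj_cnj)
  then show ?thesis using assms by (simp add: hermitian_def conv_continuous)
qed

lemma conv_self_zero:
  assumes "hermitian f"
  shows "conv f f 0 = of_real (norm2 f)"
proof -
  have "f y * f (0 - y) = of_real ((norm (f y))\<^sup>2)" for y
    using assms complex_norm_square[of "f y"] by (simp add: hermitian_def)
  then show ?thesis unfolding conv_def norm2_def cmean_of_real[symmetric] by (simp only:)
qed

lemma norm_conv_self_le:
  assumes "continuous_on UNIV f"
  shows "norm (conv f f x) \<le> norm2 f"
proof (rule power2_le_imp_le)
  show "(norm (conv f f x))\<^sup>2 \<le> (norm2 f)\<^sup>2"
    using norm_conv_le[OF assms assms, of x] unfolding power2_eq_square[of "norm2 f"] .
qed (rule norm2_nonneg[OF assms])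

lemma conv_uniform_limit:
  assumes f: "continuous_on UNIV f" and g: "\<And>n::nat. continuous_on UNIV (g n)"
    and lim: "uniform_limit UNIV g h sequentially"
  shows "(\<lambda>n. conv f (g n) x) \<longlonglongrightarrow> conv f h x"
proof -
  have h: "continuous_on UNIV h"
    by (rule uniform_limit_theorem[OF _ lim]) (auto simp: g)
  obtain B where B: "\<And>x. \<bar>norm (f x)\<bar> \<le> B" "B \<ge> 0"
    using continuous_bounds[OF continuous_on_norm[OF f]] by metis
  show ?thesis
  proof (rule LIMSEQ_I)
    fix e :: real assume "0 < e"
    then have "0 < e / (B + 1)" using B(2) by simp
    from uniform_limitD[OF lim this] obtain N where
      N: "\<And>n y. n \<ge> N \<Longrightarrow> dist (g n y) (h y) < e / (B + 1)"
      by (auto simp: eventually_sequentially)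
    have "norm (conv f (g n) x - conv f h x) < e" if "n \<ge> N" for n
    proof -
      have c: "continuous_on UNIV (\<lambda>y. g n y - h y)" by (intro continuous_on_diff g h)
      have "norm (conv f (\<lambda>y. g n y - h y) x) \<le> B * (e / (B + 1))"
        unfolding conv_def
      proof (rule norm_cmean_bound[OF conv_integrand[OF f c]])
        fix y
        show "norm (f y * (g n (x - y) - h (x - y))) \<le> B * (e / (B + 1))"
          unfolding norm_mult using B N[OF that, of "x - y"] by (intro mult_mono) (auto simp: dist_norm)
      qed
      also have "\<dots> < e" using B(2) \<open>0 < e\<close> by (simp add: field_simps)
      finally show ?thesis by (simp add: conv_diff_right[OF f g h])
    qed
    then show "\<exists>no. \<forall>n\<ge>no. norm (conv f (g n) x - conv f h x) < e" by blast
  qed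
qed

section \<open>Idempotents and characters\<close>

text \<open>
  Power iteration. Convolution by \<open>\<psi>\<close> is a compact self-adjoint operator; the even convolution powers
  of \<open>\<psi>\<close>, divided by the matching powers of the largest eigenvalue \<open>l\<close> of the square of this operator,
  converge to the kernel \<open>h\<close> of the projection onto the eigenspace of \<open>l\<close>. The proof finds \<open>l\<close> as the
  limit of the ratios of consecutive norms, without any spectral theory.
  
  In detail, let \<open>w n\<close> be the convolution power of \<open>\<psi>\<close> with \<open>n + 1\<close> factors and \<open>c n\<close> its squared norm,
  which is also the value at \<open>0\<close> of \<open>w (2n+1)\<close>. By Cauchy-Schwarz \<open>c\<close> is log-convex, so the
  ratios \<open>r n\<close> increase to a limit \<open>l\<close> and \<open>e n = c n / l ^ (n+1)\<close> decreases. It is submultiplicative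
  as well, which together with \<open>e (m+k) / e m \<longlonglongrightarrow> 1\<close> forces \<open>e n \<ge> 1\<close>. So \<open>e\<close> has a positive limit;
  as the distances of the functions \<open>h n = w (2n+1) / l ^ (n+1)\<close> are second differences of \<open>e\<close>, these
  functions form a Cauchy sequence, and one further convolution makes the convergence uniform.
\<close>

lemma top_idempotent:
  assumes psi: "hermitian \<psi>" and nz: "\<psi> x0 \<noteq> 0"
  shows "\<exists>h l. hermitian h \<and> h 0 \<noteq> 0 \<and> conv h h = h \<and> l \<noteq> 0 \<and>
    conv (conv \<psi> \<psi>) h = (\<lambda>x. l * h x)"
proof -
  define w where "w n = (conv \<psi> ^^ n) \<psi>" for n
  have w0: "w 0 = \<psi>" and wSuc: "w (Suc n) = conv \<psi> (w n)" for n by (simp_all add: w_def)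
  have hw: "hermitian (w n)" for n
    by (induction n) (simp_all add: w0 wSuc psi hermitian_conv)
  note cw = hermitian_continuous[OF hw] and cpsi = hermitian_continuous[OF psi]
  have conv_w: "conv (w m) (w n) = w (m + n + 1)" for m n
  proof (induction m)
    case (Suc m)
    have "conv (w (Suc m)) (w n) = conv \<psi> (conv (w m) (w n))"
      unfolding wSuc by (rule conv_assoc[OF cpsi cw cw])
    then show ?case using Suc by (simp add: wSuc)
  qed (simp add: w0 wSuc)
  define c where "c n = norm2 (w n)" for n
  have c_w: "w (2 * n + 1) 0 = of_real (c n)" for n
    using conv_self_zero[OF hw[of n]] conv_w[of n n] by (simp add: c_def mult_2)
  have bound_w: "norm (w (2 * n + 1) x) \<le> c n" for n x
    using norm_conv_self_le[OF cw, of n x] conv_w[of n n] by (simp add: c_def mult_2)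
  have log_convex: "(c (Suc n))\<^sup>2 \<le> c n * c (Suc (Suc n))" for n
  proof -
    have "w (2 * Suc n + 1) = conv (w n) (w (Suc (Suc n)))" by (simp add: conv_w mult_2)
    then show ?thesis
      using norm_conv_le[OF cw[of n] cw[of "Suc (Suc n)"], of 0] c_w[of "Suc n"]
      by (simp add: c_def)
  qed
  have c_pos: "0 < c n \<and> 0 < c (Suc n)" for n
  proof (induction n)
    case 0
    have "0 < c 0" unfolding c_def using nz w0 by (intro norm2_pos[of _ x0] cw) simp
    moreover from this have "w 1 0 \<noteq> 0" using c_w[of 0] by simp
    then have "0 < c 1" unfolding c_def by (intro norm2_pos[of _ 0] cw)
    ultimately show ?case by simp
  next
    case (Suc n)
    then have "0 < (c (Suc n))\<^sup>2" by simp
    then have "0 < c n * c (Suc (Suc n))" using log_convex[of n] by linarith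
    then show ?case using Suc zero_less_mult_pos by blast
  qed
  define r where "r n = c (Suc n) / c n" for n
  have "incseq r"
  proof (rule incseq_SucI)
    fix n show "r n \<le> r (Suc n)"
      using log_convex[of n] c_pos[of n] c_pos[of "Suc n"]
      by (simp add: r_def divide_simps power2_eq_square mult.commute)
  qed
  moreover have "r n \<le> c 0" for n
  proof -
    have "c (Suc n) \<le> mean (\<lambda>_::'g. c 0 * c n)"
      unfolding c_def norm2_def[of "w (Suc n)"]
    proof (rule mean_mono)
      show "(norm (w (Suc n) x))\<^sup>2 \<le> norm2 (w 0) * norm2 (w n)" for x
        unfolding wSuc w0 by (rule norm_conv_le[OF cpsi cw])
    qed (intro continuous_on_power continuous_on_norm cw continuous_on_const)+
    then show ?thesis using c_pos[of n] by (simp add: r_def divide_simps)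
  qed
  ultimately obtain l where l: "r \<longlonglongrightarrow> l" "\<forall>n. r n \<le> l"
    using incseq_convergent[of r "c 0"] by auto
  have "0 < l" using l(2)[rule_format, of 0] c_pos[of 0] by (simp add: r_def) (metis divide_pos_pos less_le_trans)
  define e where "e n = c n / l ^ (n + 1)" for n
  have e_pos: "0 < e n" for n using c_pos[of n] \<open>0 < l\<close> by (simp add: e_def)
  then have e_nz: "e n \<noteq> 0" for n by (simp add: less_imp_neq[THEN not_sym])
  have e_Suc: "e (Suc n) = e n * (r n / l)" for n
    using c_pos[of n] \<open>0 < l\<close> by (simp add: e_def r_def)
  have e_dec: "e (Suc n) \<le> e n" for n
    unfolding e_Suc using l(2) \<open>0 < l\<close> e_pos[of n] by (intro mult_left_le) auto
  (* The value at 0 of a convolution of two functions that are bounded by c m and c n. *)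
  have e_mult: "e (m + n + 1) \<le> e m * e n" for m n
  proof -
    have "w (2 * (m + n + 1) + 1) = conv (w (2 * m + 1)) (w (2 * n + 1))"
      unfolding conv_w by (simp add: algebra_simps)
    then have "of_real (c (m + n + 1)) = conv (w (2 * m + 1)) (w (2 * n + 1)) 0"
      using c_w[of "m + n + 1"] by (simp only:)
    then have "norm (of_real (c (m + n + 1)) :: complex) = norm (conv (w (2 * m + 1)) (w (2 * n + 1)) 0)"
      by (rule arg_cong)
    then have "\<bar>c (m + n + 1)\<bar> = norm (conv (w (2 * m + 1)) (w (2 * n + 1)) 0)" unfolding norm_of_real .
    also have "\<dots> \<le> c m * c n" unfolding conv_def
    proof (rule norm_cmean_bound[OF conv_integrand[OF cw cw]])
      fix y show "norm (w (2 * m + 1) y * w (2 * n + 1) (0 - y)) \<le> c m * c n"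
        unfolding norm_mult using c_pos[of m] by (intro mult_mono bound_w) auto
    qed
    finally have "c (m + n + 1) / l ^ (m + n + 1 + 1) \<le> c m * c n / l ^ (m + n + 1 + 1)"
      using \<open>0 < l\<close> by (intro divide_right_mono) auto
    then show ?thesis by (simp add: e_def power_add mult_ac)
  qed
  have ratio: "(\<lambda>m. e (m + k) / e m) \<longlonglongrightarrow> 1" for k
  proof (induction k)
    case 0
    show ?case by (simp add: e_nz)
  next
    case (Suc k)
    have "(\<lambda>m. e (m + k) / e m * (r (m + k) / l)) \<longlonglongrightarrow> 1 * (l / l)"
      using tendsto_mult[OF Suc tendsto_divide[OF LIMSEQ_ignore_initial_segment[OF l(1), of k] tendsto_const, of l]] \<open>0 < l\<close> by simp
    then show ?case using \<open>0 < l\<close> by (simp add: e_Suc mult_ac)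
  qed
  (* If e n < 1, the quotients e (m + n + 1) / e m would stay below e n and could not tend to 1. *)
  have e_ge: "1 \<le> e n" for n
  proof (rule LIMSEQ_le_const2[OF ratio])
    have "e (m + (n + 1)) / e m \<le> e n" for m
      using e_mult[of m n] e_pos[of m] by (simp add: pos_divide_le_eq mult.commute)
    then show "\<exists>N. \<forall>m\<ge>N. e (m + (n + 1)) / e m \<le> e n" by blast
  qed
  have "decseq e" by (rule decseq_SucI) (rule e_dec)
  moreover have "\<forall>n. 0 \<le> e n" using e_pos less_imp_le by blast
  ultimately obtain E where E: "e \<longlonglongrightarrow> E" using decseq_convergent by blast
  have "1 \<le> E" by (rule LIMSEQ_le_const[OF E]) (use e_ge in auto)
  define L where "L n = complex_of_real (inverse (l ^ (n + 1)))" for n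
  define h where "h n = (\<lambda>x. L n * w (2 * n + 1) x)" for n
  have hh: "hermitian (h n)" for n
    using hw[of "2 * n + 1"] by (simp add: hermitian_def h_def L_def continuous_on_mult_left)
  note ch = hermitian_continuous[OF hh]
  have conv_h: "conv (h m) (h n) = h (m + n + 1)" for m n
  proof -
    have "conv (h m) (h n) = (\<lambda>x. L n * conv (h m) (w (2 * n + 1)) x)"
      unfolding h_def[of n] by (rule conv_scale_right[OF ch cw])
    also have "\<dots> = (\<lambda>x. L n * (L m * w (2 * m + 1 + (2 * n + 1) + 1) x))"
      unfolding h_def conv_scale_left[OF cw cw] conv_w ..
    also have "\<dots> = h (m + n + 1)"
      using \<open>0 < l\<close> by (simp add: h_def L_def power_add algebra_simps)
    finally show ?thesis .
  qed
  have h0: "h n 0 = of_real (e n)" for n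
    unfolding h_def c_w by (simp add: L_def e_def divide_inverse mult.commute)
  (* h m is hermitian, so the squared distance is the value at 0 of the convolution square
     of the difference. *)
  have dist_h: "norm2 (\<lambda>x. h m x - h n x) = e (m + m + 1) - 2 * e (m + n + 1) + e (n + n + 1)" for m n
  proof -
    let ?d = "\<lambda>x. h m x - h n x"
    have d: "hermitian ?d" using hh[of m] hh[of n] by (simp add: hermitian_def continuous_on_diff)
    have "conv ?d ?d = (\<lambda>x. conv ?d (h m) x - conv ?d (h n) x)"
      by (rule conv_diff_right[OF hermitian_continuous[OF d] ch ch])
    also have "\<dots> = (\<lambda>x. conv (h m) ?d x - conv (h n) ?d x)"
      by (simp only: conv_commute[OF hermitian_continuous[OF d] ch])
    also have "\<dots> = (\<lambda>x. (h (m + m + 1) x - h (m + n + 1) x) - (h (n + m + 1) x - h (n + n + 1) x))"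
      by (simp only: conv_diff_right[OF ch ch ch] conv_h)
    finally have "conv ?d ?d 0 = (of_real (e (m + m + 1)) - of_real (e (m + n + 1)))
        - (of_real (e (n + m + 1)) - of_real (e (n + n + 1)))" by (simp only: h0)
    then have "complex_of_real (norm2 ?d) = of_real (e (m + m + 1) - 2 * e (m + n + 1) + e (n + n + 1))"
      unfolding conv_self_zero[OF d] add.commute[of n m] by simp
    then show ?thesis unfolding of_real_eq_iff .
  qed
  have "\<exists>H. uniform_limit UNIV (\<lambda>n. h (Suc n)) H sequentially"
  proof -
    have "uniformly_Cauchy_on UNIV (\<lambda>n. h (Suc n))"
      unfolding uniformly_Cauchy_on_def
    proof (intro allI impI)
      fix d :: real assume "0 < d"
      define K where "K = norm2 (h 0) + 1"
      have "K > 0" using norm2_nonneg[OF ch, of 0] by (simp add: K_def)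
      then have "0 < d\<^sup>2 / (4 * K)" using \<open>0 < d\<close> by simp
      from LIMSEQ_D[OF E this] obtain N where N: "\<And>n. n \<ge> N \<Longrightarrow> \<bar>e n - E\<bar> < d\<^sup>2 / (4 * K)" by auto
      have "dist (h (Suc m) x) (h (Suc n) x) < d" if "m \<ge> N" "n \<ge> N" for m n x
      proof -
        have "h (Suc m) x - h (Suc n) x = conv (h 0) (\<lambda>x. h m x - h n x) x"
          unfolding conv_diff_right[OF ch ch ch] conv_h by simp
        then have "(norm (h (Suc m) x - h (Suc n) x))\<^sup>2 \<le> norm2 (h 0) * norm2 (\<lambda>x. h m x - h n x)"
          using norm_conv_le[OF ch[of 0] continuous_on_diff[OF ch[of m] ch[of n]], of x] by (simp only:)
        also have "\<dots> \<le> K * norm2 (\<lambda>x. h m x - h n x)"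
          by (intro mult_right_mono norm2_nonneg continuous_on_diff ch) (simp add: K_def)
        also have "\<dots> < K * (4 * (d\<^sup>2 / (4 * K)))"
          unfolding dist_h using N[of "m + m + 1"] N[of "m + n + 1"] N[of "n + n + 1"] that \<open>K > 0\<close>
          by (intro mult_strict_left_mono) linarith+
        also have "\<dots> = d\<^sup>2" using \<open>K > 0\<close> by simp
        finally show ?thesis unfolding dist_norm using \<open>0 < d\<close> by (intro power2_less_imp_less[of _ d]) auto
      qed
      then show "\<exists>M. \<forall>x\<in>UNIV. \<forall>m\<ge>M. \<forall>n\<ge>M. dist (h (Suc m) x) (h (Suc n) x) < d" by blast
    qed
    then show ?thesis using Cauchy_uniformly_convergent unfolding uniformly_convergent_on_def by blast
  qed
  then obtain H where H: "uniform_limit UNIV (\<lambda>n. h (Suc n)) H sequentially" ..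
  have cH: "continuous_on UNIV H"
    by (rule uniform_limit_theorem[OF _ H]) (auto simp: ch)
  have hH: "(\<lambda>n. h n x) \<longlonglongrightarrow> H x" for x
    using tendsto_uniform_limitI[OF H, of x] LIMSEQ_imp_Suc by auto
  have herm: "hermitian H"
  proof -
    have "H (- x) = cnj (H x)" for x
    proof (rule LIMSEQ_unique[OF hH])
      have "(\<lambda>n. cnj (h n x)) \<longlonglongrightarrow> cnj (H x)" by (intro tendsto_cnj hH)
      moreover have "h n (- x) = cnj (h n x)" for n using hh by (simp add: hermitian_def)
      ultimately show "(\<lambda>n. h n (- x)) \<longlonglongrightarrow> cnj (H x)" by simp
    qed
    then show ?thesis using cH by (simp add: hermitian_def)
  qed
  (* Convolution by h m only shifts the index, so it fixes the limit. *)
  have conv_hH: "conv (h m) H = H" for m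
  proof
    fix x
    have eq: "h (m + Suc n + 1) = h (n + (m + 2))" for n by (rule arg_cong[of _ _ h]) simp
    have "(\<lambda>n. conv (h m) (h (Suc n)) x) \<longlonglongrightarrow> conv (h m) H x" by (rule conv_uniform_limit[OF ch ch H])
    then have "(\<lambda>n. h (n + (m + 2)) x) \<longlonglongrightarrow> conv (h m) H x" unfolding conv_h eq .
    then show "conv (h m) H x = H x" by (rule LIMSEQ_unique) (rule LIMSEQ_ignore_initial_segment[OF hH])
  qed
  have "conv H H = H"
  proof
    fix x
    have "(\<lambda>n. conv H (h (Suc n)) x) \<longlonglongrightarrow> conv H H x" by (rule conv_uniform_limit[OF cH ch H])
    then have "(\<lambda>n. H x) \<longlonglongrightarrow> conv H H x" unfolding conv_commute[OF cH ch] conv_hH .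
    then show "conv H H x = H x" by (rule LIMSEQ_unique[OF _ tendsto_const])
  qed
  moreover have "H 0 \<noteq> 0"
  proof -
    have "(\<lambda>n. h n 0) \<longlonglongrightarrow> of_real E" unfolding h0 by (intro tendsto_of_real E)
    from LIMSEQ_unique[OF this hH] have "H 0 = of_real E" by simp
    then show ?thesis using \<open>1 \<le> E\<close> by simp
  qed
  moreover have "conv (conv \<psi> \<psi>) H = (\<lambda>x. of_real l * H x)"
  proof -
    have eq: "conv \<psi> \<psi> = (\<lambda>x. of_real l * h 0 x)"
    proof -
      have "w (2 * 0 + 1) = conv \<psi> \<psi>" using wSuc[of 0] by (simp add: w0)
      then show ?thesis using \<open>0 < l\<close> unfolding h_def L_def by (simp add: mult.assoc[symmetric])
    qed
    show ?thesis unfolding eq conv_scale_left[OF ch cH] conv_hH ..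
  qed
  moreover have "complex_of_real l \<noteq> 0" using \<open>0 < l\<close> by simp
  ultimately show ?thesis by (intro exI[of _ H] exI[of _ "of_real l"] conjI herm)
qed

text \<open>
  A nonzero hermitian idempotent satisfies \<open>e 0 = norm2 e \<ge> 1\<close>, because \<open>\<bar>e x\<bar> \<le> norm2 e\<close> gives \<open>norm2 e \<le> (norm2 e)\<^sup>2\<close>. If
  \<open>f\<close> is a smaller idempotent than \<open>h\<close>, then \<open>h - f\<close> is idempotent too and \<open>norm2 h = norm2 f + norm2 (h - f)\<close>,
  so each step down decreases \<open>norm2\<close> by at least one.
\<close>

lemma minimal_idempotent:
  assumes "hermitian h" "h 0 \<noteq> 0" "conv h h = h"
  shows "\<exists>e. hermitian e \<and> e 0 \<noteq> 0 \<and> conv e e = e \<and> conv h e = e \<and>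
    (\<forall>f. hermitian f \<and> f 0 \<noteq> 0 \<and> conv f f = f \<and> conv e f = f \<longrightarrow> f = e)"
  using assms
proof (induction "nat \<lfloor>norm2 h\<rfloor>" arbitrary: h rule: less_induct)
  case less
  note ch = hermitian_continuous[OF less.prems(1)]
  show ?case
  proof (cases "\<forall>f. hermitian f \<and> f 0 \<noteq> 0 \<and> conv f f = f \<and> conv h f = f \<longrightarrow> f = h")
    case True
    then show ?thesis using less.prems by (intro exI[of _ h]) simp
  next
    case False
    then obtain f where f: "hermitian f" "f 0 \<noteq> 0" "conv f f = f" "conv h f = f" "f \<noteq> h" by blast
    note cf = hermitian_continuous[OF f(1)]
    have value0: "k 0 = of_real (norm2 k)" if "hermitian k" "conv k k = k" for k
      using conv_self_zero[OF that(1)] that(2) by simp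
    let ?k = "\<lambda>x. h x - f x"
    have k: "hermitian ?k" using less.prems(1) f(1) by (simp add: hermitian_def continuous_on_diff)
    note ck = hermitian_continuous[OF k]
    have fh: "conv f h = f" using f(4) conv_commute[OF cf ch] by simp
    have "conv ?k ?k = (\<lambda>x. conv h ?k x - conv f ?k x)"
      unfolding conv_diff_right[OF ck ch cf] conv_commute[OF ck ch] conv_commute[OF ck cf] ..
    then have kk: "conv ?k ?k = ?k"
      unfolding conv_diff_right[OF ch ch cf] conv_diff_right[OF cf ch cf] by (simp add: less.prems(3) f fh)
    have "complex_of_real (norm2 f) = of_real (norm2 h - norm2 ?k)"
      using value0[OF f(1,3)] value0[OF less.prems(1,3)] value0[OF k kk] by (simp add: algebra_simps)
    then have drop: "norm2 f = norm2 h - norm2 ?k" unfolding of_real_eq_iff .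
    have "1 \<le> norm2 ?k"
    proof -
      from f(5) obtain x where "f x \<noteq> h x" by (auto simp: fun_eq_iff)
      then have "?k x \<noteq> 0" by simp
      then have pos: "0 < norm2 ?k" by (rule norm2_pos[OF ck])
      have "norm (?k x) \<le> norm2 ?k" for x using norm_conv_self_le[OF ck, of x] unfolding kk .
      then have "(norm (?k x))\<^sup>2 \<le> (norm2 ?k)\<^sup>2" for x by (intro power_mono) auto
      then have "norm2 ?k \<le> mean (\<lambda>_::'g. (norm2 ?k)\<^sup>2)"
        unfolding norm2_def[of ?k] by (intro mean_mono continuous_on_power continuous_on_norm ck continuous_on_const)
      then show ?thesis using pos by (simp add: power2_eq_square)
    qed
    then have "norm2 f + 1 \<le> norm2 h" using drop by simp
    then have "nat \<lfloor>norm2 f\<rfloor> < nat \<lfloor>norm2 h\<rfloor>" using norm2_nonneg[OF cf] by linarith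
    from less.hyps[OF this f(1-3)] obtain e where e: "hermitian e" "e 0 \<noteq> 0" "conv e e = e" "conv f e = e"
      "\<forall>f. hermitian f \<and> f 0 \<noteq> 0 \<and> conv f f = f \<and> conv e f = f \<longrightarrow> f = e" by blast
    have "conv h e = e"
      using conv_assoc[OF ch cf hermitian_continuous[OF e(1)]] e(4) f(4) by simp
    then show ?thesis using e by (intro exI[of _ e]) simp
  qed
qed

text \<open>
  For hermitian \<open>k\<close> in the ideal generated by \<open>e\<close>, \<open>top_idempotent\<close> gives an idempotent in that ideal.
  By minimality it is \<open>e\<close>, hence \<open>conv k k\<close> is a multiple of \<open>e\<close>. Applying this to \<open>k\<close> and to \<open>k + e\<close> and
  subtracting shows that \<open>k\<close> itself is a multiple of \<open>e\<close>. A general \<open>f\<close> is a combination of two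
  hermitian elements.
\<close>

lemma minimal_idempotent_scalar:
  assumes e: "hermitian e" "e 0 \<noteq> 0" "conv e e = e"
    and min: "\<And>f. hermitian f \<Longrightarrow> f 0 \<noteq> 0 \<Longrightarrow> conv f f = f \<Longrightarrow> conv e f = f \<Longrightarrow> f = e"
    and f: "continuous_on UNIV f" "conv f e = f"
  shows "\<exists>c. f = (\<lambda>x. c * e x)"
proof -
  note ce = hermitian_continuous[OF e(1)]
  have square: "\<exists>c. conv k k = (\<lambda>x. c * e x)" if k: "hermitian k" "conv k e = k" for k
  proof (cases "\<exists>x. k x \<noteq> 0")
    case False
    then have "conv k k = (\<lambda>x. 0 * e x)" by (simp add: conv_def[abs_def])
    then show ?thesis ..
  next
    case True
    note ck = hermitian_continuous[OF k(1)]
    from True top_idempotent[OF k(1)] obtain h l where h: "hermitian h" "h 0 \<noteq> 0" "conv h h = h" "l \<noteq> 0"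
      "conv (conv k k) h = (\<lambda>x. l * h x)" by blast
    note chh = hermitian_continuous[OF h(1)]
    note ckk = conv_continuous[OF ck ck]
    have kke: "conv (conv k k) e = conv k k" using conv_assoc[OF ck ck ce] k(2) by simp
    have "(\<lambda>x. l * conv e h x) = conv e (conv (conv k k) h)"
      unfolding h(5) conv_scale_right[OF ce chh] ..
    also have "\<dots> = conv (conv (conv k k) e) h"
      unfolding conv_assoc[OF ce ckk chh, symmetric] conv_commute[OF ce ckk] ..
    also have "\<dots> = (\<lambda>x. l * h x)" unfolding kke h(5) ..
    finally have "conv e h = h" using h(4) by (simp add: fun_eq_iff)
    with min h(1-3) have "h = e" by blast
    then show ?thesis using h(5) kke by (intro exI[of _ l]) simp
  qed
  have herm: "\<exists>c. k = (\<lambda>x. c * e x)" if k: "hermitian k" "conv k e = k" for k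
  proof -
    note ck = hermitian_continuous[OF k(1)]
    let ?s = "\<lambda>x. k x + e x"
    have s: "hermitian ?s" using k(1) e(1) by (simp add: hermitian_def continuous_on_add)
    note cs = hermitian_continuous[OF s]
    have ek: "conv e k = k" using conv_commute[OF ce ck] k(2) by simp
    have se: "conv ?s e = ?s"
      unfolding conv_commute[OF cs ce] conv_add_right[OF ce ck ce] ek e(3) ..
    obtain a where a: "conv k k = (\<lambda>x. a * e x)" using square[OF k] ..
    obtain b where b: "conv ?s ?s = (\<lambda>x. b * e x)" using square[OF s se] ..
    have "conv ?s ?s = (\<lambda>x. conv k ?s x + conv e ?s x)"
      unfolding conv_add_right[OF cs ck ce] conv_commute[OF cs ck] conv_commute[OF cs ce] ..
    also have "\<dots> = (\<lambda>x. (a * e x + k x) + (k x + e x))"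
      unfolding conv_add_right[OF ck ck ce] conv_add_right[OF ce ck ce] a k(2) ek e(3) ..
    finally have "b * e x = a * e x + 2 * k x + e x" for x unfolding b by (simp add: fun_eq_iff)
    then have "k x = ((b - a - 1) / 2) * e x" for x by (simp add: algebra_simps)
    then show ?thesis by blast
  qed
  define f' where "f' = (\<lambda>x. cnj (f (- x)))"
  have cf': "continuous_on UNIV f'"
    unfolding f'_def by (intro continuous_on_cnj continuous_on_compose2[OF f(1)] continuous_on_minus continuous_on_id) simp
  have e': "(\<lambda>x. cnj (e (- x))) = e" using e(1) by (auto simp: hermitian_def)
  have f'e: "conv f' e = f'" using conv_adjoint[OF f(1) ce] unfolding e' f(2) f'_def .
  have ef: "conv e f = f" "conv e f' = f'"
    using conv_commute[OF ce f(1)] conv_commute[OF ce cf'] f(2) f'e by simp_all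
  let ?p = "\<lambda>x. f x + f' x" and ?q = "\<lambda>x. \<i> * (f x - f' x)"
  have p: "hermitian ?p"
    using f(1) cf' by (simp add: hermitian_def f'_def continuous_on_add add.commute)
  have q: "hermitian ?q"
    using f(1) cf' by (simp add: hermitian_def f'_def continuous_on_diff continuous_on_mult_left algebra_simps)
  have "conv ?p e = ?p"
    unfolding conv_commute[OF hermitian_continuous[OF p] ce] conv_add_right[OF ce f(1) cf'] ef ..
  then obtain a where a: "?p = (\<lambda>x. a * e x)" using herm[OF p] by blast
  have "conv ?q e = ?q"
    unfolding conv_commute[OF hermitian_continuous[OF q] ce] conv_scale_right[OF ce continuous_on_diff[OF f(1) cf']]
      conv_diff_right[OF ce f(1) cf'] ef ..
  then obtain b where b: "?q = (\<lambda>x. b * e x)" using herm[OF q] by blast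
  have "f x = ((a - \<i> * b) / 2) * e x" for x
  proof -
    have "f x + f' x = a * e x" "\<i> * (f x - f' x) = b * e x" using a b by (simp_all add: fun_eq_iff)
    moreover have "2 * f x = (f x + f' x) - \<i> * (\<i> * (f x - f' x))" by (simp add: algebra_simps)
    ultimately show ?thesis by (simp add: algebra_simps)
  qed
  then show ?thesis by blast
qed

definition character :: "('g \<Rightarrow> complex) \<Rightarrow> bool" where
  "character \<phi> \<longleftrightarrow> continuous_on UNIV \<phi> \<and> (\<forall>x y. \<phi> (x + y) = \<phi> x * \<phi> y) \<and> (\<forall>x. norm (\<phi> x) = 1)"

lemma characterD:
  assumes "character \<phi>"
  shows "continuous_on UNIV \<phi>" "\<phi> (x + y) = \<phi> x * \<phi> y" "norm (\<phi> x) = 1"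
    "\<phi> \<in> borel_measurable borel" "\<phi> x * cnj (\<phi> x) = 1" "bounded (range \<phi>)" "\<phi> (- x) = cnj (\<phi> x)"
proof -
  show c: "continuous_on UNIV \<phi>" and m: "\<phi> (x + y) = \<phi> x * \<phi> y" and n: "norm (\<phi> x) = 1" for x y
    using assms by (auto simp: character_def)
  show "\<phi> \<in> borel_measurable borel" by (rule borel_measurable_continuous_onI[OF c])
  show i: "\<phi> x * cnj (\<phi> x) = 1" for x using n[of x] complex_norm_square[of "\<phi> x"] by simp
  show "bounded (range \<phi>)" using n by (auto simp: bounded_iff intro!: exI[of _ 1])
  have nz: "\<phi> x \<noteq> 0" for x using n[of x] by auto
  have "\<phi> 0 * \<phi> 0 = \<phi> 0" using m[of 0 0] by simp
  then have "\<phi> 0 = 1" using nz[of 0] by simp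
  then have "\<phi> x * \<phi> (- x) = \<phi> x * cnj (\<phi> x)" using m[of x "- x"] i by simp
  then show "\<phi> (- x) = cnj (\<phi> x)" using nz by simp
qed

lemma character_one: "character (\<lambda>_. 1)"
  by (simp add: character_def)

lemma character_mult: "character \<phi> \<Longrightarrow> character \<theta> \<Longrightarrow> character (\<lambda>x. \<phi> x * \<theta> x)"
  by (auto simp: character_def norm_mult intro!: continuous_on_mult)

lemma character_cnj: "character \<phi> \<Longrightarrow> character (\<lambda>x. cnj (\<phi> x))"
  by (auto simp: character_def intro!: continuous_on_cnj)

text \<open>
  The translates of \<open>e\<close> lie in the ideal generated by \<open>e\<close>, hence are multiples of \<open>e\<close>. This is the
  functional equation of a character.
\<close>

lemma minimal_idempotent_character:
  assumes e: "hermitian e" "e 0 \<noteq> 0" "conv e e = e"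
    and min: "\<And>f. hermitian f \<Longrightarrow> f 0 \<noteq> 0 \<Longrightarrow> conv f f = f \<Longrightarrow> conv e f = f \<Longrightarrow> f = e"
  shows "character (\<lambda>x. e x / e 0)"
proof -
  note ce = hermitian_continuous[OF e(1)]
  have mult: "e (a + x) * e 0 = e a * e x" for a x
  proof -
    have c: "continuous_on UNIV (\<lambda>x. e (a + x))"
      by (intro continuous_on_compose2[OF ce] continuous_on_add continuous_on_const continuous_on_id) simp
    have "conv (\<lambda>x. e (a + x)) e = (\<lambda>x. e (a + x))"
      unfolding conv_commute[OF c ce] conv_shift_right[OF ce ce] e(3) ..
    from minimal_idempotent_scalar[OF e min c this]
    obtain k where k: "(\<lambda>x. e (a + x)) = (\<lambda>x. k * e x)" by blast
    then show ?thesis using fun_cong[OF k, of x] fun_cong[OF k, of 0] by simp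
  qed
  have real0: "cnj (e 0) = e 0" using e(1) unfolding hermitian_def by (metis minus_zero)
  have "e x * cnj (e x) = e 0 * cnj (e 0)" for x
    using mult[of "- x" x] e(1) unfolding hermitian_def by (simp add: real0 mult.commute)
  then have "(norm (e x))\<^sup>2 = (norm (e 0))\<^sup>2" for x
    unfolding complex_norm_square[symmetric] of_real_eq_iff by simp
  then have "norm (e x) = norm (e 0)" for x by (simp add: power2_eq_iff_nonneg)
  then show ?thesis unfolding character_def using mult e(2)
    by (auto intro!: continuous_on_divide ce simp: norm_divide divide_simps mult.commute)
qed

text \<open>
  Choose a continuous \<open>f\<close> that separates \<open>a\<close> and \<open>b\<close>, and let \<open>v\<close> be the difference of \<open>f\<close> and its
  translate by \<open>b - a\<close>. Convolution by \<open>v\<close> kills all functions with period \<open>b - a\<close>. The hermitian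
  function \<open>\<psi>\<close>, the convolution of \<open>v\<close> with its adjoint, is not zero, and it acts on some character
  by a number that is not zero. That character does not have period \<open>b - a\<close>.
\<close>

theorem characters_separate:
  assumes "a \<noteq> b"
  shows "\<exists>\<phi>. character \<phi> \<and> \<phi> a \<noteq> \<phi> b"
proof -
  obtain u :: "'g \<Rightarrow> real" where u: "continuous_on UNIV u" "u a = 0" "u b = 1"
    using compact_t2_Urysohn[OF compact_G compact_sing compact_sing, of b a] assms by (metis Int_insert_left_if0 Int_empty_left singletonD singletonI)
  define f where "f x = complex_of_real (u x)" for x
  have f: "continuous_on UNIV f" "f a \<noteq> f b" using u by (auto simp: f_def intro: continuous_on_of_real)
  define t where "t = b - a"
  have ft: "continuous_on UNIV (\<lambda>x. f (t + x))"
    by (intro continuous_on_compose2[OF f(1)] continuous_on_add continuous_on_const continuous_on_id) simp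
  define v where "v = (\<lambda>x. f x - f (t + x))"
  have v: "continuous_on UNIV v" unfolding v_def by (intro continuous_on_diff f ft)
  define v' where "v' = (\<lambda>x. cnj (v (- x)))"
  have v': "continuous_on UNIV v'"
    unfolding v'_def by (intro continuous_on_cnj continuous_on_compose2[OF v] continuous_on_minus continuous_on_id) simp
  define \<psi> where "\<psi> = conv v v'"
  have "conv v v' = conv v' v" by (rule conv_commute[OF v v'])
  moreover have "(\<lambda>x. cnj (v' (- x))) = v" by (simp add: v'_def)
  ultimately have "\<psi> x = cnj (\<psi> (- x))" for x
    using conv_adjoint[OF v v'] unfolding \<psi>_def v'_def[symmetric] by (metis (no_types))
  then have psi: "hermitian \<psi>" unfolding hermitian_def
    using conv_continuous[OF v v'] by (metis \<psi>_def complex_cnj_cnj)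
  have "\<psi> 0 = of_real (norm2 v)"
  proof -
    have "v y * v' (0 - y) = of_real ((norm (v y))\<^sup>2)" for y
      using complex_norm_square[of "v y"] by (simp add: v'_def)
    then show ?thesis unfolding \<psi>_def conv_def norm2_def cmean_of_real[symmetric] by (simp only:)
  qed
  moreover have "v a \<noteq> 0" using f(2) by (simp add: v_def t_def)
  then have "0 < norm2 v" by (rule norm2_pos[OF v])
  ultimately have "\<psi> 0 \<noteq> 0" by simp
  from top_idempotent[OF psi this] obtain h l where h: "hermitian h" "h 0 \<noteq> 0" "conv h h = h" "l \<noteq> 0"
    "conv (conv \<psi> \<psi>) h = (\<lambda>x. l * h x)" by blast
  from minimal_idempotent[OF h(1-3)] obtain e where e: "hermitian e" "e 0 \<noteq> 0" "conv e e = e" "conv h e = e"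
    and min: "\<And>f. hermitian f \<Longrightarrow> f 0 \<noteq> 0 \<Longrightarrow> conv f f = f \<Longrightarrow> conv e f = f \<Longrightarrow> f = e" by blast
  note ce = hermitian_continuous[OF e(1)] and cpsi = hermitian_continuous[OF psi] and chh = hermitian_continuous[OF h(1)]
  have char: "character (\<lambda>x. e x / e 0)"
  proof (rule minimal_idempotent_character[OF e(1-3)])
    fix f assume "hermitian f" "f 0 \<noteq> 0" "conv f f = f" "conv e f = f"
    then show "f = e" by (rule min)
  qed
  have "e a / e 0 \<noteq> e b / e 0"
  proof
    assume eq: "e a / e 0 = e b / e 0"
    have m: "e (x + y) / e 0 = (e x / e 0) * (e y / e 0)" for x y using char by (simp add: character_def)
    have "e b / e 0 = (e t / e 0) * (e a / e 0)" using m[of t a] by (simp add: t_def)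
    moreover have "e a / e 0 \<noteq> 0" using char unfolding character_def by (metis norm_zero zero_neq_one)
    ultimately have "e t / e 0 = 1" unfolding eq[symmetric] by (metis mult_cancel_right1)
    then have per: "e (t + x) = e x" for x using m[of t x] e(2) by simp
    have "conv e v = (\<lambda>x. conv e f x - conv e f (t + x))"
      unfolding v_def conv_diff_right[OF ce f(1) ft] conv_shift_right[OF ce f(1)] ..
    also have "\<dots> = (\<lambda>x. 0)"
      using conv_shift_right[OF f(1) ce, of t] unfolding conv_commute[OF ce f(1)] per by (simp add: fun_eq_iff)
    finally have "conv e v = (\<lambda>x. 0)" .
    then have "conv e \<psi> = (\<lambda>x. 0)"
      unfolding \<psi>_def using conv_assoc[OF ce v v'] by (simp add: conv_def[abs_def])
    then have z: "conv \<psi> e = (\<lambda>x. 0)" using conv_commute[OF ce cpsi] by simp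
    have "conv (conv \<psi> \<psi>) e = (\<lambda>x. 0)"
      unfolding conv_assoc[OF cpsi cpsi ce] z by (simp add: conv_def[abs_def])
    moreover have "conv (conv \<psi> \<psi>) e = (\<lambda>x. l * e x)"
      using conv_assoc[OF conv_continuous[OF cpsi cpsi] chh ce] unfolding e(4) h(5) conv_scale_left[OF chh ce] e(4) by simp
    ultimately show False using h(4) e(2) by (metis mult_eq_0_iff)
  qed
  with char show ?thesis by blast
qed

end

section \<open>Radon probability measures\<close>

lemma radon_probD:
  assumes "radon_prob P"
  shows "prob_space P" "sets P = sets borel"
    "B \<in> sets borel \<Longrightarrow> emeasure P B = (SUP K\<in>{K. K \<subseteq> B \<and> compact K}. emeasure P K)"
  using assms unfolding radon_prob_def by blast+

lemma radon_prob_inner: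
  assumes P: "radon_prob P" and B: "B \<in> sets borel" and "0 < e"
  shows "\<exists>K. compact K \<and> K \<subseteq> B \<and> measure P B < measure P K + e"
proof (rule ccontr)
  interpret prob_space P by (rule radon_probD(1)[OF P])
  assume "\<not> ?thesis"
  then have le: "measure P K \<le> measure P B - e" if "compact K" "K \<subseteq> B" for K
    using that not_le by (metis le_diff_eq)
  have "emeasure P B = (SUP K\<in>{K. K \<subseteq> B \<and> compact K}. emeasure P K)"
    by (rule radon_probD(3)[OF P B])
  also have "\<dots> \<le> ennreal (measure P B - e)"
    using le by (intro SUP_least) (auto simp: emeasure_eq_measure intro!: ennreal_leI)
  finally have "measure P B \<le> measure P B - e"
    using le[of "{}"] by (simp add: emeasure_eq_measure)
  then show False using \<open>0 < e\<close> by simp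
qed

lemma radon_probI:
  fixes P :: "'a::t2_space measure"
  assumes "prob_space P" and sb: "sets P = sets borel"
    and inner: "\<And>B e. B \<in> sets borel \<Longrightarrow> 0 < e \<Longrightarrow> \<exists>K. compact K \<and> K \<subseteq> B \<and> measure P B \<le> measure P K + e"
  shows "radon_prob P"
proof -
  interpret prob_space P by fact
  have "emeasure P B = (SUP K\<in>{K. K \<subseteq> B \<and> compact K}. emeasure P K)" if B: "B \<in> sets borel" for B
  proof (rule ennreal_approx_SUP)
    show "emeasure P K \<le> emeasure P B" if "K \<in> {K. K \<subseteq> B \<and> compact K}" for K
      using that B by (intro emeasure_mono) (auto simp: sb)
    show "\<exists>K\<in>{K. K \<subseteq> B \<and> compact K}. emeasure P B \<le> emeasure P K + ennreal e" if e: "0 < e" for e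
    proof -
      obtain K where "compact K" "K \<subseteq> B" "measure P B \<le> measure P K + e" using inner[OF B e] by blast
      then show ?thesis using e
        by (intro bexI[of _ K]) (auto simp: emeasure_eq_measure ennreal_plus[symmetric] simp del: ennreal_plus)
    qed
  qed
  then show ?thesis unfolding radon_prob_def using assms(1,2) by blast
qed

text \<open>
  Outer regularity is inner regularity of the complement: there is a compact \<open>L\<close> disjoint from \<open>K\<close> with
  \<open>P (- L) < P K + e\<close>, and a continuous function between the indicators of \<open>K\<close> and \<open>- L\<close> compares the
  two measures.
\<close>

lemma radon_prob_compact_le:
  fixes P Q :: "'a::t2_space measure"
  assumes comp: "compact (UNIV :: 'a set)" and P: "radon_prob P" and Q: "radon_prob Q"
    and eq: "\<And>f :: 'a \<Rightarrow> real. continuous_on UNIV f \<Longrightarrow> (\<integral>x. f x \<partial>P) = (\<integral>x. f x \<partial>Q)"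
    and K: "compact K"
  shows "measure Q K \<le> measure P K"
proof (rule field_le_epsilon)
  interpret P: prob_space P by (rule radon_probD(1)[OF P])
  interpret Q: prob_space Q by (rule radon_probD(1)[OF Q])
  note sP = radon_probD(2)[OF P] and sQ = radon_probD(2)[OF Q]
  fix e :: real assume "0 < e"
  have Kb: "K \<in> sets borel" by (rule borel_compact[OF K])
  obtain L where L: "compact L" "L \<subseteq> - K" "measure P (- K) < measure P L + e"
    using radon_prob_inner[OF P, of "- K" e] Kb \<open>0 < e\<close> by auto
  have Lb: "L \<in> sets borel" by (rule borel_compact[OF L(1)])
  obtain f :: "'a \<Rightarrow> real" where f: "continuous_on UNIV f" "\<And>x. 0 \<le> f x" "\<And>x. f x \<le> 1"
    "\<And>x. x \<in> K \<Longrightarrow> f x = 1" "\<And>x. x \<in> L \<Longrightarrow> f x = 0"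
    using compact_t2_Urysohn[OF comp K L(1)] L(2) by blast
  have fm: "f \<in> borel_measurable borel" by (rule borel_measurable_continuous_onI[OF f(1)])
  have fmP: "f \<in> borel_measurable P" unfolding measurable_cong_sets[OF sP refl] by (rule fm)
  have fmQ: "f \<in> borel_measurable Q" unfolding measurable_cong_sets[OF sQ refl] by (rule fm)
  have fP: "integrable P f" and fQ: "integrable Q f"
    using f(2,3) fmP fmQ
    by (auto intro!: P.integrable_const_bound[of _ 1] Q.integrable_const_bound[of _ 1])
  have spP: "space P = UNIV" and spQ: "space Q = UNIV"
    using sets_eq_imp_space_eq[OF sP] sets_eq_imp_space_eq[OF sQ] by simp_all
  have iP: "integrable P (indicator (- L) :: 'a \<Rightarrow> real)" and iQ: "integrable Q (indicator K :: 'a \<Rightarrow> real)"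
    using Kb Lb sP sQ by (auto simp: P.emeasure_eq_measure Q.emeasure_eq_measure)
  have "measure Q K = (\<integral>x. indicator K x \<partial>Q)" using Kb sQ by (simp add: spQ)
  also have "\<dots> \<le> (\<integral>x. f x \<partial>Q)"
    using f by (intro integral_mono iQ fQ) (auto simp: indicator_def)
  also have "\<dots> = (\<integral>x. f x \<partial>P)" using eq[OF f(1)] by simp
  also have "\<dots> \<le> (\<integral>x. indicator (- L) x \<partial>P)"
    using f by (intro integral_mono iP fP) (auto simp: indicator_def)
  also have "\<dots> = measure P (- L)" using Lb sP by (simp add: spP)
  also have "\<dots> = 1 - measure P L" using P.prob_compl[of L] Lb sP by (simp add: spP Compl_eq_Diff_UNIV)
  also have "\<dots> \<le> measure P K + e"
    using L(3) P.prob_compl[of K] Kb sP by (simp add: spP Compl_eq_Diff_UNIV)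
  finally show "measure Q K \<le> measure P K + e" .
qed

lemma radon_prob_eqI:
  fixes P Q :: "'a::t2_space measure"
  assumes comp: "compact (UNIV :: 'a set)" and P: "radon_prob P" and Q: "radon_prob Q"
    and eq: "\<And>f :: 'a \<Rightarrow> real. continuous_on UNIV f \<Longrightarrow> (\<integral>x. f x \<partial>P) = (\<integral>x. f x \<partial>Q)"
  shows "P = Q"
proof (rule measure_eqI)
  interpret P: prob_space P by (rule radon_probD(1)[OF P])
  interpret Q: prob_space Q by (rule radon_probD(1)[OF Q])
  note sP = radon_probD(2)[OF P] and sQ = radon_probD(2)[OF Q]
  show "sets P = sets Q" by (simp add: sP sQ)
  fix B assume "B \<in> sets P"
  then have B: "B \<in> sets borel" by (simp add: sP)
  have "emeasure P K = emeasure Q K" if "compact K" for K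
    using radon_prob_compact_le[OF comp P Q eq that] radon_prob_compact_le[OF comp Q P eq[symmetric] that]
    by (simp add: P.emeasure_eq_measure Q.emeasure_eq_measure)
  then have "emeasure P ` {K. K \<subseteq> B \<and> compact K} = emeasure Q ` {K. K \<subseteq> B \<and> compact K}"
    by (intro image_cong) auto
  then show "emeasure P B = emeasure Q B"
    unfolding radon_probD(3)[OF P B] radon_probD(3)[OF Q B] by simp
qed

section \<open>The past of the coordinates and the past of the noise\<close>

lemma continuous_coord: "continuous_on UNIV (coord k)"
  unfolding coord_def by (rule continuous_on_product_coordinates)

lemma continuous_noise: "continuous_on UNIV (noise k :: (nat \<Rightarrow> 'g::topological_group_add) \<Rightarrow> 'g)"
  unfolding noise_def by (intro continuous_on_add continuous_on_minus continuous_coord)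

lemma space_past [simp]: "space (past X k) = UNIV"
  by (simp add: past_def)

lemma sets_past: "sets (past X k) = sigma_sets UNIV {X j -` B | j B. j \<ge> k \<and> B \<in> sets borel}"
  by (simp add: past_def)

lemma vimage_in_past: "k \<le> j \<Longrightarrow> B \<in> sets borel \<Longrightarrow> X j -` B \<in> sets (past X k)"
  unfolding sets_past by (intro sigma_sets.Basic) blast

lemma past_measurable: "k \<le> j \<Longrightarrow> X j \<in> borel_measurable (past X k)"
  by (intro measurableI) (simp_all add: vimage_in_past)

lemma past_antimono: "k \<le> l \<Longrightarrow> sets (past X l) \<subseteq> sets (past X k)"
  unfolding sets_past by (intro sigma_sets_mono') (use le_trans in blast)

lemma past_sub_borel:
  assumes "\<And>j. continuous_on UNIV (X j)"
  shows "sets (past X k) \<subseteq> sets borel"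
proof -
  have "X j -` B \<in> sets borel" if "B \<in> sets borel" for j B
    using measurable_sets[OF borel_measurable_continuous_onI[OF assms] that] by simp
  then have "{X j -` B | j B. j \<ge> k \<and> B \<in> sets borel} \<subseteq> sets borel" by blast
  from sets.sigma_sets_subset[OF this] show ?thesis by (simp add: sets_past)
qed

lemma UNIV_in_past [simp]: "UNIV \<in> sets (past X k)"
  using sets.top[of "past X k"] by simp

definition ae_sets :: "'a measure \<Rightarrow> 'a measure \<Rightarrow> 'a set set" where
  "ae_sets P F = {A \<in> sets P. \<exists>A'\<in>sets F. AE \<omega> in P. \<omega> \<in> A \<longleftrightarrow> \<omega> \<in> A'}"

lemma ae_sets_sigma_algebra:
  assumes "space F = space P" "sets F \<subseteq> sets P"
  shows "sigma_algebra (space P) (ae_sets P F)"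
  unfolding sigma_algebra_iff2
proof (intro conjI ballI allI impI)
  show "ae_sets P F \<subseteq> Pow (space P)" using sets.sets_into_space by (auto simp: ae_sets_def)
  show "{} \<in> ae_sets P F" by (auto simp: ae_sets_def intro!: bexI[of _ "{}"])
next
  fix A assume "A \<in> ae_sets P F"
  then obtain A' where A: "A \<in> sets P" "A' \<in> sets F" "AE \<omega> in P. \<omega> \<in> A \<longleftrightarrow> \<omega> \<in> A'" by (auto simp: ae_sets_def)
  have "space P - A' \<in> sets F" using sets.compl_sets[OF A(2)] assms by simp
  moreover have "AE \<omega> in P. \<omega> \<in> space P - A \<longleftrightarrow> \<omega> \<in> space P - A'" using A(3) by eventually_elim auto
  ultimately show "space P - A \<in> ae_sets P F" unfolding ae_sets_def using sets.compl_sets[OF A(1)] by blast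
next
  fix A :: "nat \<Rightarrow> 'a set" assume A: "range A \<subseteq> ae_sets P F"
  then have "\<forall>n. \<exists>A'. A' \<in> sets F \<and> (AE \<omega> in P. \<omega> \<in> A n \<longleftrightarrow> \<omega> \<in> A')" unfolding ae_sets_def by blast
  then obtain A' where A': "\<And>n. A' n \<in> sets F" "\<And>n. AE \<omega> in P. \<omega> \<in> A n \<longleftrightarrow> \<omega> \<in> A' n" by metis
  have "AE \<omega> in P. \<forall>n. \<omega> \<in> A n \<longleftrightarrow> \<omega> \<in> A' n" using A'(2) by (simp add: AE_all_countable)
  then have "AE \<omega> in P. \<omega> \<in> (\<Union>n. A n) \<longleftrightarrow> \<omega> \<in> (\<Union>n. A' n)" by eventually_elim auto
  moreover have "(\<Union>n. A n) \<in> sets P" using A by (auto simp: ae_sets_def)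
  moreover have "(\<Union>n. A' n) \<in> sets F" using A'(1) by blast
  ultimately show "(\<Union>n. A n) \<in> ae_sets P F" unfolding ae_sets_def by blast
qed

lemma ae_sets_mono: "sets F \<subseteq> sets F' \<Longrightarrow> ae_sets P F \<subseteq> ae_sets P F'"
  by (auto simp: ae_sets_def)

lemma sets_sub_ae_sets: "sets F \<subseteq> sets P \<Longrightarrow> sets F \<subseteq> ae_sets P F"
  by (auto simp: ae_sets_def)

lemma ae_sets_cong:
  assumes "A \<in> ae_sets P F" "B \<in> sets P" "AE \<omega> in P. \<omega> \<in> A \<longleftrightarrow> \<omega> \<in> B"
  shows "B \<in> ae_sets P F"
proof -
  obtain A' where A': "A' \<in> sets F" "AE \<omega> in P. \<omega> \<in> A \<longleftrightarrow> \<omega> \<in> A'" using assms(1) by (auto simp: ae_sets_def)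
  have "AE \<omega> in P. \<omega> \<in> B \<longleftrightarrow> \<omega> \<in> A'" using A'(2) assms(3) by eventually_elim simp
  then show ?thesis using A'(1) assms(2) by (auto simp: ae_sets_def)
qed

text \<open>
  A compact subset of \<open>V\<close> is covered by finitely many of the open \<open>F\<close>-measurable subsets of \<open>V\<close>. By
  inner regularity, countably many such finite unions exhaust \<open>V\<close> up to a null set.
\<close>

lemma radon_open_ae_sets:
  fixes P :: "'a::t2_space measure"
  assumes P: "radon_prob P" and F: "space F = UNIV" "sets F \<subseteq> sets borel" and V: "open V"
    and cover: "\<And>x. x \<in> V \<Longrightarrow> \<exists>S. open S \<and> S \<subseteq> V \<and> S \<in> sets F \<and> x \<in> S"
  shows "V \<in> ae_sets P F"
proof -
  interpret prob_space P by (rule radon_probD(1)[OF P])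
  note sb = radon_probD(2)[OF P]
  have "\<exists>E\<in>sets F. E \<subseteq> V \<and> measure P V < measure P E + inverse (real (Suc n))" for n
  proof -
    obtain K where K: "compact K" "K \<subseteq> V" "measure P V < measure P K + inverse (real (Suc n))"
      using radon_prob_inner[OF P borel_open[OF V], of "inverse (real (Suc n))"] by auto
    obtain \<S> where S: "\<S> \<subseteq> {S. open S \<and> S \<subseteq> V \<and> S \<in> sets F}" "finite \<S>" "K \<subseteq> \<Union>\<S>"
      using compactE[OF K(1), of "{S. open S \<and> S \<subseteq> V \<and> S \<in> sets F}"] cover K(2) by (smt (verit) Union_iff mem_Collect_eq subset_eq)
    have E: "\<Union>\<S> \<in> sets F" using S by (intro sets.finite_Union) auto
    have "measure P K \<le> measure P (\<Union>\<S>)"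
      using E F sb S(3) by (intro finite_measure_mono) auto
    then show ?thesis using E S(1) K(3) by (intro bexI[of _ "\<Union>\<S>"]) auto
  qed
  then obtain E where E: "\<And>n. E n \<in> sets F" "\<And>n. E n \<subseteq> V"
    "\<And>n. measure P V < measure P (E n) + inverse (real (Suc n))" by metis
  have m: "V \<in> events" "\<And>n. E n \<in> events" "(\<Union>n. E n) \<in> events"
    using V E(1) F sb by auto
  have "measure P (V - (\<Union>n. E n)) \<le> 0"
  proof (rule LIMSEQ_le_const[OF LIMSEQ_inverse_real_of_nat], intro exI allI impI)
    fix n
    have "measure P (V - (\<Union>n. E n)) \<le> measure P (V - E n)" using m by (intro finite_measure_mono) auto
    also have "\<dots> = measure P V - measure P (E n)" using m E(2) by (intro finite_measure_Diff) auto
    finally show "measure P (V - (\<Union>n. E n)) \<le> inverse (real (Suc n))" using E(3)[of n] by simp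
  qed
  then have "measure P (V - (\<Union>n. E n)) = 0" using measure_nonneg by (rule antisym)
  then have "AE \<omega> in P. \<omega> \<notin> V - (\<Union>n. E n)"
    using m by (intro AE_not_in) (simp add: null_sets_def emeasure_eq_measure)
  then have "AE \<omega> in P. \<omega> \<in> V \<longleftrightarrow> \<omega> \<in> (\<Union>n. E n)" by eventually_elim (use E(2) in auto)
  moreover have "(\<Union>n. E n) \<in> sets F" using E(1) by blast
  ultimately show ?thesis unfolding ae_sets_def using m(1) by blast
qed

locale solution =
  fixes \<mu> :: "nat \<Rightarrow> 'g::{topological_group_add,t2_space} measure" and P :: "(nat \<Rightarrow> 'g) measure"
  assumes solution: "P \<in> solutions \<mu>"
begin

lemma radon: "radon_prob P" and law: "distr P borel (noise k) = \<mu> k"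
  and indep: "prob_space.indep_set P (sets (vimage_algebra UNIV (noise k) borel)) (sets (past coord (Suc k)))"
  using solution unfolding solutions_def by blast+

sublocale prob_space P by (rule radon_probD(1)[OF radon])

lemma sets_P [simp, measurable_cong]: "sets P = sets borel" by (rule radon_probD(2)[OF radon])

lemma space_P [simp]: "space P = UNIV" using sets_eq_imp_space_eq[OF sets_P] by simp

lemma coord_measurable: "coord k \<in> borel_measurable P"
  unfolding measurable_cong_sets[OF sets_P refl] by (rule borel_measurable_continuous_onI[OF continuous_coord])

lemma noise_measurable: "noise k \<in> borel_measurable P"
  unfolding measurable_cong_sets[OF sets_P refl] by (rule borel_measurable_continuous_onI[OF continuous_noise])

lemma past_coord_sub: "sets (past coord k :: (nat \<Rightarrow> 'g) measure) \<subseteq> sets P"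
  and past_noise_sub: "sets (past noise k :: (nat \<Rightarrow> 'g) measure) \<subseteq> sets P"
  unfolding sets_P by (intro past_sub_borel continuous_coord continuous_noise)+

text \<open>
  In general \<open>past noise k\<close> is contained in this \<open>\<sigma>\<close>-field (\<open>past_noise_ae_past\<close>) but not in
  \<open>past coord k\<close>. The noise at the following time is still independent of it (\<open>indep_ae_past\<close>).
\<close>

definition ae_past :: "nat \<Rightarrow> (nat \<Rightarrow> 'g) measure" where
  "ae_past k = sigma UNIV (ae_sets P (past coord k))"

lemma sets_ae_past: "sets (ae_past k) = ae_sets P (past coord k)"
proof -
  have "sigma_algebra UNIV (ae_sets P (past coord k))"
    using ae_sets_sigma_algebra[of "past coord k" P] past_coord_sub by simp
  from sigma_algebra.sigma_sets_eq[OF this] show ?thesis by (simp add: ae_past_def)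
qed

lemma space_ae_past [simp]: "space (ae_past k) = UNIV"
  by (simp add: ae_past_def)

lemma ae_past_sub: "sets (ae_past k) \<subseteq> sets P"
  by (auto simp: sets_ae_past ae_sets_def)

lemma coord_ae_past: "coord k \<in> borel_measurable (ae_past k)"
proof (rule measurableI)
  fix B :: "'g set" assume "B \<in> sets borel"
  then show "coord k -` B \<inter> space (ae_past k) \<in> sets (ae_past k)"
    using sets_sub_ae_sets[OF past_coord_sub[of k]] vimage_in_past[OF order_refl, of B coord k]
    by (auto simp: sets_ae_past)
qed simp

text \<open>
  The preimage of an open set under the noise is open, and it is a union of open rectangles
  \<open>{\<omega>. \<omega> (Suc k) \<in> A \<and> \<omega> k \<in> C}\<close>, each of which belongs to the past of the coordinates.
\<close>

lemma noise_ae_past: "noise k \<in> borel_measurable (ae_past k)"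
proof (rule borel_measurableI)
  fix B :: "'g set" assume B: "open B"
  define V where "V = (noise k -` B :: (nat \<Rightarrow> 'g) set)"
  have c: "continuous_on UNIV (\<lambda>p :: 'g \<times> 'g. - fst p + snd p)"
    by (intro continuous_on_add continuous_on_minus continuous_on_fst continuous_on_snd continuous_on_id)
  have "V \<in> ae_sets P (past coord k)"
  proof (rule radon_open_ae_sets[OF radon])
    show "open V" unfolding V_def by (intro open_vimage B continuous_noise)
    show "sets (past coord k :: (nat \<Rightarrow> 'g) measure) \<subseteq> sets borel" using past_coord_sub by simp
    fix \<omega> assume "\<omega> \<in> V"
    then have mem: "(coord (Suc k) \<omega>, coord k \<omega>) \<in> (\<lambda>p. - fst p + snd p) -` B" by (simp add: V_def noise_def)
    have op: "open ((\<lambda>p :: 'g \<times> 'g. - fst p + snd p) -` B)" by (intro open_vimage B c)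
    obtain A C where AC: "open A" "open C" "(coord (Suc k) \<omega>, coord k \<omega>) \<in> A \<times> C"
      "A \<times> C \<subseteq> (\<lambda>p. - fst p + snd p) -` B" by (rule open_prod_elim[OF op mem])
    let ?S = "(coord (Suc k) -` A \<inter> coord k -` C) :: (nat \<Rightarrow> 'g) set"
    show "\<exists>S. open S \<and> S \<subseteq> V \<and> S \<in> sets (past coord k) \<and> \<omega> \<in> S"
    proof (intro exI[of _ ?S] conjI)
      show "open ?S" by (intro open_Int open_vimage AC continuous_coord)
      show "?S \<subseteq> V" using AC(4) by (force simp: V_def noise_def)
      show "?S \<in> sets (past coord k)" using AC by (intro sets.Int vimage_in_past) auto
    qed (use AC(3) in auto)
  qed simp
  then show "noise k -` B \<inter> space (ae_past k) \<in> sets (ae_past k)" by (simp add: V_def sets_ae_past)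
qed

lemma ae_past_antimono: "k \<le> l \<Longrightarrow> sets (ae_past l) \<subseteq> sets (ae_past k)"
  unfolding sets_ae_past by (intro ae_sets_mono past_antimono)

lemma past_noise_ae_past: "sets (past noise k) \<subseteq> sets (ae_past k)"
proof -
  have "noise j -` B \<in> sets (ae_past k)" if "k \<le> j" "B \<in> sets borel" for j B
    using measurable_sets[OF noise_ae_past that(2), of j] ae_past_antimono[OF that(1)] by auto
  then have "{noise j -` B | j B. j \<ge> k \<and> B \<in> sets borel} \<subseteq> sets (ae_past k)" by blast
  from sets.sigma_sets_subset[OF this] show ?thesis by (simp add: sets_past)
qed

lemma indep_ae_past:
  assumes A: "A \<in> sets (ae_past (Suc k))" and B: "B \<in> sets borel"
  shows "measure P (noise k -` B \<inter> A) = measure P (noise k -` B) * measure P A"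
proof -
  obtain A' where A': "A' \<in> sets (past coord (Suc k))" "AE \<omega> in P. \<omega> \<in> A \<longleftrightarrow> \<omega> \<in> A'"
    using A by (auto simp: sets_ae_past ae_sets_def)
  have m: "A \<in> events" "A' \<in> events" using A A' past_coord_sub ae_past_sub by auto
  have N: "noise k -` B \<in> events" using measurable_sets[OF noise_measurable B] by simp
  have "measure P A = measure P A'" using A'(2) m by (intro finite_measure_eq_AE)
  moreover have "measure P (noise k -` B \<inter> A) = measure P (noise k -` B \<inter> A')"
  proof (rule finite_measure_eq_AE)
    show "AE \<omega> in P. \<omega> \<in> noise k -` B \<inter> A \<longleftrightarrow> \<omega> \<in> noise k -` B \<inter> A'"
      using A'(2) by eventually_elim auto
  qed (use m N in auto)
  moreover have "noise k -` B \<in> sets (vimage_algebra UNIV (noise k) borel)"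
    using in_vimage_algebra[OF B, of "noise k" UNIV] by simp
  ultimately show ?thesis using indep_setD[OF indep _ A'(1)] by simp
qed

lemma past_noise_subalgebra: "sigma_finite_subalgebra P (past noise k)"
proof -
  have "finite_measure_subalgebra P (past noise k)"
    by unfold_locales (use past_noise_sub in \<open>auto simp: subalgebra_def\<close>)
  then show ?thesis by (rule finite_measure_subalgebra_is_sigma_finite)
qed

section \<open>Extremality and the remote past\<close>

text \<open>
  Conditioning on \<open>A\<close> changes neither the law of the noise at time \<open>-k\<close> nor its independence of the
  earlier coordinates, because \<open>A\<close> belongs, up to a null set, to the past of the preceding time. This
  holds for all \<open>k\<close> at once when \<open>A\<close> belongs to the remote past.
\<close>

lemma conditioned_solution:
  assumes A: "\<And>k. A \<in> sets (ae_past k)" and pos: "0 < measure P A"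
  shows "uniform_measure P A \<in> solutions \<mu>"
proof -
  let ?Q = "uniform_measure P A"
  have Am: "A \<in> events" using A ae_past_sub by blast
  have nz: "emeasure P A \<noteq> 0" "emeasure P A \<noteq> \<infinity>" using pos by (simp_all add: emeasure_eq_measure)
  interpret Q: prob_space ?Q by (rule prob_space_uniform_measure[OF nz])
  have mQ: "measure ?Q B = measure P (A \<inter> B) / measure P A" if "B \<in> sets borel" for B
    using that by (intro measure_uniform_measure nz) simp
  have noise: "measure ?Q (noise k -` B) = measure P (noise k -` B)" if "B \<in> sets borel" for k B
  proof -
    have "noise k -` B \<in> sets borel" using measurable_sets[OF noise_measurable that] by simp
    then show ?thesis using mQ indep_ae_past[OF A that] pos by (simp add: Int_commute)
  qed
  have "radon_prob ?Q"
  proof (rule radon_probI)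
    fix B :: "(nat \<Rightarrow> 'g) set" and e :: real assume B: "B \<in> sets borel" and "0 < e"
    then have "A \<inter> B \<in> sets borel" "0 < e * measure P A" using Am pos by auto
    from radon_prob_inner[OF radon this] obtain K where
      K: "compact K" "K \<subseteq> A \<inter> B" "measure P (A \<inter> B) < measure P K + e * measure P A" by blast
    have "A \<inter> K = K" using K by blast
    have "measure P (A \<inter> B) / measure P A \<le> (measure P K + e * measure P A) / measure P A"
      using K(3) pos by (intro divide_right_mono) auto
    then have "measure ?Q B \<le> measure ?Q K + e"
      using pos mQ[OF B] mQ[OF borel_compact[OF K(1)]] \<open>A \<inter> K = K\<close> by (simp add: add_divide_distrib)
    then show "\<exists>K. compact K \<and> K \<subseteq> B \<and> measure ?Q B \<le> measure ?Q K + e" using K by blast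
  qed (simp_all add: Q.prob_space_axioms)
  moreover have "Q.indep_set (sets (vimage_algebra UNIV (noise k) borel))
      (sets (past (coord :: nat \<Rightarrow> (nat \<Rightarrow> 'g) \<Rightarrow> 'g) (Suc k)))" for k
  proof (rule Q.indep_setI)
    show "sets (vimage_algebra UNIV (noise k) borel) \<subseteq> Q.events"
      "sets (past (coord :: nat \<Rightarrow> (nat \<Rightarrow> 'g) \<Rightarrow> 'g) (Suc k)) \<subseteq> Q.events"
      using indep_setD_ev1[OF indep] indep_setD_ev2[OF indep] by simp_all
    fix a b :: "(nat \<Rightarrow> 'g) set"
    assume a: "a \<in> sets (vimage_algebra UNIV (noise k) borel)" and b: "b \<in> sets (past coord (Suc k))"
    obtain B where B: "B \<in> sets borel" "a = noise k -` B"
      using a by (auto simp: sets_vimage_algebra2)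
    have b': "b \<in> sets (ae_past (Suc k))" using b sets_sub_ae_sets[OF past_coord_sub] by (auto simp: sets_ae_past)
    have m: "a \<in> sets borel" "b \<in> sets borel"
      using a b indep_setD_ev1[OF indep] indep_setD_ev2[OF indep] by auto
    have "measure ?Q (a \<inter> b) = measure P (noise k -` B \<inter> (A \<inter> b)) / measure P A"
      using mQ[of "a \<inter> b"] m B(2) by (simp add: Int_left_commute)
    also have "\<dots> = measure P (noise k -` B) * measure P (A \<inter> b) / measure P A"
      using indep_ae_past[OF sets.Int[OF A b'] B(1)] by simp
    finally show "measure ?Q (a \<inter> b) = measure ?Q a * measure ?Q b"
      using noise[OF B(1)] mQ[OF m(2)] B(2) by simp
  qed
  moreover have "distr ?Q borel (noise k) = \<mu> k" for k
    unfolding law[of k, symmetric]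
  proof (rule measure_eqI)
    fix B :: "'g set" assume "B \<in> sets (distr ?Q borel (noise k))"
    then have B: "B \<in> sets borel" by simp
    have "noise k \<in> borel_measurable ?Q" using noise_measurable by simp
    then show "emeasure (distr ?Q borel (noise k)) B = emeasure (distr P borel (noise k)) B"
      using noise[OF B] B noise_measurable
      by (simp add: emeasure_distr Q.emeasure_eq_measure emeasure_eq_measure)
  qed simp
  ultimately show ?thesis unfolding solutions_def by blast
qed

end

text \<open>
  Otherwise \<open>P\<close> would be a proper convex combination of the solutions obtained by conditioning on \<open>A\<close>
  and on its complement; these are different, as they give \<open>A\<close> the values \<open>1\<close> and \<open>0\<close>.
\<close>

lemma extremal_zero_one:
  assumes ext: "P \<in> extremal_solutions \<mu>" and "solution \<mu> P"
    and A: "\<And>k. A \<in> sets (solution.ae_past P k)"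
  shows "measure P A = 0 \<or> measure P A = 1"
proof (rule ccontr)
  interpret solution \<mu> P by fact
  assume c: "\<not> ?thesis"
  have Am: "A \<in> events" using A ae_past_sub by blast
  have A': "UNIV - A \<in> sets (ae_past k)" for k using sets.compl_sets[OF A[of k]] by simp
  have t: "0 < measure P A" "measure P A < 1"
    using c measure_nonneg[of P A] prob_le_1[of A] by linarith+
  have comp: "measure P (UNIV - A) = 1 - measure P A" using prob_compl[OF Am] by simp
  let ?Q = "uniform_measure P A" and ?R = "uniform_measure P (UNIV - A)"
  have Q: "?Q \<in> solutions \<mu>" and R: "?R \<in> solutions \<mu>"
    using t comp by (auto intro!: conditioned_solution A A')
  have nz: "emeasure P A \<noteq> 0" "emeasure P A \<noteq> \<infinity>" "emeasure P (UNIV - A) \<noteq> 0" "emeasure P (UNIV - A) \<noteq> \<infinity>"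
    using t comp by (simp_all add: emeasure_eq_measure)
  have "measure P B = measure P A * measure ?Q B + (1 - measure P A) * measure ?R B" if B: "B \<in> sets borel" for B
  proof -
    have "measure P B = measure P (A \<inter> B) + measure P ((UNIV - A) \<inter> B)"
      using Am B by (subst finite_measure_Union[symmetric]) (auto intro: arg_cong[of _ _ "measure P"])
    then show ?thesis using t comp nz B by simp
  qed
  then have "?Q = ?R" using ext Q R t unfolding extremal_solutions_def by blast
  then have "measure ?Q A = measure ?R A" by simp
  moreover have "measure ?Q A = 1" "measure ?R A = 0" using nz Am t by (simp_all add: Diff_Int_distrib2)
  ultimately show False by simp
qed

section \<open>Translations and the inclusion for every compact group\<close>

lemma continuous_translation:
  "continuous_on UNIV (\<lambda>\<omega> k. g + \<omega> k :: 'g::topological_group_add)"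
  by (intro continuous_on_coordinatewise_then_product continuous_on_add continuous_on_const continuous_on_product_coordinates)

lemma radon_translate:
  assumes P: "radon_prob P"
  shows "radon_prob (translate g P :: (nat \<Rightarrow> 'g::{topological_group_add,t2_space}) measure)"
proof (rule radon_probI)
  let ?T = "\<lambda>(\<omega> :: nat \<Rightarrow> 'g) k. g + \<omega> k"
  interpret prob_space P by (rule radon_probD(1)[OF P])
  note sP = radon_probD(2)[OF P]
  have sp: "space P = UNIV" using sets_eq_imp_space_eq[OF sP] by simp
  have T: "?T \<in> measurable P borel"
    unfolding measurable_cong_sets[OF sP refl] by (rule borel_measurable_continuous_onI[OF continuous_translation])
  show "prob_space (translate g P)" unfolding translate_def by (rule prob_space_distr[OF T])
  show "sets (translate g P) = sets borel" by (simp add: translate_def)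
  fix B :: "(nat \<Rightarrow> 'g) set" and e :: real assume B: "B \<in> sets borel" and "0 < e"
  have eq: "measure (translate g P) A = measure P (?T -` A)" if "A \<in> sets borel" for A
    unfolding translate_def using measure_distr[OF T that] by (simp add: sp)
  have "?T -` B \<in> sets borel" using measurable_sets[OF T B] by (simp add: sp sP)
  from radon_prob_inner[OF P this \<open>0 < e\<close>] obtain K where
    K: "compact K" "K \<subseteq> ?T -` B" "measure P (?T -` B) < measure P K + e" by blast
  have c: "compact (?T ` K)"
    by (intro compact_continuous_image K(1) continuous_on_subset[OF continuous_translation]) simp
  have m: "?T ` K \<in> sets borel" by (rule borel_compact[OF c])
  have "measure P K \<le> measure P (?T -` ?T ` K)"
    using measurable_sets[OF T m] by (intro finite_measure_mono) (auto simp: sp)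
  then have "measure (translate g P) B \<le> measure (translate g P) (?T ` K) + e"
    unfolding eq[OF B] eq[OF m] using K(3) by simp
  then show "\<exists>K. compact K \<and> K \<subseteq> B \<and> measure (translate g P) B \<le> measure (translate g P) K + e"
    using c K(2) by (intro exI[of _ "?T ` K"]) auto
qed

lemma noise_translate: "noise k (\<lambda>k. g + \<omega> k) = noise k \<omega>"
  unfolding noise_def coord_def minus_add by (simp only: add.assoc minus_add_cancel)

lemma past_noise_translate:
  assumes "A \<in> sets (past noise k)"
  shows "(\<lambda>k. g + \<omega> k) \<in> A \<longleftrightarrow> \<omega> \<in> A"
  using assms unfolding sets_past
  by (induction rule: sigma_sets.induct) (auto simp: noise_translate)

text \<open>
  A translated path has the same noise, so the two paths cannot be separated by a set of the past of
  the noise, in particular not by a level set of \<open>V\<close>.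
\<close>

lemma past_noise_measurable_translate:
  fixes V :: "_ \<Rightarrow> 'b::t1_space"
  assumes V: "V \<in> borel_measurable (past noise k)"
  shows "V (\<lambda>k. g + \<omega> k) = V \<omega>"
proof -
  have "V -` {V \<omega>} \<in> sets (past noise k)"
    using measurable_sets[OF V borel_closed[OF closed_singleton]] by simp
  from past_noise_translate[OF this, of g \<omega>] show ?thesis by simp
qed

text \<open>
  Let \<open>Y\<close> be the version of \<open>\<rho>(\<eta> 0)\<close> that is measurable with respect to the noise; \<open>Y\<close> is invariant under
  translation. The law of \<open>\<eta>\<close> is invariant as well, so \<open>\<rho>(g + \<eta> 0) = Y = \<rho>(\<eta> 0)\<close> almost surely, and one
  path with this property suffices.
\<close>

lemma (in solution) H_mu_subset_Hs_mu: "H_mu P \<subseteq> Hs_mu P"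
proof
  fix g assume "g \<in> H_mu P"
  then have g: "translate g P = P" by (simp add: H_mu_def)
  have "\<rho> g = 1\<^sub>m n" if strong: "(\<rho>, n) \<in> strong_reps P" for \<rho> n
  proof -
    have irr: "unitary_rep \<rho> n" using strong by (auto simp: strong_reps_def irreducible_unitary_reps_def)
    have car: "\<rho> x \<in> carrier_mat n n" and adj: "mat_adjoint (\<rho> x) * \<rho> x = 1\<^sub>m n"
      and hom: "\<rho> (x + y) = \<rho> x * \<rho> y" for x y
      using irr by (auto simp: unitary_rep_def)
    obtain Y where Y: "\<And>\<omega>. Y \<omega> \<in> carrier_mat n n"
      "\<And>i j. i < n \<Longrightarrow> j < n \<Longrightarrow> (\<lambda>\<omega>. Y \<omega> $$ (i, j)) \<in> borel_measurable (past noise 0)"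
      "AE \<omega> in P. \<rho> (coord 0 \<omega>) = Y \<omega>"
      using strong unfolding strong_reps_def by blast
    have inv: "Y (\<lambda>k. g + \<omega> k) = Y \<omega>" for \<omega>
    proof (rule eq_matI)
      fix i j assume "i < dim_row (Y \<omega>)" "j < dim_col (Y \<omega>)"
      then have "i < n" "j < n" using Y(1)[of \<omega>] by auto
      from past_noise_measurable_translate[OF Y(2)[OF this]]
      show "Y (\<lambda>k. g + \<omega> k) $$ (i, j) = Y \<omega> $$ (i, j)" .
    qed (use Y(1) in \<open>metis carrier_matD\<close>)+
    have T: "(\<lambda>\<omega> k. g + \<omega> k) \<in> measurable P borel"
      unfolding measurable_cong_sets[OF sets_P refl]
      by (rule borel_measurable_continuous_onI[OF continuous_translation])
    have "AE \<omega> in translate g P. \<rho> (coord 0 \<omega>) = Y \<omega>" unfolding g by (rule Y(3))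
    then have "AE \<omega> in P. \<rho> (coord 0 (\<lambda>k. g + \<omega> k)) = Y (\<lambda>k. g + \<omega> k)"
      unfolding translate_def by (rule AE_distrD[OF T])
    with Y(3) have "AE \<omega> in P. \<rho> (g + \<omega> 0) = \<rho> (\<omega> 0)"
      by eventually_elim (simp add: coord_def inv)
    moreover have "ae_filter P \<noteq> bot" by (simp add: ae_filter_eq_bot_iff emeasure_space_1[simplified])
    ultimately obtain x where x: "\<rho> (g + x) = \<rho> x"
      using eventually_happens' by blast
    have zero: "\<rho> 0 = 1\<^sub>m n"
    proof -
      have ac: "mat_adjoint (\<rho> 0) \<in> carrier_mat n n" using mat_of_rows_carrier(1)[of n "map conjugate (cols (\<rho> 0))"] carrier_matD[OF car[of 0]]
        by (simp add: mat_adjoint_def)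
      have "\<rho> 0 = (mat_adjoint (\<rho> 0) * \<rho> 0) * \<rho> 0" using car[of 0] by (simp add: adj)
      also have "\<dots> = mat_adjoint (\<rho> 0) * (\<rho> 0 * \<rho> 0)" by (rule assoc_mult_mat[OF ac car car])
      also have "\<dots> = 1\<^sub>m n" unfolding hom[symmetric] by (simp add: adj)
      finally show ?thesis .
    qed
    have "\<rho> g = \<rho> ((g + x) + - x)" by (simp add: add.assoc)
    also have "\<dots> = \<rho> (g + x) * \<rho> (- x)" by (rule hom)
    also have "\<dots> = \<rho> (x + - x)" unfolding x by (rule hom[symmetric])
    finally show ?thesis by (simp add: zero)
  qed
  then show "g \<in> Hs_mu P" by (auto simp: Hs_mu_def)
qed

section \<open>Conditional expectations given the noise\<close>

text \<open>
  \<open>m\<close> is a version of the conditional expectation of the complex variable \<open>X\<close> given \<open>F\<close>, tested against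
  bounded functions.
\<close>

definition cond_version :: "'a measure \<Rightarrow> 'a measure \<Rightarrow> ('a \<Rightarrow> complex) \<Rightarrow> ('a \<Rightarrow> complex) \<Rightarrow> bool" where
  "cond_version P F X m \<longleftrightarrow> m \<in> borel_measurable F \<and> integrable P m \<and>
     (\<forall>V\<in>borel_measurable F. bounded (range V) \<longrightarrow> (\<integral>\<omega>. X \<omega> * V \<omega> \<partial>P) = (\<integral>\<omega>. m \<omega> * V \<omega> \<partial>P))"

lemma integrable_mult_bounded:
  fixes f g :: "'a \<Rightarrow> 'b::{real_normed_field, second_countable_topology, banach}"
  assumes f: "integrable P f" and g: "g \<in> borel_measurable P" and "bounded (range g)"
  shows "integrable P (\<lambda>\<omega>. f \<omega> * g \<omega>)"
proof -
  obtain B where B: "\<And>\<omega>. norm (g \<omega>) \<le> B" using assms(3) by (auto simp: bounded_iff)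
  show ?thesis
  proof (rule Bochner_Integration.integrable_bound)
    show "integrable P (\<lambda>\<omega>. B * norm (f \<omega>))" using f by simp
    show "(\<lambda>\<omega>. f \<omega> * g \<omega>) \<in> borel_measurable P" using f g by simp
    have "norm (f \<omega> * g \<omega>) \<le> norm (B * norm (f \<omega>))" for \<omega>
    proof -
      have "norm (f \<omega> * g \<omega>) \<le> norm (f \<omega>) * B" unfolding norm_mult by (intro mult_left_mono B) simp
      also have "\<dots> \<le> norm (B * norm (f \<omega>))" by (simp add: mult.commute)
      finally show ?thesis .
    qed
    then show "AE \<omega> in P. norm (f \<omega> * g \<omega>) \<le> norm (B * norm (f \<omega>))" by simp
  qed
qed

text \<open>
  Conditional expectations of the real and the imaginary part, recombined.
\<close>

lemma cond_version_exists:
  assumes "sigma_finite_subalgebra P F" and X: "integrable P (X :: 'a \<Rightarrow> complex)"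
  shows "\<exists>m. cond_version P F X m"
proof -
  interpret sigma_finite_subalgebra P F by fact
  define a b where "a = real_cond_exp P F (\<lambda>\<omega>. Re (X \<omega>))" and "b = real_cond_exp P F (\<lambda>\<omega>. Im (X \<omega>))"
  have F: "a \<in> borel_measurable F" "b \<in> borel_measurable F" by (simp_all add: a_def b_def)
  have int: "integrable P a" "integrable P b"
    using X by (auto simp: a_def b_def intro!: real_cond_exp_int)
  define m where "m = (\<lambda>\<omega>. complex_of_real (a \<omega>) + \<i> * complex_of_real (b \<omega>))"
  have mF: "m \<in> borel_measurable F" unfolding m_def using F by simp
  have mint: "integrable P m" unfolding m_def using int by simp
  have "(\<integral>\<omega>. X \<omega> * V \<omega> \<partial>P) = (\<integral>\<omega>. m \<omega> * V \<omega> \<partial>P)"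
    if V: "V \<in> borel_measurable F" "bounded (range V)" for V
  proof -
    have VP: "V \<in> borel_measurable P" using measurable_from_subalg[OF subalg V(1)] .
    note iX = integrable_mult_bounded[OF X VP V(2)] and im = integrable_mult_bounded[OF mint VP V(2)]
    have bd: "bounded (range (\<lambda>\<omega>. Re (V \<omega>)))" "bounded (range (\<lambda>\<omega>. Im (V \<omega>)))"
      using bounded_linear_image[OF V(2) bounded_linear_Re] bounded_linear_image[OF V(2) bounded_linear_Im]
      by (simp_all add: image_image)
    have VF: "(\<lambda>\<omega>. Re (V \<omega>)) \<in> borel_measurable F" "(\<lambda>\<omega>. Im (V \<omega>)) \<in> borel_measurable F"
      using V(1) by simp_all
    have VP': "(\<lambda>\<omega>. Re (V \<omega>)) \<in> borel_measurable P" "(\<lambda>\<omega>. Im (V \<omega>)) \<in> borel_measurable P"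
      using VP by simp_all
    have move: "integrable P (\<lambda>\<omega>. v \<omega> * u \<omega>)" "integrable P (\<lambda>\<omega>. v \<omega> * real_cond_exp P F u \<omega>)"
      "(\<integral>\<omega>. v \<omega> * real_cond_exp P F u \<omega> \<partial>P) = (\<integral>\<omega>. v \<omega> * u \<omega> \<partial>P)"
      if "v \<in> borel_measurable F" "v \<in> borel_measurable P" "bounded (range v)" "integrable P u" for u v
    proof -
      show i: "integrable P (\<lambda>\<omega>. v \<omega> * u \<omega>)"
        using integrable_mult_bounded[OF that(4,2,3)] by (simp add: mult.commute)
      show "integrable P (\<lambda>\<omega>. v \<omega> * real_cond_exp P F u \<omega>)"
        "(\<integral>\<omega>. v \<omega> * real_cond_exp P F u \<omega> \<partial>P) = (\<integral>\<omega>. v \<omega> * u \<omega> \<partial>P)"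
        by (rule real_cond_exp_intg[OF i that(1) borel_measurable_integrable[OF that(4)]])+
    qed
    have uX: "integrable P (\<lambda>\<omega>. Re (X \<omega>))" "integrable P (\<lambda>\<omega>. Im (X \<omega>))" using X by simp_all
    note mv = move[OF VF(1) VP'(1) bd(1) uX(1)] move[OF VF(1) VP'(1) bd(1) uX(2)]
      move[OF VF(2) VP'(2) bd(2) uX(1)] move[OF VF(2) VP'(2) bd(2) uX(2)]
    show ?thesis
    proof (rule complex_eqI)
      have "Re (\<integral>\<omega>. X \<omega> * V \<omega> \<partial>P) = (\<integral>\<omega>. Re (V \<omega>) * Re (X \<omega>) - Im (V \<omega>) * Im (X \<omega>) \<partial>P)"
        unfolding integral_Re[OF iX, symmetric] by (simp add: mult.commute)
      also have "\<dots> = (\<integral>\<omega>. Re (V \<omega>) * a \<omega> - Im (V \<omega>) * b \<omega> \<partial>P)"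
        unfolding a_def b_def using mv by simp
      also have "\<dots> = Re (\<integral>\<omega>. m \<omega> * V \<omega> \<partial>P)"
        unfolding integral_Re[OF im, symmetric] by (simp add: m_def mult.commute)
      finally show "Re (\<integral>\<omega>. X \<omega> * V \<omega> \<partial>P) = Re (\<integral>\<omega>. m \<omega> * V \<omega> \<partial>P)" .
      have "Im (\<integral>\<omega>. X \<omega> * V \<omega> \<partial>P) = (\<integral>\<omega>. Im (V \<omega>) * Re (X \<omega>) + Re (V \<omega>) * Im (X \<omega>) \<partial>P)"
        unfolding integral_Im[OF iX, symmetric] by (simp add: mult.commute add.commute)
      also have "\<dots> = (\<integral>\<omega>. Im (V \<omega>) * a \<omega> + Re (V \<omega>) * b \<omega> \<partial>P)"
        unfolding a_def b_def using mv by simp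
      also have "\<dots> = Im (\<integral>\<omega>. m \<omega> * V \<omega> \<partial>P)"
        unfolding integral_Im[OF im, symmetric] by (simp add: m_def mult.commute add.commute)
      finally show "Im (\<integral>\<omega>. X \<omega> * V \<omega> \<partial>P) = Im (\<integral>\<omega>. m \<omega> * V \<omega> \<partial>P)" .
    qed
  qed
  then show ?thesis using mF mint unfolding cond_version_def by blast
qed

lemma zero_if_integrals_zero:
  fixes D :: "'a \<Rightarrow> complex"
  assumes "sigma_finite_subalgebra P F" and D: "D \<in> borel_measurable F" "integrable P D"
    and zero: "\<And>A. A \<in> sets F \<Longrightarrow> set_lebesgue_integral P A D = 0"
  shows "AE \<omega> in P. D \<omega> = 0"
proof -
  interpret sigma_finite_subalgebra P F by fact
  have int: "set_integrable P A D" if "A \<in> sets F" for A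
    using that subalg D(2) unfolding set_integrable_def subalgebra_def
    by (intro integrable_mult_indicator) auto
  have "AE \<omega> in P. real_cond_exp P F (\<lambda>\<omega>. Re (D \<omega>)) \<omega> = 0"
  proof (rule real_cond_exp_charact)
    fix A assume A: "A \<in> sets F"
    show "set_lebesgue_integral P A (\<lambda>\<omega>. Re (D \<omega>)) = set_lebesgue_integral P A (\<lambda>\<omega>. 0)"
      using zero[OF A] integral_Re[OF int[OF A, unfolded set_integrable_def]]
      by (simp add: set_lebesgue_integral_def)
  qed (use D in simp_all)
  moreover have "AE \<omega> in P. real_cond_exp P F (\<lambda>\<omega>. Re (D \<omega>)) \<omega> = Re (D \<omega>)"
    using D by (intro real_cond_exp_F_meas) simp_all
  moreover have "AE \<omega> in P. real_cond_exp P F (\<lambda>\<omega>. Im (D \<omega>)) \<omega> = 0"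
  proof (rule real_cond_exp_charact)
    fix A assume A: "A \<in> sets F"
    show "set_lebesgue_integral P A (\<lambda>\<omega>. Im (D \<omega>)) = set_lebesgue_integral P A (\<lambda>\<omega>. 0)"
      using zero[OF A] integral_Im[OF int[OF A, unfolded set_integrable_def]]
      by (simp add: set_lebesgue_integral_def)
  qed (use D in simp_all)
  moreover have "AE \<omega> in P. real_cond_exp P F (\<lambda>\<omega>. Im (D \<omega>)) \<omega> = Im (D \<omega>)"
    using D by (intro real_cond_exp_F_meas) simp_all
  ultimately show ?thesis by eventually_elim (simp add: complex_eq_iff)
qed

text \<open>
  The events that \<open>X\<close> is above and below its expectation cannot have probability one.
\<close>

lemma (in prob_space) AE_const_if_zero_one:
  fixes X :: "'a \<Rightarrow> real"
  assumes X: "integrable M X"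
    and zo: "\<And>S. S \<in> sets borel \<Longrightarrow> prob (X -` S \<inter> space M) = 0 \<or> prob (X -` S \<inter> space M) = 1"
  shows "AE \<omega> in M. X \<omega> = expectation X"
proof -
  note XM = borel_measurable_integrable[OF X]
  have ae: "(AE \<omega> in M. X \<omega> \<notin> S) \<or> (AE \<omega> in M. X \<omega> \<in> S)" if S: "S \<in> sets borel" for S
  proof -
    have m: "X -` S \<inter> space M \<in> events" using measurable_sets[OF XM S] .
    from zo[OF S] show ?thesis
    proof
      assume "prob (X -` S \<inter> space M) = 0"
      then have "AE \<omega> in M. \<omega> \<notin> X -` S \<inter> space M" using prob_eq_0[OF m] by simp
      from this AE_space have "AE \<omega> in M. X \<omega> \<notin> S" by eventually_elim auto
      then show ?thesis ..
    next
      assume "prob (X -` S \<inter> space M) = 1"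
      then have "AE \<omega> in M. \<omega> \<in> X -` S \<inter> space M" using prob_eq_1[OF m] by simp
      then have "AE \<omega> in M. X \<omega> \<in> S" by eventually_elim auto
      then show ?thesis ..
    qed
  qed
  have "AE \<omega> in M. X \<omega> \<notin> {expectation X<..}"
  proof (rule ccontr)
    assume "\<not> ?thesis"
    then have "AE \<omega> in M. X \<omega> \<in> {expectation X<..}" using ae[of "{expectation X<..}"] by simp
    then have "expectation X < expectation X" by (intro expectation_greater[OF X]) simp
    then show False by simp
  qed
  moreover have "AE \<omega> in M. X \<omega> \<notin> {..<expectation X}"
  proof (rule ccontr)
    assume "\<not> ?thesis"
    then have "AE \<omega> in M. X \<omega> \<in> {..<expectation X}" using ae[of "{..<expectation X}"] by simp
    then have "expectation X < expectation X" by (intro expectation_less[OF X]) simp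
    then show False by simp
  qed
  ultimately show ?thesis by eventually_elim auto
qed

context solution begin

text \<open>
  This generator is stable under intersection, and it separates the noise at time \<open>-k\<close> from the
  earlier noise, so that independence can be used on it.
\<close>

lemma past_noise_split:
  "sets (past noise k) = sigma_sets UNIV {noise k -` B \<inter> C | B C. B \<in> sets borel \<and> C \<in> sets (past noise (Suc k))}"
  (is "_ = sigma_sets UNIV ?G")
proof (rule antisym)
  have "noise j -` B \<in> sigma_sets UNIV ?G" if "k \<le> j" "B \<in> sets borel" for j B
  proof (rule sigma_sets.Basic, cases "j = k")
    case True
    then show "noise j -` B \<in> ?G" using that by (intro CollectI exI[of _ B] exI[of _ UNIV]) auto
  next
    case False
    then have "noise j -` B \<in> sets (past noise (Suc k))" using that by (intro vimage_in_past) auto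
    then show "noise j -` B \<in> ?G" by (intro CollectI exI[of _ UNIV] exI[of _ "noise j -` B"]) auto
  qed
  then show "sets (past noise k) \<subseteq> sigma_sets UNIV ?G"
    unfolding sets_past[of noise k] by (intro sigma_sets_mono) blast
  have "?G \<subseteq> sets (past noise k)"
    using vimage_in_past[OF order_refl, of _ noise k] past_antimono[of k "Suc k" noise] by auto
  then show "sigma_sets UNIV ?G \<subseteq> sets (past noise k)"
    using sets.sigma_sets_subset[of ?G "past noise k"] by simp
qed

lemma indep_noise_past:
  fixes f h :: "_ \<Rightarrow> complex"
  assumes f: "f \<in> borel_measurable (ae_past (Suc k))" and h: "h \<in> borel_measurable borel"
    and int: "integrable P f" and bd: "bounded (range h)"
  shows "(\<integral>\<omega>. f \<omega> * h (noise k \<omega>) \<partial>P) = (\<integral>\<omega>. f \<omega> \<partial>P) * (\<integral>\<omega>. h (noise k \<omega>) \<partial>P)"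
proof (rule indep_var_lebesgue_integral)
  have hm: "(\<lambda>\<omega>. h (noise k \<omega>)) \<in> borel_measurable P" using measurable_compose[OF noise_measurable h] .
  obtain b where b: "\<And>x. norm (h x) \<le> b" using bd by (auto simp: bounded_iff)
  show "integrable P (\<lambda>\<omega>. h (noise k \<omega>))"
    by (rule integrable_const_bound[of _ b]) (use b hm in auto)
  show "indep_var borel f borel (\<lambda>\<omega>. h (noise k \<omega>))"
    unfolding indep_var_eq
  proof (intro conjI)
    show "indep_set (sigma_sets (space P) {f -` A \<inter> space P |A. A \<in> sets borel})
       (sigma_sets (space P) {(\<lambda>\<omega>. h (noise k \<omega>)) -` A \<inter> space P |A. A \<in> sets borel})"
    proof (rule indep_setI)
      have "{f -` A \<inter> space P |A. A \<in> sets borel} \<subseteq> sets (ae_past (Suc k))"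
        using measurable_sets[OF f] by auto
      from sets.sigma_sets_subset[OF this]
      have 1: "sigma_sets (space P) {f -` A \<inter> space P |A. A \<in> sets borel} \<subseteq> sets (ae_past (Suc k))" by simp
      then show "sigma_sets (space P) {f -` A \<inter> space P |A. A \<in> sets borel} \<subseteq> events"
        using ae_past_sub by blast
      let ?V = "vimage_algebra UNIV (noise k) borel :: (nat \<Rightarrow> 'g) measure"
      have "(\<lambda>\<omega>. h (noise k \<omega>)) -` A \<inter> space P \<in> sets ?V" if "A \<in> sets borel" for A
        using in_vimage_algebra[OF measurable_sets[OF h that], of "noise k" UNIV] by (simp add: vimage_def)
      then have "{(\<lambda>\<omega>. h (noise k \<omega>)) -` A \<inter> space P |A. A \<in> sets borel} \<subseteq> sets ?V" by blast
      from sets.sigma_sets_subset[OF this]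
      have 2: "sigma_sets (space P) {(\<lambda>\<omega>. h (noise k \<omega>)) -` A \<inter> space P |A. A \<in> sets borel} \<subseteq> sets ?V"
        by simp
      then show "sigma_sets (space P) {(\<lambda>\<omega>. h (noise k \<omega>)) -` A \<inter> space P |A. A \<in> sets borel} \<subseteq> events"
        using indep_setD_ev1[OF indep] by blast
      fix a b assume a: "a \<in> sigma_sets (space P) {f -` A \<inter> space P |A. A \<in> sets borel}"
        and b: "b \<in> sigma_sets (space P) {(\<lambda>\<omega>. h (noise k \<omega>)) -` A \<inter> space P |A. A \<in> sets borel}"
      from b 2 have "b \<in> sets ?V" by blast
      then obtain B where B: "B \<in> sets borel" "b = noise k -` B" by (auto simp: sets_vimage_algebra2)
      from a 1 have "a \<in> sets (ae_past (Suc k))" by blast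
      from indep_ae_past[OF this B(1)] show "prob (a \<inter> b) = prob a * prob b"
        unfolding B(2) by (simp add: Int_commute mult.commute)
    qed
  qed (use int hm in auto)
qed (rule int)

end

section \<open>Characters of an extremal solution\<close>

locale abelian_solution = compact_abelian "TYPE('g)" + solution \<mu> P
  for \<mu> :: "nat \<Rightarrow> 'g::{topological_group_add,t2_space} measure" and P :: "(nat \<Rightarrow> 'g) measure" +
  assumes extremal: "P \<in> extremal_solutions \<mu>"
begin

lemma character_coord_Suc:
  assumes "character \<phi>"
  shows "\<phi> (coord k \<omega>) = \<phi> (coord (Suc k) \<omega>) * \<phi> (noise k \<omega>)"
  unfolding noise_def characterD(2)[OF assms, symmetric] by (simp only: add_minus_cancel)

text \<open>
  It must be shown that \<open>W * \<phi>(\<xi> k)\<close>, with \<open>W = \<phi>(\<eta> (k+1)) - m'\<close>, has integral zero over all events of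
  the noise up to time \<open>-k\<close>. On an intersection of \<open>{\<xi> k \<in> B}\<close> with an event \<open>C\<close> of the earlier noise
  the integral factors by independence, and the factor of \<open>W\<close> on \<open>C\<close> is zero by the definition of \<open>m'\<close>.
  Such intersections generate all events in question, and Dynkin's lemma extends the identity to them.
\<close>

lemma cond_version_step:
  assumes phi: "character \<phi>"
    and m: "cond_version P (past noise k) (\<lambda>\<omega>. \<phi> (coord k \<omega>)) m"
    and m': "cond_version P (past noise (Suc k)) (\<lambda>\<omega>. \<phi> (coord (Suc k) \<omega>)) m'"
  shows "AE \<omega> in P. m \<omega> = m' \<omega> * \<phi> (noise k \<omega>)"
proof -
  note ph = characterD[OF phi]
  let ?X = "\<lambda>k \<omega>. \<phi> (coord k \<omega>)" and ?Z = "\<lambda>\<omega>. \<phi> (noise k \<omega>)"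
  have XP: "?X j \<in> borel_measurable P" for j using measurable_compose[OF coord_measurable ph(4)] .
  have ZP: "?Z \<in> borel_measurable P" using measurable_compose[OF noise_measurable ph(4)] .
  have Xi: "integrable P (?X j)" for j
    by (rule integrable_const_bound[of _ 1]) (use XP ph(3) in auto)
  have Zb: "bounded (range ?Z)" using ph(3) by (auto simp: bounded_iff intro!: exI[of _ 1])
  have mF: "m \<in> borel_measurable (past noise k)" "integrable P m"
    and m'F: "m' \<in> borel_measurable (past noise (Suc k))" "integrable P m'"
    using m m' by (simp_all add: cond_version_def)
  have m'Fk: "m' \<in> borel_measurable (past noise k)"
    using m'F(1) past_antimono[of k "Suc k" noise] by (auto simp: measurable_def)
  have ZF: "?Z \<in> borel_measurable (past noise k)"
    using measurable_compose[OF past_measurable[OF order_refl] ph(4)] .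
  define W where "W = (\<lambda>\<omega>. ?X (Suc k) \<omega> - m' \<omega>)"
  have Wi: "integrable P W" unfolding W_def using Xi m'F by simp
  have Wa: "W \<in> borel_measurable (ae_past (Suc k))"
  proof -
    have "?X (Suc k) \<in> borel_measurable (ae_past (Suc k))" using measurable_compose[OF coord_ae_past ph(4)] .
    moreover have "m' \<in> borel_measurable (ae_past (Suc k))"
      using m'F(1) past_noise_ae_past[of "Suc k"] by (auto simp: measurable_def)
    ultimately show ?thesis unfolding W_def by simp
  qed
  have WZi: "integrable P (\<lambda>\<omega>. W \<omega> * ?Z \<omega>)" by (rule integrable_mult_bounded[OF Wi ZP Zb])
  have WZs: "set_integrable P A (\<lambda>\<omega>. W \<omega> * ?Z \<omega>)" if "A \<in> sets (past noise k)" for A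
    using that past_noise_sub[of k] WZi unfolding set_integrable_def by (intro integrable_mult_indicator) auto
  let ?G = "{(noise k :: (nat \<Rightarrow> 'g) \<Rightarrow> 'g) -` B \<inter> C | B C. B \<in> sets borel \<and> C \<in> sets (past noise (Suc k))}"
  have gen: "set_lebesgue_integral P A (\<lambda>\<omega>. W \<omega> * ?Z \<omega>) = 0"
    if A: "A = noise k -` B \<inter> C" "B \<in> sets borel" "C \<in> sets (past noise (Suc k))" for A B C
  proof -
    have Ca: "C \<in> sets (ae_past (Suc k))" using A(3) past_noise_ae_past by blast
    have CP: "(indicator C :: _ \<Rightarrow> complex) \<in> borel_measurable P"
      by (rule borel_measurable_indicator) (use Ca ae_past_sub in blast)
    have Cb: "bounded (range (indicator C :: _ \<Rightarrow> complex))"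
      by (auto simp: bounded_iff indicator_def intro!: exI[of _ 1])
    define h where "h x = indicator B x * \<phi> x" for x
    have "set_lebesgue_integral P A (\<lambda>\<omega>. W \<omega> * ?Z \<omega>)
        = (\<integral>\<omega>. (W \<omega> * indicator C \<omega>) * h (noise k \<omega>) \<partial>P)"
      unfolding set_lebesgue_integral_def A(1) h_def
      by (intro Bochner_Integration.integral_cong) (auto simp: indicator_def)
    also have "\<dots> = (\<integral>\<omega>. W \<omega> * indicator C \<omega> \<partial>P) * (\<integral>\<omega>. h (noise k \<omega>) \<partial>P)"
    proof (rule indep_noise_past)
      show "(\<lambda>\<omega>. W \<omega> * indicator C \<omega>) \<in> borel_measurable (ae_past (Suc k))" using Wa Ca by simp
      show "h \<in> borel_measurable borel" unfolding h_def using ph(4) A(2) by simp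
      show "integrable P (\<lambda>\<omega>. W \<omega> * indicator C \<omega>)"
        by (rule integrable_mult_bounded[OF Wi CP Cb])
      show "bounded (range h)" using ph(3) by (auto simp: bounded_iff h_def indicator_def intro!: exI[of _ 1])
    qed
    also have "(\<integral>\<omega>. W \<omega> * indicator C \<omega> \<partial>P) = 0"
    proof -
      have "(indicator C :: _ \<Rightarrow> complex) \<in> borel_measurable (past noise (Suc k))" using A(3) by simp
      then have "(\<integral>\<omega>. ?X (Suc k) \<omega> * indicator C \<omega> \<partial>P) = (\<integral>\<omega>. m' \<omega> * indicator C \<omega> \<partial>P)"
        using m' Cb by (simp add: cond_version_def)
      then show ?thesis unfolding W_def left_diff_distrib
        using integrable_mult_bounded[OF Xi CP Cb] integrable_mult_bounded[OF m'F(2) CP Cb] by simp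
    qed
    finally show ?thesis by simp
  qed
  have zero: "set_lebesgue_integral P A (\<lambda>\<omega>. W \<omega> * ?Z \<omega>) = 0" if A: "A \<in> sets (past noise k)" for A
  proof -
    have "Int_stable ?G"
      unfolding Int_stable_def
    proof (intro ballI)
      fix a b :: "(nat \<Rightarrow> 'g) set" assume "a \<in> ?G" "b \<in> ?G"
      then obtain B C B' C' where "a = noise k -` B \<inter> C" "B \<in> sets borel" "C \<in> sets (past noise (Suc k))"
        "b = noise k -` B' \<inter> C'" "B' \<in> sets borel" "C' \<in> sets (past noise (Suc k))" by (elim CollectE exE conjE)
      then show "a \<inter> b \<in> ?G" by (intro CollectI exI[of _ "B \<inter> B'"] exI[of _ "C \<inter> C'"]) auto
    qed
    moreover have "?G \<subseteq> Pow UNIV" by simp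
    moreover have "A \<in> sigma_sets UNIV ?G" using A unfolding past_noise_split[of k] .
    ultimately show ?thesis
    proof (induction rule: sigma_sets_induct_disjoint)
      case (basic A)
      then obtain B C where "A = noise k -` B \<inter> C" "B \<in> sets borel" "C \<in> sets (past noise (Suc k))"
        by (elim CollectE exE conjE)
      then show ?case by (rule gen)
    next
      case empty
      show ?case by (simp add: set_lebesgue_integral_def)
    next
      case (compl A)
      have A: "A \<in> sets (past noise k)" using compl(1) unfolding past_noise_split[of k] .
      have U: "set_lebesgue_integral P UNIV (\<lambda>\<omega>. W \<omega> * ?Z \<omega>) = 0"
        by (rule gen[of _ UNIV UNIV]) simp_all
      have "set_lebesgue_integral P UNIV (\<lambda>\<omega>. W \<omega> * ?Z \<omega>)
        = set_lebesgue_integral P (UNIV - A) (\<lambda>\<omega>. W \<omega> * ?Z \<omega>) + set_lebesgue_integral P A (\<lambda>\<omega>. W \<omega> * ?Z \<omega>)"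
        using set_integral_Un[OF Diff_disjoint[of A UNIV, unfolded Int_commute[of A]] WZs WZs] A sets.compl_sets[OF A]
        by (simp add: Un_commute)
      then show ?case using U compl(2) by simp
    next
      case (union A)
      have A: "A i \<in> sets (past noise k)" for i using union(2) unfolding past_noise_split[of k] by blast
      have "set_lebesgue_integral P (\<Union>i. A i) (\<lambda>\<omega>. W \<omega> * ?Z \<omega>) = (\<Sum>i. set_lebesgue_integral P (A i) (\<lambda>\<omega>. W \<omega> * ?Z \<omega>))"
      proof (rule lebesgue_integral_countable_add)
        show "A i \<in> events" for i using A past_noise_sub by blast
        show "i \<noteq> j \<Longrightarrow> A i \<inter> A j = {}" for i j using union(1) by (auto simp: disjoint_family_on_def)
        show "set_integrable P (\<Union>i. A i) (\<lambda>\<omega>. W \<omega> * ?Z \<omega>)" using A by (intro WZs) auto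
      qed
      then show ?case using union(3) by simp
    qed
  qed
  have "AE \<omega> in P. m \<omega> - m' \<omega> * ?Z \<omega> = 0"
  proof (rule zero_if_integrals_zero[OF past_noise_subalgebra])
    show "(\<lambda>\<omega>. m \<omega> - m' \<omega> * ?Z \<omega>) \<in> borel_measurable (past noise k)" using mF(1) m'Fk ZF by simp
    have i2: "integrable P (\<lambda>\<omega>. m' \<omega> * ?Z \<omega>)" by (rule integrable_mult_bounded[OF m'F(2) ZP Zb])
    then show "integrable P (\<lambda>\<omega>. m \<omega> - m' \<omega> * ?Z \<omega>)" using mF(2) by simp
    fix A :: "(nat \<Rightarrow> 'g) set" assume A: "A \<in> sets (past noise k)"
    have AF: "(indicator A :: _ \<Rightarrow> complex) \<in> borel_measurable (past noise k)" using A by simp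
    have AP: "(indicator A :: _ \<Rightarrow> complex) \<in> borel_measurable P"
      by (rule borel_measurable_indicator) (use A past_noise_sub in blast)
    have Ab: "bounded (range (indicator A :: _ \<Rightarrow> complex))"
      by (auto simp: bounded_iff indicator_def intro!: exI[of _ 1])
    have "(\<integral>\<omega>. m \<omega> * indicator A \<omega> \<partial>P) = (\<integral>\<omega>. ?X k \<omega> * indicator A \<omega> \<partial>P)"
      using m AF Ab by (simp add: cond_version_def)
    moreover have "indicator A \<omega> *\<^sub>R (W \<omega> * ?Z \<omega>) = (W \<omega> * ?Z \<omega>) * indicator A \<omega>" for \<omega>
      by (simp add: indicator_def)
    then have "(\<integral>\<omega>. (W \<omega> * ?Z \<omega>) * indicator A \<omega> \<partial>P) = 0"
      using zero[OF A] unfolding set_lebesgue_integral_def by simp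
    moreover have "(W \<omega> * ?Z \<omega>) * indicator A \<omega> = ?X k \<omega> * indicator A \<omega> - (m' \<omega> * ?Z \<omega>) * indicator A \<omega>" for \<omega>
      unfolding W_def character_coord_Suc[OF phi, of k] by (simp add: algebra_simps)
    ultimately have "(\<integral>\<omega>. m \<omega> * indicator A \<omega> \<partial>P) = (\<integral>\<omega>. (m' \<omega> * ?Z \<omega>) * indicator A \<omega> \<partial>P)"
      using integrable_mult_bounded[OF Xi AP Ab] integrable_mult_bounded[OF i2 AP Ab] by simp
    then have "(\<integral>\<omega>. (m \<omega> - m' \<omega> * ?Z \<omega>) * indicator A \<omega> \<partial>P) = 0"
      unfolding left_diff_distrib using integrable_mult_bounded[OF mF(2) AP Ab] integrable_mult_bounded[OF i2 AP Ab] by simp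
    moreover have "indicator A \<omega> *\<^sub>R (m \<omega> - m' \<omega> * ?Z \<omega>) = (m \<omega> - m' \<omega> * ?Z \<omega>) * indicator A \<omega>" for \<omega>
      by (simp add: indicator_def)
    ultimately show "set_lebesgue_integral P A (\<lambda>\<omega>. m \<omega> - m' \<omega> * ?Z \<omega>) = 0"
      unfolding set_lebesgue_integral_def by simp
  qed
  then show ?thesis by eventually_elim simp
qed

text \<open>
  \<open>R k = m k * cnj (\<phi>(\<eta> k))\<close> is the quotient of \<open>m k\<close> by \<open>\<phi>(\<eta> k)\<close>. It is measurable with respect to the
  past at time \<open>-k\<close> and almost surely the same for all \<open>k\<close>, so it belongs to the remote past and is
  constant by \<open>extremal_zero_one\<close>. The two alternatives are the cases of a nonzero and of a zero
  constant.
\<close>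

lemma character_dichotomy:
  assumes phi: "character \<phi>"
  shows "(\<forall>k. \<exists>Y\<in>borel_measurable (past noise k). AE \<omega> in P. \<phi> (coord k \<omega>) = Y \<omega>) \<or>
    (\<forall>V\<in>borel_measurable (past noise 0). bounded (range V) \<longrightarrow> (\<integral>\<omega>. \<phi> (coord 0 \<omega>) * V \<omega> \<partial>P) = 0)"
proof -
  note ph = characterD[OF phi]
  let ?X = "\<lambda>k \<omega>. \<phi> (coord k \<omega>)"
  have XP: "?X j \<in> borel_measurable P" for j using measurable_compose[OF coord_measurable ph(4)] .
  have Xi: "integrable P (?X j)" for j
    by (rule integrable_const_bound[of _ 1]) (use XP ph(3) in auto)
  have "\<forall>k. \<exists>m. cond_version P (past noise k) (?X k) m"
    using cond_version_exists[OF past_noise_subalgebra Xi] by blast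
  then obtain m where m: "\<And>k. cond_version P (past noise k) (?X k) (m k)" by metis
  have mF: "m k \<in> borel_measurable (past noise k)" "integrable P (m k)" for k
    using m[of k] by (simp_all add: cond_version_def)
  define R where "R k \<omega> = m k \<omega> * cnj (?X k \<omega>)" for k \<omega>
  have "AE \<omega> in P. R k \<omega> = R (Suc k) \<omega>" for k
    using cond_version_step[OF phi m m, of k]
  proof eventually_elim
    case (elim \<omega>)
    have "R k \<omega> = m (Suc k) \<omega> * cnj (?X (Suc k) \<omega>) * (\<phi> (noise k \<omega>) * cnj (\<phi> (noise k \<omega>)))"
      unfolding R_def elim character_coord_Suc[OF phi, of k] by simp
    then show ?case by (simp only: ph(5) R_def mult_1_right)
  qed
  then have step: "AE \<omega> in P. \<forall>k. R k \<omega> = R (Suc k) \<omega>" by (simp add: AE_all_countable)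
  have R0: "AE \<omega> in P. R k \<omega> = R 0 \<omega>" for k
    using step
  proof eventually_elim
    case (elim \<omega>)
    then show "R k \<omega> = R 0 \<omega>" by (induction k) simp_all
  qed
  have Ra: "R k \<in> borel_measurable (ae_past k)" for k
  proof -
    have "m k \<in> borel_measurable (ae_past k)"
      using mF(1)[of k] past_noise_ae_past[of k] by (auto simp: measurable_def)
    moreover have "(\<lambda>\<omega>. cnj (?X k \<omega>)) \<in> borel_measurable (ae_past k)"
      by (rule measurable_compose[OF coord_ae_past borel_measurable_continuous_onI[OF continuous_on_cnj[OF ph(1)]]])
    ultimately show ?thesis unfolding R_def by (rule borel_measurable_times)
  qed
  have RP: "R k \<in> borel_measurable P" for k
    using Ra[of k] ae_past_sub[of k] by (auto simp: measurable_def)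
  have zo: "prob (R 0 -` S) = 0 \<or> prob (R 0 -` S) = 1" if S: "S \<in> sets borel" for S
  proof (rule extremal_zero_one[OF extremal solution_axioms])
    fix k
    have "R k -` S \<in> ae_sets P (past coord k)" using measurable_sets[OF Ra S, of k] by (simp add: sets_ae_past)
    moreover have "R 0 -` S \<in> events" using measurable_sets[OF RP S, of 0] by simp
    moreover have "AE \<omega> in P. \<omega> \<in> R k -` S \<longleftrightarrow> \<omega> \<in> R 0 -` S" using R0[of k] by eventually_elim simp
    ultimately show "R 0 -` S \<in> sets (ae_past k)" unfolding sets_ae_past by (rule ae_sets_cong)
  qed
  have Ri: "integrable P (R 0)" unfolding R_def
  proof (rule integrable_mult_bounded[OF mF(2)])
    show "(\<lambda>\<omega>. cnj (?X 0 \<omega>)) \<in> borel_measurable P"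
      by (rule measurable_compose[OF coord_measurable borel_measurable_continuous_onI[OF continuous_on_cnj[OF ph(1)]]])
    show "bounded (range (\<lambda>\<omega>. cnj (?X 0 \<omega>)))" using ph(3) by (auto simp: bounded_iff intro!: exI[of _ 1])
  qed
  have "AE \<omega> in P. Re (R 0 \<omega>) = expectation (\<lambda>\<omega>. Re (R 0 \<omega>))"
  proof (rule AE_const_if_zero_one)
    fix S :: "real set" assume "S \<in> sets borel"
    then have "Re -` S \<in> sets borel" using measurable_sets[of Re borel borel S] by simp
    from zo[OF this] show "prob ((\<lambda>\<omega>. Re (R 0 \<omega>)) -` S \<inter> space P) = 0 \<or> prob ((\<lambda>\<omega>. Re (R 0 \<omega>)) -` S \<inter> space P) = 1"
      by (simp add: vimage_def)
  qed (use Ri in simp)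
  moreover have "AE \<omega> in P. Im (R 0 \<omega>) = expectation (\<lambda>\<omega>. Im (R 0 \<omega>))"
  proof (rule AE_const_if_zero_one)
    fix S :: "real set" assume "S \<in> sets borel"
    then have "Im -` S \<in> sets borel" using measurable_sets[of Im borel borel S] by simp
    from zo[OF this] show "prob ((\<lambda>\<omega>. Im (R 0 \<omega>)) -` S \<inter> space P) = 0 \<or> prob ((\<lambda>\<omega>. Im (R 0 \<omega>)) -` S \<inter> space P) = 1"
      by (simp add: vimage_def)
  qed (use Ri in simp)
  ultimately have "AE \<omega> in P. R 0 \<omega> = Complex (expectation (\<lambda>\<omega>. Re (R 0 \<omega>))) (expectation (\<lambda>\<omega>. Im (R 0 \<omega>)))"
    by eventually_elim (simp add: complex_eq_iff)
  then obtain c where c0: "AE \<omega> in P. R 0 \<omega> = c" ..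
  have mX: "AE \<omega> in P. m k \<omega> = c * ?X k \<omega>" for k
    using R0[of k] c0
  proof eventually_elim
    case (elim \<omega>)
    have "m k \<omega> * (?X k \<omega> * cnj (?X k \<omega>)) = R k \<omega> * ?X k \<omega>" unfolding R_def by simp
    then show ?case using elim by (simp only: ph(5) mult_1_right)
  qed
  show ?thesis
  proof (cases "c = 0")
    case True
    have "(\<integral>\<omega>. ?X 0 \<omega> * V \<omega> \<partial>P) = 0" if V: "V \<in> borel_measurable (past noise 0)" "bounded (range V)" for V
    proof -
      have "(\<integral>\<omega>. ?X 0 \<omega> * V \<omega> \<partial>P) = (\<integral>\<omega>. m 0 \<omega> * V \<omega> \<partial>P)"
        using m[of 0] V by (simp add: cond_version_def)
      also have "AE \<omega> in P. m 0 \<omega> * V \<omega> = 0" using mX[of 0] by eventually_elim (simp add: True)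
      then have "(\<integral>\<omega>. m 0 \<omega> * V \<omega> \<partial>P) = 0" by (rule integral_eq_zero_AE)
      finally show ?thesis .
    qed
    then show ?thesis by blast
  next
    case False
    have "\<exists>Y\<in>borel_measurable (past noise k). AE \<omega> in P. ?X k \<omega> = Y \<omega>" for k
    proof (intro bexI)
      show "AE \<omega> in P. ?X k \<omega> = m k \<omega> / c" using mX[of k] by eventually_elim (simp add: False)
      show "(\<lambda>\<omega>. m k \<omega> / c) \<in> borel_measurable (past noise k)" using mF(1)[of k] by simp
    qed
    then show ?thesis by blast
  qed
qed

text \<open>
  A nonzero subspace of the one-dimensional space is the whole space, so characters are irreducible.
\<close>

lemma character_one_dim_rep:
  assumes phi: "character \<phi>"
  shows "(\<lambda>g. mat 1 1 (\<lambda>_. \<phi> g), 1) \<in> irreducible_unitary_reps"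
proof -
  note ph = characterD[OF phi]
  have adj: "mat_adjoint (mat 1 1 (\<lambda>_. \<phi> g)) * mat 1 1 (\<lambda>_. \<phi> g) = 1\<^sub>m 1" for g
  proof (rule eq_matI)
    fix i j assume "i < dim_row (1\<^sub>m 1 :: complex mat)" "j < dim_col (1\<^sub>m 1 :: complex mat)"
    then show "(mat_adjoint (mat 1 1 (\<lambda>_. \<phi> g)) * mat 1 1 (\<lambda>_. \<phi> g)) $$ (i, j) = 1\<^sub>m 1 $$ (i, j)"
      using ph(5)[of g] by (simp add: mat_adjoint_def mat_of_rows_def scalar_prod_def mult.commute)
  qed (simp_all add: mat_adjoint_def)
  have "unitary_rep (\<lambda>g. mat 1 1 (\<lambda>_. \<phi> g)) 1"
    unfolding unitary_rep_def
  proof (intro conjI allI impI adj)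
    fix g h show "mat 1 1 (\<lambda>_. \<phi> (g + h)) = mat 1 1 (\<lambda>_. \<phi> g) * mat 1 1 (\<lambda>_. \<phi> h)"
      by (rule eq_matI) (simp_all add: ph(2) scalar_prod_def)
  next
    fix i j :: nat assume "i < 1" "j < 1"
    then show "continuous_on UNIV (\<lambda>g. mat 1 1 (\<lambda>_. \<phi> g) $$ (i, j))" using ph(1) by simp
  qed simp
  moreover have "W = {0\<^sub>v 1} \<or> W = carrier_vec 1"
    if W: "invariant_subspace (\<lambda>g. mat 1 1 (\<lambda>_. \<phi> g)) 1 W" for W
  proof (cases "W = {0\<^sub>v 1}")
    case False
    have sub: "W \<subseteq> carrier_vec 1" "0\<^sub>v 1 \<in> W" and scale: "\<And>c v. v \<in> W \<Longrightarrow> c \<cdot>\<^sub>v v \<in> W"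
      using W by (auto simp: invariant_subspace_def)
    from False sub(2) obtain v where v: "v \<in> W" "v \<noteq> 0\<^sub>v 1" by blast
    have vc: "v \<in> carrier_vec 1" using v sub by blast
    have nz: "v $ 0 \<noteq> 0"
    proof
      assume "v $ 0 = 0"
      then have "v = 0\<^sub>v 1" using vc by (intro eq_vecI) auto
      then show False using v(2) by simp
    qed
    have "u \<in> W" if "u \<in> carrier_vec 1" for u
    proof -
      have "u = (u $ 0 / v $ 0) \<cdot>\<^sub>v v" using that vc nz by (intro eq_vecI) auto
      then show ?thesis using scale[OF v(1)] by metis
    qed
    then show ?thesis using sub(1) by blast
  qed simp
  ultimately show ?thesis by (auto simp: irreducible_unitary_reps_def)
qed

lemma Hs_mu_character:
  assumes g: "g \<in> Hs_mu P" and phi: "character \<phi>"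
    and strong: "\<forall>k. \<exists>Y\<in>borel_measurable (past noise k). AE \<omega> in P. \<phi> (coord k \<omega>) = Y \<omega>"
  shows "\<phi> g = 1"
proof -
  have "(\<lambda>g. mat 1 1 (\<lambda>_. \<phi> g), 1) \<in> strong_reps P"
    unfolding strong_reps_def
  proof (intro CollectI case_prodI conjI allI character_one_dim_rep phi)
    fix k
    obtain Y where Y: "Y \<in> borel_measurable (past noise k)" "AE \<omega> in P. \<phi> (coord k \<omega>) = Y \<omega>"
      using strong by blast
    show "\<exists>Z. (\<forall>\<omega>. Z \<omega> \<in> carrier_mat 1 1) \<and>
        (\<forall>i<1. \<forall>j<1. (\<lambda>\<omega>. Z \<omega> $$ (i, j)) \<in> borel_measurable (past noise k)) \<and>
        (AE \<omega> in P. mat 1 1 (\<lambda>_. \<phi> (coord k \<omega>)) = Z \<omega>)"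
    proof (intro exI[of _ "\<lambda>\<omega>. mat 1 1 (\<lambda>_. Y \<omega>)"] conjI)
      show "AE \<omega> in P. mat 1 1 (\<lambda>_. \<phi> (coord k \<omega>)) = mat 1 1 (\<lambda>_. Y \<omega>)"
        using Y(2) by eventually_elim simp
    qed (use Y(1) in auto)
  qed
  then have "mat 1 1 (\<lambda>_. \<phi> g) = (1\<^sub>m 1 :: complex mat)" using g by (auto simp: Hs_mu_def)
  then have "mat 1 1 (\<lambda>_. \<phi> g) $$ (0, 0) = (1\<^sub>m 1 :: complex mat) $$ (0, 0)" by simp
  then show ?thesis by simp
qed

section \<open>Trigonometric polynomials and the reverse inclusion\<close>

text \<open>
  Products of characters of coordinates. They are the characters of the path group that depend on
  finitely many coordinates; the inductive form gives the measurability in \<open>monomials_factor\<close>.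
\<close>

inductive_set monomials :: "((nat \<Rightarrow> 'g) \<Rightarrow> complex) set" where
  one: "(\<lambda>_. 1) \<in> monomials"
| times: "f \<in> monomials \<Longrightarrow> character \<phi> \<Longrightarrow> (\<lambda>\<omega>. \<phi> (\<omega> j) * f \<omega>) \<in> monomials"

lemma monomials_mult:
  assumes "f \<in> monomials" "h \<in> monomials"
  shows "(\<lambda>\<omega>. f \<omega> * h \<omega>) \<in> monomials"
  using assms(1)
proof (induction rule: monomials.induct)
  case (times f \<phi> j)
  from monomials.times[OF times.IH times.hyps(2), of j] show ?case by (simp add: mult.assoc)
qed (use assms(2) in simp)

lemma monomials_cnj:
  assumes "f \<in> monomials"
  shows "(\<lambda>\<omega>. cnj (f \<omega>)) \<in> monomials"
  using assms
proof (induction rule: monomials.induct)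
  case (times f \<phi> j)
  from monomials.times[OF times.IH character_cnj[OF times.hyps(2)], of j] show ?case by simp
qed (simp add: monomials.one)

lemma monomials_continuous:
  assumes "f \<in> monomials"
  shows "continuous_on UNIV f"
  using assms
proof (induction rule: monomials.induct)
  case (times f \<phi> j)
  show ?case
    by (intro continuous_on_mult times.IH continuous_on_compose2[OF characterD(1)[OF times.hyps(2)]]
        continuous_on_product_coordinates) simp
qed simp

text \<open>
  The increment \<open>- \<omega> 0 + \<omega> j\<close> is minus the sum of the noise at the indices below \<open>j\<close>.
\<close>

lemma character_increment_measurable:
  assumes phi: "character \<phi>"
  shows "(\<lambda>\<omega>. \<phi> (- \<omega> 0 + \<omega> j)) \<in> borel_measurable (past noise 0)"
proof (induction j)
  case 0
  then show ?case by simp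
next
  case (Suc j)
  have "- \<omega> 0 + \<omega> (Suc j) = (- \<omega> 0 + \<omega> j) + - noise j \<omega>" for \<omega>
    unfolding noise_def coord_def minus_add by (simp only: minus_minus add.assoc add_minus_cancel)
  then have eq: "\<phi> (- \<omega> 0 + \<omega> (Suc j)) = \<phi> (- \<omega> 0 + \<omega> j) * cnj (\<phi> (noise j \<omega>))" for \<omega>
    using characterD(2,7)[OF phi] by metis
  have "(\<lambda>\<omega>. cnj (\<phi> (noise j \<omega>))) \<in> borel_measurable (past noise 0)"
    by (rule measurable_compose[OF past_measurable borel_measurable_continuous_onI[OF continuous_on_cnj[OF characterD(1)[OF phi]]]]) simp
  then show ?case unfolding eq by (rule borel_measurable_times[OF Suc])
qed

text \<open>
  Each factor \<open>\<theta> (\<omega> j)\<close> equals \<open>\<theta> (\<omega> 0)\<close> times a function of the noise. So all coordinates can be moved to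
  index \<open>0\<close>, where their characters multiply.
\<close>

lemma monomials_factor:
  assumes "f \<in> monomials"
  shows "\<exists>\<phi> V. character \<phi> \<and> V \<in> borel_measurable (past noise 0) \<and> bounded (range V) \<and>
    (\<forall>\<omega>. f \<omega> = \<phi> (coord 0 \<omega>) * V \<omega>)"
  using assms
proof (induction rule: monomials.induct)
  case one
  show ?case
    by (intro exI[of _ "\<lambda>_. 1"] conjI character_one) (auto simp: bounded_iff)
next
  case (times f \<theta> j)
  then obtain \<phi> V where f: "character \<phi>" "V \<in> borel_measurable (past noise 0)" "bounded (range V)"
    "\<And>\<omega>. f \<omega> = \<phi> (coord 0 \<omega>) * V \<omega>" by blast
  note th = characterD[OF times.hyps(2)]
  let ?U = "\<lambda>\<omega>. \<theta> (- \<omega> 0 + \<omega> j) * V \<omega>"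
  obtain b where "\<And>\<omega>. norm (V \<omega>) \<le> b" using f(3) by (auto simp: bounded_iff)
  then have b: "bounded (range ?U)" by (auto simp: bounded_iff norm_mult th(3))
  have eq: "\<theta> (\<omega> j) = \<theta> (\<omega> 0) * \<theta> (- \<omega> 0 + \<omega> j)" for \<omega>
    unfolding th(2)[symmetric] by (simp only: add_minus_cancel)
  show ?case
  proof (intro exI[of _ "\<lambda>x. \<theta> x * \<phi> x"] exI[of _ ?U] conjI allI)
    show "?U \<in> borel_measurable (past noise 0)"
      by (intro borel_measurable_times character_increment_measurable times.hyps(2) f(2))
    show "\<theta> (\<omega> j) * f \<omega> = \<theta> (coord 0 \<omega>) * \<phi> (coord 0 \<omega>) * ?U \<omega>" for \<omega>
      unfolding f(4) coord_def eq[of \<omega>] by (simp only: mult_ac)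
  qed (intro character_mult times.hyps(2) f(1) b)+
qed

text \<open>
  The translation multiplies \<open>f\<close> by \<open>\<phi> g\<close>. By \<open>character_dichotomy\<close>, either \<open>\<phi>\<close> belongs to the strong
  representations and \<open>\<phi> g = 1\<close>, or the integral of \<open>f\<close> is zero.
\<close>

lemma monomials_translate:
  assumes g: "g \<in> Hs_mu P" and f: "f \<in> monomials"
  shows "(\<integral>\<omega>. f (\<lambda>k. g + \<omega> k) \<partial>P) = (\<integral>\<omega>. f \<omega> \<partial>P)"
proof -
  from monomials_factor[OF f] obtain \<phi> V where phi: "character \<phi>"
    and V: "V \<in> borel_measurable (past noise 0)" "bounded (range V)"
    and fV: "\<And>\<omega>. f \<omega> = \<phi> (coord 0 \<omega>) * V \<omega>" by blast
  have shift: "f (\<lambda>k. g + \<omega> k) = \<phi> g * f \<omega>" for \<omega>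
    unfolding fV past_noise_measurable_translate[OF V(1)] using characterD(2)[OF phi, of g "\<omega> 0"]
    by (simp add: coord_def)
  from character_dichotomy[OF phi] show ?thesis
  proof
    assume "\<forall>k. \<exists>Y\<in>borel_measurable (past noise k). AE \<omega> in P. \<phi> (coord k \<omega>) = Y \<omega>"
    then have "\<phi> g = 1" by (rule Hs_mu_character[OF g phi])
    then show ?thesis by (simp add: shift)
  next
    assume "\<forall>V\<in>borel_measurable (past noise 0). bounded (range V) \<longrightarrow> (\<integral>\<omega>. \<phi> (coord 0 \<omega>) * V \<omega> \<partial>P) = 0"
    then have "(\<integral>\<omega>. f \<omega> \<partial>P) = 0" unfolding fV using V by blast
    then show ?thesis by (simp add: shift)
  qed
qed

inductive_set trig_polys :: "((nat \<Rightarrow> 'g) \<Rightarrow> complex) set" where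
  monomial: "f \<in> monomials \<Longrightarrow> (\<lambda>\<omega>. c * f \<omega>) \<in> trig_polys"
| add: "f \<in> trig_polys \<Longrightarrow> h \<in> trig_polys \<Longrightarrow> (\<lambda>\<omega>. f \<omega> + h \<omega>) \<in> trig_polys"

lemma trig_polys_mult:
  assumes "f \<in> trig_polys" "h \<in> trig_polys"
  shows "(\<lambda>\<omega>. f \<omega> * h \<omega>) \<in> trig_polys"
  using assms(1)
proof (induction rule: trig_polys.induct)
  case (monomial f c)
  from assms(2) show ?case
  proof (induction rule: trig_polys.induct)
    case (monomial h d)
    from trig_polys.monomial[OF monomials_mult[OF \<open>f \<in> monomials\<close> monomial], of "c * d"]
    show ?case by (simp add: mult_ac)
  next
    case (add h1 h2)
    from trig_polys.add[OF add.IH] show ?case by (simp add: distrib_left)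
  qed
next
  case (add f1 f2)
  from trig_polys.add[OF add.IH] show ?case by (simp add: distrib_right)
qed

lemma trig_polys_continuous:
  assumes "f \<in> trig_polys"
  shows "continuous_on UNIV f"
  using assms
  by (induction rule: trig_polys.induct)
    (auto intro!: continuous_on_mult_left continuous_on_add simp: monomials_continuous)

lemma continuous_integrable:
  fixes f :: "(nat \<Rightarrow> 'g) \<Rightarrow> 'b::{banach, second_countable_topology}"
  assumes "continuous_on UNIV f"
  shows "integrable P f"
proof -
  have "bounded (f ` UNIV)"
    using compact_continuous_image[OF assms compact_paths[OF compact_G]] compact_imp_bounded by blast
  then obtain b where "\<And>\<omega>. norm (f \<omega>) \<le> b" by (auto simp: bounded_iff)
  moreover have "f \<in> borel_measurable P"
    unfolding measurable_cong_sets[OF sets_P refl] by (rule borel_measurable_continuous_onI[OF assms])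
  ultimately show ?thesis by (intro integrable_const_bound[of _ b]) auto
qed

lemma continuous_translated:
  assumes "continuous_on UNIV (f :: (nat \<Rightarrow> 'g) \<Rightarrow> 'b::topological_space)"
  shows "continuous_on UNIV (\<lambda>\<omega>. f (\<lambda>k. g + \<omega> k))"
  by (rule continuous_on_compose2[OF assms continuous_translation]) simp

lemma trig_polys_translate:
  assumes g: "g \<in> Hs_mu P" and f: "f \<in> trig_polys"
  shows "(\<integral>\<omega>. f (\<lambda>k. g + \<omega> k) \<partial>P) = (\<integral>\<omega>. f \<omega> \<partial>P)"
  using f
proof (induction rule: trig_polys.induct)
  case (monomial f c)
  then show ?case using monomials_translate[OF g monomial] by simp
next
  case (add f h)
  note c = trig_polys_continuous[OF add.hyps(1)] trig_polys_continuous[OF add.hyps(2)]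
  show ?case
    using add.IH continuous_integrable[OF c(1)] continuous_integrable[OF c(2)]
      continuous_integrable[OF continuous_translated[OF c(1), of g]]
      continuous_integrable[OF continuous_translated[OF c(2), of g]]
    by simp
qed

text \<open>
  The real and imaginary part of a character of one coordinate are trigonometric polynomials,
  because monomials are closed under complex conjugation.
\<close>

lemma trig_polys_separate:
  assumes "\<omega> \<noteq> \<omega>'"
  shows "\<exists>f :: (nat \<Rightarrow> 'g) \<Rightarrow> real. (\<lambda>\<omega>. of_real (f \<omega>)) \<in> trig_polys \<and> f \<omega> \<noteq> f \<omega>'"
proof -
  from assms obtain j where "\<omega> j \<noteq> \<omega>' j" by auto
  from characters_separate[OF this] obtain \<phi> where phi: "character \<phi>" "\<phi> (\<omega> j) \<noteq> \<phi> (\<omega>' j)" by blast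
  have m: "(\<lambda>\<omega>. \<phi> (\<omega> j)) \<in> monomials" using monomials.times[OF monomials.one phi(1), of j] by simp
  have Re: "(\<lambda>\<omega>. of_real (Re (\<phi> (\<omega> j)))) \<in> trig_polys"
  proof -
    have "of_real (Re z) = (1/2) * z + (1/2) * cnj z" for z by (simp add: complex_eq_iff)
    then show ?thesis
      using trig_polys.add[OF trig_polys.monomial[OF m, of "1/2"] trig_polys.monomial[OF monomials_cnj[OF m], of "1/2"]]
      by presburger
  qed
  have Im: "(\<lambda>\<omega>. of_real (Im (\<phi> (\<omega> j)))) \<in> trig_polys"
  proof -
    have "of_real (Im z) = (- \<i> / 2) * z + (\<i> / 2) * cnj z" for z by (simp add: complex_eq_iff)
    then show ?thesis
      using trig_polys.add[OF trig_polys.monomial[OF m, of "- \<i> / 2"] trig_polys.monomial[OF monomials_cnj[OF m], of "\<i> / 2"]]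
      by presburger
  qed
  from phi(2) have "Re (\<phi> (\<omega> j)) \<noteq> Re (\<phi> (\<omega>' j)) \<or> Im (\<phi> (\<omega> j)) \<noteq> Im (\<phi> (\<omega>' j))"
    by (simp add: complex_eq_iff)
  then show ?thesis
  proof
    assume "Re (\<phi> (\<omega> j)) \<noteq> Re (\<phi> (\<omega>' j))"
    then show ?thesis using Re by (intro exI[of _ "\<lambda>\<omega>. Re (\<phi> (\<omega> j))"]) simp
  next
    assume "Im (\<phi> (\<omega> j)) \<noteq> Im (\<phi> (\<omega>' j))"
    then show ?thesis using Im by (intro exI[of _ "\<lambda>\<omega>. Im (\<phi> (\<omega> j))"]) simp
  qed
qed

lemma trig_polys_dense:
  fixes f :: "(nat \<Rightarrow> 'g) \<Rightarrow> real"
  assumes f: "continuous_on UNIV f" and "0 < e"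
  shows "\<exists>h. (\<lambda>\<omega>. of_real (h \<omega>)) \<in> trig_polys \<and> (\<forall>\<omega>. \<bar>f \<omega> - h \<omega>\<bar> < e)"
proof -
  let ?R = "{h :: (nat \<Rightarrow> 'g) \<Rightarrow> real. (\<lambda>\<omega>. of_real (h \<omega>)) \<in> trig_polys}"
  have "function_ring_on ?R UNIV"
  proof
    show "compact (UNIV :: (nat \<Rightarrow> 'g) set)" by (rule compact_paths[OF compact_G])
    show "continuous_on UNIV h" if "h \<in> ?R" for h
    proof -
      from that have "(\<lambda>\<omega>. complex_of_real (h \<omega>)) \<in> trig_polys" by simp
      from continuous_on_Re[OF trig_polys_continuous[OF this]] show ?thesis by simp
    qed
    show "(\<lambda>\<omega>. h \<omega> + k \<omega>) \<in> ?R" if "h \<in> ?R" "k \<in> ?R" for h k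
      using trig_polys.add[of "\<lambda>\<omega>. of_real (h \<omega>)" "\<lambda>\<omega>. of_real (k \<omega>)"] that by simp
    show "(\<lambda>\<omega>. h \<omega> * k \<omega>) \<in> ?R" if "h \<in> ?R" "k \<in> ?R" for h k
      using trig_polys_mult[of "\<lambda>\<omega>. of_real (h \<omega>)" "\<lambda>\<omega>. of_real (k \<omega>)"] that by simp
    show "(\<lambda>_. c) \<in> ?R" for c
      using trig_polys.monomial[OF monomials.one, of "of_real c"] by simp
    show "\<exists>f\<in>?R. f x \<noteq> f y" if "x \<noteq> y" for x y
      using trig_polys_separate[OF that] by blast
  qed
  from function_ring_on.Stone_Weierstrass_basic[OF this f \<open>0 < e\<close>] show ?thesis by auto
qed

text \<open>
  A continuous function is uniformly close to a trigonometric polynomial, and the integrals of the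
  latter are invariant under translation by \<open>g\<close>. So \<open>P\<close> and its translate agree on all continuous
  functions, which determines a Radon measure.
\<close>

lemma Hs_mu_subset_H_mu: "Hs_mu P \<subseteq> H_mu P"
proof
  fix g assume g: "g \<in> Hs_mu P"
  let ?T = "\<lambda>(\<omega> :: nat \<Rightarrow> 'g) k. g + \<omega> k"
  have T: "?T \<in> measurable P borel"
    unfolding measurable_cong_sets[OF sets_P refl] by (rule borel_measurable_continuous_onI[OF continuous_translation])
  have "translate g P = P"
  proof (rule radon_prob_eqI[OF compact_paths[OF compact_G] radon_translate[OF radon] radon])
    fix f :: "(nat \<Rightarrow> 'g) \<Rightarrow> real" assume f: "continuous_on UNIV f"
    have "\<bar>(\<integral>\<omega>. f (?T \<omega>) \<partial>P) - (\<integral>\<omega>. f \<omega> \<partial>P)\<bar> \<le> e" if "0 < e" for e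
    proof -
      obtain h where h: "(\<lambda>\<omega>. complex_of_real (h \<omega>)) \<in> trig_polys" "\<And>\<omega>. \<bar>f \<omega> - h \<omega>\<bar> < e / 2"
        using trig_polys_dense[OF f, of "e / 2"] \<open>0 < e\<close> by auto
      have "continuous_on UNIV (\<lambda>\<omega>. complex_of_real (h \<omega>))" by (rule trig_polys_continuous[OF h(1)])
      from continuous_on_Re[OF this] have ch: "continuous_on UNIV h" by simp
      have eq: "(\<integral>\<omega>. h (?T \<omega>) \<partial>P) = (\<integral>\<omega>. h \<omega> \<partial>P)"
        using trig_polys_translate[OF g h(1)] by simp
      note i = continuous_integrable[OF f] continuous_integrable[OF ch]
        continuous_integrable[OF continuous_translated[OF f, of g]] continuous_integrable[OF continuous_translated[OF ch, of g]]
      have close: "\<bar>(\<integral>\<omega>. a \<omega> \<partial>P) - (\<integral>\<omega>. b \<omega> \<partial>P)\<bar> \<le> e / 2"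
        if "integrable P a" "integrable P b" "\<And>\<omega>. \<bar>a \<omega> - b \<omega>\<bar> < e / 2" for a b :: "(nat \<Rightarrow> 'g) \<Rightarrow> real"
      proof -
        have "\<bar>(\<integral>\<omega>. a \<omega> \<partial>P) - (\<integral>\<omega>. b \<omega> \<partial>P)\<bar> = \<bar>\<integral>\<omega>. a \<omega> - b \<omega> \<partial>P\<bar>" using that by simp
        also have "\<dots> \<le> (\<integral>\<omega>. \<bar>a \<omega> - b \<omega>\<bar> \<partial>P)" by (rule integral_abs_bound)
        also have "\<dots> \<le> (\<integral>\<omega>. e / 2 \<partial>P)"
          using that by (intro integral_mono) (auto simp: less_imp_le)
        finally show ?thesis by (simp add: prob_space[simplified])
      qed
      show ?thesis using close[OF i(1,2) h(2)] close[OF i(3,4) h(2)] eq by linarith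
    qed
    then have "\<bar>(\<integral>\<omega>. f (?T \<omega>) \<partial>P) - (\<integral>\<omega>. f \<omega> \<partial>P)\<bar> \<le> 0" by (rule field_le_epsilon[of _ 0, simplified])
    then have "(\<integral>\<omega>. f (?T \<omega>) \<partial>P) = (\<integral>\<omega>. f \<omega> \<partial>P)" by simp
    then show "(\<integral>\<omega>. f \<omega> \<partial>translate g P) = (\<integral>\<omega>. f \<omega> \<partial>P)"
      unfolding translate_def using integral_distr[OF T borel_measurable_continuous_onI[OF f]] by simp
  qed
  then show "g \<in> H_mu P" by (simp add: H_mu_def)
qed

end

theorem theorem1p5:
  fixes \<mu> :: "nat \<Rightarrow> 'g::{topological_group_add,t2_space} measure"
    and P :: "(nat \<Rightarrow> 'g) measure"
  assumes "compact (UNIV :: 'g set)"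
    and "\<And>k. prob_space (\<mu> k) \<and> sets (\<mu> k) = sets borel"
    and "P \<in> extremal_solutions \<mu>"
  shows "H_mu P \<subseteq> Hs_mu P \<and> ((\<forall>x y :: 'g. x + y = y + x) \<longrightarrow> H_mu P = Hs_mu P)"
proof (intro conjI impI)
  interpret solution \<mu> P
    using assms(3) by unfold_locales (simp add: extremal_solutions_def)
  show sub: "H_mu P \<subseteq> Hs_mu P" by (rule H_mu_subset_Hs_mu)
  assume "\<forall>x y :: 'g. x + y = y + x"
  then interpret abelian_solution \<mu> P
    using assms(1,3) by unfold_locales auto
  show "H_mu P = Hs_mu P" using sub Hs_mu_subset_H_mu by (rule antisym)
qed

end
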